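(* Let $\nu>0$, $\gamma>0$ and $\mathbf{f}\in\mathbf{H}^{-1}$, and let $\mathcal{M}>0$ be a constant such that $c^*(\mathbf{u},\mathbf{v},\mathbf{w})\le \mathcal{M}\|\nabla\mathbf{u}\|\,\|\nabla\mathbf{v}\|\,\|\nabla\mathbf{w}\|$ for all $\mathbf{u},\mathbf{v},\mathbf{w}\in\mathbf{X}$. Let $(\mathbf{u}_0,p_0)=(\mathbf{0},0)$ and suppose that $(\tilde{\mathbf{u}}_k,\mathbf{u}_k,p_k)\in \mathbf{X}\times\mathbf{V}\times Q$, $k=1,2,\dots$, is a solution of the Steady Incremental Viscosity Splitting algorithm, i.e. for every $k\ge 1$: Step 1: $a(\tilde{\mathbf{u}}_k,\mathbf{v})+c^*(\mathbf{u}_{k-1},\tilde{\mathbf{u}}_k,\mathbf{v})+b(p_{k-1},\mathbf{v})=\langle\mathbf{f},\mathbf{v}\rangle$ for all $\mathbf{v}\in\mathbf{X}$; Step 2: $a(\mathbf{u}_k-\tilde{\mathbf{u}}_k,\mathbf{v})+b(p_k-p_{k-1},\mathbf{v})=0$ for all $\mathbf{v}\in\mathbf{X}$, and $b(q,\mathbf{u}_k)=0$ for all $q\in Q$. Assume $$\Lambda:=\nu^{-2}\mathcal{M}\|\mathbf{f}\|_{-1}<\frac{1}{\sqrt{2}},$$ let $(\mathbf{u},p)\in\mathbf{X}\times Q$ be the unique solution of the stationary Navier-Stokes problem $a(\mathbf{u},\mathbf{v})+c^*(\mathbf{u},\mathbf{u},\mathbf{v})+b(p,\mathbf{v})=\langle\mathbf{f},\mathbf{v}\rangle$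 for all $\mathbf{v}\in\mathbf{X}$, $b(q,\mathbf{u})=0$ for all $q\in Q$, and set $\mathbf{e}_k=\mathbf{u}-\mathbf{u}_k$, $\tilde{\mathbf{e}}_k=\mathbf{u}-\tilde{\mathbf{u}}_k$, $\delta_k=p-p_k$ for $k\ge1$. Then there exist $\omega_1,\omega_2,\omega_3>0$ and $\tau\in(0,1)$, independent of $k$, such that the sequence $$\psi_k:=\omega_1\|\nabla\mathbf{e}_k\|^2+\omega_2\left(\frac{\nu}{4}\|\nabla\tilde{\mathbf{e}}_k\|^2+\frac{\gamma}{2}\left(\|\nabla\cdot\tilde{\mathbf{e}}_k\|^2+\|\nabla\cdot\mathbf{e}_k\|^2\right)\right)+\omega_3\|\nabla\delta_k\|_{\mathrm{L}^{-1}}^2$$ is contractive, i.e. $\psi_{k+1}\le\tau\,\psi_k$ for all $k\ge1$.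
   Context: $\Omega\subset\mathbb{R}^d$, $d\in\{2,3\}$, is a bounded connected open set with Lipschitz boundary. $(\cdot,\cdot)$ and $\|\cdot\|$ denote the $L^2(\Omega)$ inner product and norm (for scalar, vector and matrix fields). $\mathbf{X}=H_0^1(\Omega)^d$ (normed by $\|\nabla\cdot\|$), $Q=L^2_0(\Omega)$ (mean-zero $L^2$ functions), $\mathbf{H}^{-1}$ is the dual of $\mathbf{X}$ with duality pairing $\langle\cdot,\cdot\rangle$ and norm $\|\mathbf{f}\|_{-1}=\langle\mathbf{f},(-\Delta)^{-1}\mathbf{f}\rangle^{1/2}$, where $-\Delta:\mathbf{X}\to\mathbf{H}^{-1}$ is the Dirichlet Laplacian; equivalently $\|\mathbf{f}\|_{-1}=\sup_{\mathbf{0}\ne\mathbf{v}\in\mathbf{X}}\langle\mathbf{f},\mathbf{v}\rangle/\|\nabla\mathbf{v}\|$. The forms are $$a(\mathbf{u},\mathbf{v})=\nu(\nabla\mathbf{u},\nabla\mathbf{v})+\gamma(\nabla\cdot\mathbf{u},\nabla\cdot\mathbf{v}),\quad b(p,\mathbf{v})=-(p,\nabla\cdot\mathbf{v}),$$ $$c^*(\mathbf{u},\mathbf{v},\mathbf{w})=((\mathbf{u}\cdot\nabla)\mathbf{v},\mathbf{w})+\tfrac12((\nabla\cdot\mathbf{u})\mathbf{v},\mathbf{w}).$$ $\mathbf{V}=\{\mathbf{v}\in\mathbf{X}: b(q,\mathbf{v})=0\ \forall q\in Q\}=\{\mathbf{v}\in\mathbf{X}:\nabla\cdot\mathbf{v}=0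 \text{ in } \Omega\}$, with the norm of $\mathbf{X}$. There is $\beta>0$ depending only on $\Omega$ such that the inf-sup condition $\inf_{0\neq q\in Q}\sup_{\mathbf{0}\neq\mathbf{v}\in\mathbf{X}} b(q,\mathbf{v})/(\|q\|\,\|\nabla\mathbf{v}\|)\ge\beta$ holds. Under the stated condition on $\Lambda$ the stationary Navier-Stokes problem has a unique solution. For $q\in Q$, $\nabla q\in\mathbf{H}^{-1}$ is the functional $\langle\nabla q,\mathbf{v}\rangle=b(q,\mathbf{v})$. The operator $\mathrm{L}=-\nu\Delta-\gamma\nabla(\nabla\cdot):\mathbf{X}\to\mathbf{H}^{-1}$ is defined by $\langle\mathrm{L}\mathbf{u},\mathbf{v}\rangle=a(\mathbf{u},\mathbf{v})$; it is invertible, and $\|\mathbf{g}\|_{\mathrm{L}^{-1}}:=\sqrt{\langle\mathrm{L}^{-1}\mathbf{g},\mathbf{g}\rangle}$ for $\mathbf{g}\in\mathbf{H}^{-1}$. *)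

theory Defs
  imports "HOL-Analysis.Analysis"
begin

section \<open>Lipschitz domains\<close>

text \<open>
  Near each boundary point, \<open>\<Omega>\<close> is the strict epigraph, in some direction \<open>n\<close>, of a Lipschitz
  function \<open>h\<close> on the hyperplane orthogonal to \<open>n\<close>; the point \<open>y\<close> has height \<open>y \<bullet> n\<close> over its
  projection \<open>y - (y \<bullet> n) *\<^sub>R n\<close>.  This is the usual definition by a rotated coordinate system.
\<close>

definition lipschitz_boundary :: "(real ^ 'n) set \<Rightarrow> bool" where
  "lipschitz_boundary \<Omega> \<longleftrightarrow>
     (\<forall>x \<in> frontier \<Omega>. \<exists>r > 0. \<exists>n h L.
        norm n = 1 \<and> L-lipschitz_on {z. z \<bullet> n = 0} h \<and>
        \<Omega> \<inter> ball x r = {y \<in> ball x r. y \<bullet> n > (h (y - (y \<bullet> n) *\<^sub>R n) :: real)})"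

section \<open>Square-integrable fields\<close>

text \<open>
  Elements of function spaces are represented by functions on the whole of \<open>\<real>\<^sup>d\<close>, not by classes
  modulo almost-everywhere equality on \<open>\<Omega>\<close>; every quantity below sees only the class on \<open>\<Omega>\<close>.
  For matrix fields the inner product of \<^typ>\<open>real ^ 'n ^ 'n\<close> is the Frobenius product.
\<close>

definition L2 :: "(real ^ 'n) set \<Rightarrow> (real ^ 'n \<Rightarrow> 'b::euclidean_space) set" where
  "L2 \<Omega> = {f. f \<in> borel_measurable (lebesgue_on \<Omega>) \<and>
              integrable (lebesgue_on \<Omega>) (\<lambda>x. (norm (f x))\<^sup>2)}"

definition L2_inner ::
    "(real ^ 'n) set \<Rightarrow> (real ^ 'n \<Rightarrow> 'b::euclidean_space) \<Rightarrow> (real ^ 'n \<Rightarrow> 'b) \<Rightarrow> real" where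
  "L2_inner \<Omega> f g = (\<integral>x. f x \<bullet> g x \<partial>lebesgue_on \<Omega>)"

definition L2_norm :: "(real ^ 'n) set \<Rightarrow> (real ^ 'n \<Rightarrow> 'b::euclidean_space) \<Rightarrow> real" where
  "L2_norm \<Omega> f = sqrt (L2_inner \<Omega> f f)"

section \<open>Test functions and weak gradients\<close>

definition partial_deriv :: "'n \<Rightarrow> (real ^ 'n \<Rightarrow> real) \<Rightarrow> real ^ 'n \<Rightarrow> real" where
  "partial_deriv i f x = frechet_derivative f (at x) (axis i 1)"

primrec C_k :: "nat \<Rightarrow> (real ^ 'n \<Rightarrow> real) \<Rightarrow> bool" where
  "C_k 0 f \<longleftrightarrow> continuous_on UNIV f"
| "C_k (Suc k) f \<longleftrightarrow> (\<forall>x. f differentiable (at x)) \<and> (\<forall>i. C_k k (partial_deriv i f))"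

definition test_functions :: "(real ^ 'n) set \<Rightarrow> (real ^ 'n \<Rightarrow> real) set" where
  "test_functions \<Omega> =
     {\<phi>. (\<forall>k. C_k k \<phi>) \<and> compact (closure {x. \<phi> x \<noteq> 0}) \<and> closure {x. \<phi> x \<noteq> 0} \<subseteq> \<Omega>}"

definition has_weak_gradient ::
    "(real ^ 'n) set \<Rightarrow> (real ^ 'n \<Rightarrow> real) \<Rightarrow> (real ^ 'n \<Rightarrow> real ^ 'n) \<Rightarrow> bool" where
  "has_weak_gradient \<Omega> u g \<longleftrightarrow>
     (\<forall>\<phi> \<in> test_functions \<Omega>. \<forall>i.
        (\<integral>x. u x * partial_deriv i \<phi> x \<partial>lebesgue_on \<Omega>) = - (\<integral>x. g x $ i * \<phi> x \<partial>lebesgue_on \<Omega>))"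

definition H1 :: "(real ^ 'n) set \<Rightarrow> (real ^ 'n \<Rightarrow> real) set" where
  "H1 \<Omega> = {u \<in> L2 \<Omega>. \<exists>g \<in> L2 \<Omega>. has_weak_gradient \<Omega> u g}"

text \<open>Weak gradients are unique up to null sets; for \<open>u \<in> H1 \<Omega>\<close> one representative is chosen.\<close>

definition weak_grad :: "(real ^ 'n) set \<Rightarrow> (real ^ 'n \<Rightarrow> real) \<Rightarrow> real ^ 'n \<Rightarrow> real ^ 'n" where
  "weak_grad \<Omega> u = (SOME g. g \<in> L2 \<Omega> \<and> has_weak_gradient \<Omega> u g)"

definition H1_norm :: "(real ^ 'n) set \<Rightarrow> (real ^ 'n \<Rightarrow> real) \<Rightarrow> real" where
  "H1_norm \<Omega> u = sqrt ((L2_norm \<Omega> u)\<^sup>2 + (L2_norm \<Omega> (weak_grad \<Omega> u))\<^sup>2)"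

definition H1_0 :: "(real ^ 'n) set \<Rightarrow> (real ^ 'n \<Rightarrow> real) set" where
  "H1_0 \<Omega> = {u \<in> H1 \<Omega>. \<forall>\<epsilon> > 0. \<exists>\<phi> \<in> test_functions \<Omega>. H1_norm \<Omega> (\<lambda>x. u x - \<phi> x) < \<epsilon>}"

section \<open>Velocity and pressure spaces\<close>

definition X_space :: "(real ^ 'n) set \<Rightarrow> (real ^ 'n \<Rightarrow> real ^ 'n) set" where
  "X_space \<Omega> = {v. \<forall>i. (\<lambda>x. v x $ i) \<in> H1_0 \<Omega>}"

text \<open>The \<open>(i, j)\<close> entry is \<open>\<partial>\<^sub>j v\<^sub>i\<close>, so that \<open>((u \<bullet> \<nabla>) v) x\<close> is \<open>vgrad \<Omega> v x *v u x\<close>.\<close>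

definition vgrad ::
    "(real ^ 'n) set \<Rightarrow> (real ^ 'n \<Rightarrow> real ^ 'n) \<Rightarrow> real ^ 'n \<Rightarrow> real ^ 'n ^ 'n" where
  "vgrad \<Omega> v x = (\<chi> i. weak_grad \<Omega> (\<lambda>y. v y $ i) x)"

definition vdiv :: "(real ^ 'n) set \<Rightarrow> (real ^ 'n \<Rightarrow> real ^ 'n) \<Rightarrow> real ^ 'n \<Rightarrow> real" where
  "vdiv \<Omega> v x = trace (vgrad \<Omega> v x)"

definition Q_space :: "(real ^ 'n) set \<Rightarrow> (real ^ 'n \<Rightarrow> real) set" where
  "Q_space \<Omega> = {q \<in> L2 \<Omega>. (\<integral>x. q x \<partial>lebesgue_on \<Omega>) = 0}"

section \<open>Forms\<close>

definition a_form ::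
    "real \<Rightarrow> real \<Rightarrow> (real ^ 'n) set \<Rightarrow> (real ^ 'n \<Rightarrow> real ^ 'n) \<Rightarrow> (real ^ 'n \<Rightarrow> real ^ 'n) \<Rightarrow> real"
  where
  "a_form \<nu> \<gamma> \<Omega> u v =
     \<nu> * L2_inner \<Omega> (vgrad \<Omega> u) (vgrad \<Omega> v) + \<gamma> * L2_inner \<Omega> (vdiv \<Omega> u) (vdiv \<Omega> v)"

definition b_form ::
    "(real ^ 'n) set \<Rightarrow> (real ^ 'n \<Rightarrow> real) \<Rightarrow> (real ^ 'n \<Rightarrow> real ^ 'n) \<Rightarrow> real" where
  "b_form \<Omega> p v = - L2_inner \<Omega> p (vdiv \<Omega> v)"

definition c_form ::
    "(real ^ 'n) set \<Rightarrow> (real ^ 'n \<Rightarrow> real ^ 'n) \<Rightarrow> (real ^ 'n \<Rightarrow> real ^ 'n) \<Rightarrow>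
     (real ^ 'n \<Rightarrow> real ^ 'n) \<Rightarrow> real" where
  "c_form \<Omega> u v w =
     L2_inner \<Omega> (\<lambda>x. vgrad \<Omega> v x *v u x) w + 1 / 2 * L2_inner \<Omega> (\<lambda>x. vdiv \<Omega> u x *\<^sub>R v x) w"

definition V_space :: "(real ^ 'n) set \<Rightarrow> (real ^ 'n \<Rightarrow> real ^ 'n) set" where
  "V_space \<Omega> = {v \<in> X_space \<Omega>. \<forall>q \<in> Q_space \<Omega>. b_form \<Omega> q v = 0}"

section \<open>The dual space and its norms\<close>

text \<open>
  A functional is a function on all fields, of which only the values on \<open>X_space \<Omega>\<close> matter; the
  duality pairing is application.  Boundedness makes it respect almost-everywhere equality.
\<close>

type_synonym 'n functional = "(real ^ 'n \<Rightarrow> real ^ 'n) \<Rightarrow> real"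

definition X_dual :: "(real ^ 'n) set \<Rightarrow> 'n functional set" where
  "X_dual \<Omega> = {f.
     (\<forall>u \<in> X_space \<Omega>. \<forall>v \<in> X_space \<Omega>. f (\<lambda>x. u x + v x) = f u + f v) \<and>
     (\<forall>c. \<forall>v \<in> X_space \<Omega>. f (\<lambda>x. c *\<^sub>R v x) = c * f v) \<and>
     (\<exists>C. \<forall>v \<in> X_space \<Omega>. \<bar>f v\<bar> \<le> C * L2_norm \<Omega> (vgrad \<Omega> v))}"

definition neg_laplacian :: "(real ^ 'n) set \<Rightarrow> (real ^ 'n \<Rightarrow> real ^ 'n) \<Rightarrow> 'n functional" where
  "neg_laplacian \<Omega> u = (\<lambda>v. L2_inner \<Omega> (vgrad \<Omega> u) (vgrad \<Omega> v))"

definition L_op ::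
    "real \<Rightarrow> real \<Rightarrow> (real ^ 'n) set \<Rightarrow> (real ^ 'n \<Rightarrow> real ^ 'n) \<Rightarrow> 'n functional" where
  "L_op \<nu> \<gamma> \<Omega> u = (\<lambda>v. a_form \<nu> \<gamma> \<Omega> u v)"

text \<open>
  The inverse of an operator from \<open>X_space \<Omega>\<close> onto its dual; the preimage is unique up to
  almost-everywhere equality, and a representative is chosen.
\<close>

definition X_inverse ::
    "(real ^ 'n) set \<Rightarrow> ((real ^ 'n \<Rightarrow> real ^ 'n) \<Rightarrow> 'n functional) \<Rightarrow>
     'n functional \<Rightarrow> real ^ 'n \<Rightarrow> real ^ 'n" where
  "X_inverse \<Omega> A g = (SOME u. u \<in> X_space \<Omega> \<and> (\<forall>v \<in> X_space \<Omega>. A u v = g v))"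

definition dual_norm :: "(real ^ 'n) set \<Rightarrow> 'n functional \<Rightarrow> real" where
  "dual_norm \<Omega> f = sqrt (f (X_inverse \<Omega> (neg_laplacian \<Omega>) f))"

definition L_inv_norm :: "real \<Rightarrow> real \<Rightarrow> (real ^ 'n) set \<Rightarrow> 'n functional \<Rightarrow> real" where
  "L_inv_norm \<nu> \<gamma> \<Omega> g = sqrt (g (X_inverse \<Omega> (L_op \<nu> \<gamma> \<Omega>) g))"

definition pressure_grad :: "(real ^ 'n) set \<Rightarrow> (real ^ 'n \<Rightarrow> real) \<Rightarrow> 'n functional" where
  "pressure_grad \<Omega> q = (\<lambda>v. b_form \<Omega> q v)"

section \<open>The stationary Navier-Stokes problem and the splitting algorithm\<close>

definition navier_stokes_solution ::
    "real \<Rightarrow> real \<Rightarrow> (real ^ 'n) set \<Rightarrow> 'n functional \<Rightarrow>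
     (real ^ 'n \<Rightarrow> real ^ 'n) \<Rightarrow> (real ^ 'n \<Rightarrow> real) \<Rightarrow> bool" where
  "navier_stokes_solution \<nu> \<gamma> \<Omega> f u p \<longleftrightarrow>
     u \<in> X_space \<Omega> \<and> p \<in> Q_space \<Omega> \<and>
     (\<forall>v \<in> X_space \<Omega>. a_form \<nu> \<gamma> \<Omega> u v + c_form \<Omega> u u v + b_form \<Omega> p v = f v) \<and>
     (\<forall>q \<in> Q_space \<Omega>. b_form \<Omega> q u = 0)"

text \<open>The value \<open>ut 0\<close> is not used.\<close>

definition sivs_solution ::
    "real \<Rightarrow> real \<Rightarrow> (real ^ 'n) set \<Rightarrow> 'n functional \<Rightarrow>
     (nat \<Rightarrow> real ^ 'n \<Rightarrow> real ^ 'n) \<Rightarrow> (nat \<Rightarrow> real ^ 'n \<Rightarrow> real ^ 'n) \<Rightarrow>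
     (nat \<Rightarrow> real ^ 'n \<Rightarrow> real) \<Rightarrow> bool" where
  "sivs_solution \<nu> \<gamma> \<Omega> f ut us ps \<longleftrightarrow>
     us 0 = (\<lambda>x. 0) \<and> ps 0 = (\<lambda>x. 0) \<and>
     (\<forall>k \<ge> 1.
        ut k \<in> X_space \<Omega> \<and> us k \<in> V_space \<Omega> \<and> ps k \<in> Q_space \<Omega> \<and>
        (\<forall>v \<in> X_space \<Omega>.
           a_form \<nu> \<gamma> \<Omega> (ut k) v + c_form \<Omega> (us (k - 1)) (ut k) v + b_form \<Omega> (ps (k - 1)) v = f v) \<and>
        (\<forall>v \<in> X_space \<Omega>.
           a_form \<nu> \<gamma> \<Omega> (\<lambda>x. us k x - ut k x) v + b_form \<Omega> (\<lambda>x. ps k x - ps (k - 1) x) v = 0) \<and>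
        (\<forall>q \<in> Q_space \<Omega>. b_form \<Omega> q (us k) = 0))"

end

theory Submission
  imports Defs
begin

text \<open>
  Let \<open>a\<close> be the energy inner product \<open>\<nu>(\<nabla>u, \<nabla>v) + \<gamma>(div u, div v)\<close> and let \<open>G q\<close> be the element of the
  velocity space that represents the pressure gradient: \<open>a(G q, v) = b(q, v)\<close> for all \<open>v\<close>. Then the
  \<open>L\<^sup>-\<^sup>1\<close> norm of \<open>\<nabla>q\<close> is the energy norm of \<open>G q\<close>, and Step 2 of the algorithm says that
  \<open>et\<^sub>k\<^sub>+\<^sub>1 = e\<^sub>k\<^sub>+\<^sub>1 + G \<delta>\<^sub>k\<^sub>+\<^sub>1 - G \<delta>\<^sub>k\<close>, where \<open>e\<^sub>k\<^sub>+\<^sub>1\<close> is \<open>a\<close>-orthogonal to the range of \<open>G\<close> because it is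
  divergence free. Step 2 is thus a projection, and it obeys Pythagoras' theorem.

  Subtracting Step 1 from the Navier-Stokes equation gives, for every \<open>v\<close>,
  \<open>a(et\<^sub>k\<^sub>+\<^sub>1, v) + c(e\<^sub>k, u, v) + c(u\<^sub>k, et\<^sub>k\<^sub>+\<^sub>1, v) + a(G \<delta>\<^sub>k, v) = 0\<close> (\<open>error_equation\<close>), which is
  tested with two functions.

  With \<open>v = et\<^sub>k\<^sub>+\<^sub>1\<close> the term \<open>c(u\<^sub>k, v, v)\<close> vanishes by skew-symmetry, the projection identity turns
  the pressure term into a difference of squares, and \<open>M \<parallel>\<nabla>u\<parallel> \<le> \<nu> \<Lambda>\<close> bounds what is left
  (\<open>energy_estimate\<close>). Since \<open>\<Lambda>\<^sup>2 < 1/2\<close>, the velocity error is damped, but the pressure error is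
  only seen not to grow.

  With \<open>v = G \<delta>\<^sub>k\<close> the same equation bounds the pressure error by the two velocity errors
  (\<open>pressure_estimate\<close>); the constant involves \<open>sup \<parallel>\<nabla>u\<^sub>k\<parallel>\<close>, which is finite by the first estimate.
  Giving up a small multiple of the dissipation of \<open>et\<close> in the first estimate therefore
  also damps the pressure, and the weighted sum contracts (\<open>contraction_of_coupled_estimates\<close>).

  The rest of the work puts these manipulations on solid ground. Weak gradients are unique
  (\<open>fundamental_lemma_calculus_of_variations\<close>), so the forms are bilinear; the velocity space is
  complete (\<open>L2_complete\<close>, \<open>Poincare\<close>), so \<open>G\<close> and the dual norm are given by Riesz representation
  (\<open>Riesz_representation\<close>). The convection form is a sum of Lebesgue integrals, which is trilinear only where
  these converge absolutely; this is where the dimension matters, through the embedding of \<open>H\<^sub>0\<^sup>1\<close> into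
  \<open>L\<^sup>4\<close> (\<open>Ladyzhenskaya_inequality\<close>, \<open>H1_0_L4\<close>). Once it is trilinear, its boundedness extends
  skew-symmetry from test functions to the whole space (\<open>c_skew\<close>).
\<close>

section \<open>Square-integrable fields\<close>

lemma L2_measurable: "f \<in> L2 \<Omega> \<Longrightarrow> f \<in> borel_measurable (lebesgue_on \<Omega>)"
  by (simp add: L2_def)

lemma L2_integrable_sq: "f \<in> L2 \<Omega> \<Longrightarrow> integrable (lebesgue_on \<Omega>) (\<lambda>x. (norm (f x))\<^sup>2)"
  by (simp add: L2_def)

lemma L2_bound:
  fixes f :: "real ^ 'n \<Rightarrow> 'b::euclidean_space"
  assumes "f \<in> borel_measurable (lebesgue_on \<Omega>)" "integrable (lebesgue_on \<Omega>) h"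
    "\<And>x. (norm (f x))\<^sup>2 \<le> h x"
  shows "f \<in> L2 \<Omega>"
  unfolding L2_def
proof (intro CollectI conjI assms(1))
  show "integrable (lebesgue_on \<Omega>) (\<lambda>x. (norm (f x))\<^sup>2)"
    by (rule Bochner_Integration.integrable_bound[OF assms(2)])
       (use assms in \<open>auto intro!: AE_I2 order_trans[OF _ abs_ge_self]\<close>)
qed

lemma norm_add_sq_le: "(norm (a + b))\<^sup>2 \<le> 2 * (norm a)\<^sup>2 + 2 * (norm b)\<^sup>2"
  for a b :: "'b::real_inner"
proof -
  have "0 \<le> (norm (a - b))\<^sup>2" by simp
  then show ?thesis
    by (simp add: power2_norm_eq_inner inner_add_left inner_add_right inner_diff_left
        inner_diff_right inner_commute)
qed

lemma abs_inner_le_sq: "\<bar>a \<bullet> b\<bar> \<le> (norm a)\<^sup>2 + (norm b)\<^sup>2" for a b :: "'b::real_inner"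
proof -
  have "\<bar>a \<bullet> b\<bar> \<le> norm a * norm b" by (rule Cauchy_Schwarz_ineq2)
  moreover have "0 \<le> (norm a - norm b)\<^sup>2" "0 \<le> (norm a)\<^sup>2" "0 \<le> (norm b)\<^sup>2" by simp_all
  ultimately show ?thesis by (simp add: power2_diff)
qed

lemma L2_add: "f \<in> L2 \<Omega> \<Longrightarrow> g \<in> L2 \<Omega> \<Longrightarrow> (\<lambda>x. f x + g x) \<in> L2 \<Omega>"
  by (rule L2_bound[where h = "\<lambda>x. 2 * (norm (f x))\<^sup>2 + 2 * (norm (g x))\<^sup>2"])
     (auto intro!: borel_measurable_add Bochner_Integration.integrable_add integrable_mult_right norm_add_sq_le
       simp: L2_measurable L2_integrable_sq)

lemma L2_scale: "f \<in> L2 \<Omega> \<Longrightarrow> (\<lambda>x. c *\<^sub>R f x) \<in> L2 \<Omega>"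
  by (rule L2_bound[where h = "\<lambda>x. c\<^sup>2 * (norm (f x))\<^sup>2"])
     (auto intro!: borel_measurable_scaleR integrable_mult_right
       simp: L2_measurable L2_integrable_sq power_mult_distrib)

lemma L2_diff: "f \<in> L2 \<Omega> \<Longrightarrow> g \<in> L2 \<Omega> \<Longrightarrow> (\<lambda>x. f x - g x) \<in> L2 \<Omega>"
  using L2_add[OF _ L2_scale[of g \<Omega> "-1"]] by simp

lemma L2_zero: "(\<lambda>x. 0) \<in> L2 \<Omega>"
  by (simp add: L2_def)

lemma L2_sum: "finite I \<Longrightarrow> (\<And>i. i \<in> I \<Longrightarrow> f i \<in> L2 \<Omega>) \<Longrightarrow> (\<lambda>x. \<Sum>i\<in>I. f i x) \<in> L2 \<Omega>"
  by (induction I rule: finite_induct) (auto intro: L2_zero L2_add)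

lemma L2_integrable_inner:
  assumes "f \<in> L2 \<Omega>" "g \<in> L2 \<Omega>"
  shows "integrable (lebesgue_on \<Omega>) (\<lambda>x. f x \<bullet> g x)"
  by (rule Bochner_Integration.integrable_bound
      [OF Bochner_Integration.integrable_add[OF L2_integrable_sq L2_integrable_sq, OF assms]])
     (use assms in \<open>auto intro!: AE_I2 borel_measurable_inner abs_inner_le_sq
       order_trans[OF abs_inner_le_sq] simp: L2_measurable\<close>)

lemma L2_inner_commute: "L2_inner \<Omega> f g = L2_inner \<Omega> g f"
  by (simp add: L2_inner_def inner_commute)

lemma L2_inner_add_left:
  "f \<in> L2 \<Omega> \<Longrightarrow> g \<in> L2 \<Omega> \<Longrightarrow> h \<in> L2 \<Omega> \<Longrightarrow>
    L2_inner \<Omega> (\<lambda>x. f x + g x) h = L2_inner \<Omega> f h + L2_inner \<Omega> g h"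
  by (simp add: L2_inner_def inner_add_left L2_integrable_inner)

lemma L2_inner_diff_left:
  "f \<in> L2 \<Omega> \<Longrightarrow> g \<in> L2 \<Omega> \<Longrightarrow> h \<in> L2 \<Omega> \<Longrightarrow>
    L2_inner \<Omega> (\<lambda>x. f x - g x) h = L2_inner \<Omega> f h - L2_inner \<Omega> g h"
  by (simp add: L2_inner_def inner_diff_left L2_integrable_inner)

lemma L2_inner_scale_left: "L2_inner \<Omega> (\<lambda>x. c *\<^sub>R f x) h = c * L2_inner \<Omega> f h"
  by (simp add: L2_inner_def)

lemma L2_inner_add_right:
  "f \<in> L2 \<Omega> \<Longrightarrow> g \<in> L2 \<Omega> \<Longrightarrow> h \<in> L2 \<Omega> \<Longrightarrow>
    L2_inner \<Omega> h (\<lambda>x. f x + g x) = L2_inner \<Omega> h f + L2_inner \<Omega> h g"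
  by (simp add: L2_inner_def inner_add_right L2_integrable_inner)

lemma L2_inner_scale_right: "L2_inner \<Omega> h (\<lambda>x. c *\<^sub>R f x) = c * L2_inner \<Omega> h f"
  by (simp add: L2_inner_def)

lemma L2_inner_self_nonneg: "0 \<le> L2_inner \<Omega> f f"
  by (simp add: L2_inner_def)

lemma L2_norm_nonneg [simp]: "0 \<le> L2_norm \<Omega> f"
  by (simp add: L2_norm_def L2_inner_self_nonneg)

lemma L2_norm_sq: "(L2_norm \<Omega> f)\<^sup>2 = L2_inner \<Omega> f f"
  by (simp add: L2_norm_def L2_inner_self_nonneg)

lemma L2_inner_self: "L2_inner \<Omega> f f = (\<integral>x. (norm (f x))\<^sup>2 \<partial>lebesgue_on \<Omega>)"
  by (simp add: L2_inner_def power2_norm_eq_inner)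

lemma L2_inner_cong_AE:
  assumes "AE x in lebesgue_on \<Omega>. f x = f' x" "AE x in lebesgue_on \<Omega>. g x = g' x"
    "f \<in> L2 \<Omega>" "f' \<in> L2 \<Omega>" "g \<in> L2 \<Omega>" "g' \<in> L2 \<Omega>"
  shows "L2_inner \<Omega> f g = L2_inner \<Omega> f' g'"
  unfolding L2_inner_def
proof (rule integral_cong_AE)
  show "AE x in lebesgue_on \<Omega>. f x \<bullet> g x = f' x \<bullet> g' x"
    using assms(1,2) by eventually_elim simp
qed (use assms in \<open>auto intro!: borel_measurable_inner simp: L2_measurable\<close>)

lemma L2_norm_cong_AE:
  assumes "AE x in lebesgue_on \<Omega>. f x = f' x" "f \<in> L2 \<Omega>" "f' \<in> L2 \<Omega>"
  shows "L2_norm \<Omega> f = L2_norm \<Omega> f'"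
  unfolding L2_norm_def using L2_inner_cong_AE[OF assms(1) assms(1)] assms by simp

lemma L2_norm_scale: "L2_norm \<Omega> (\<lambda>x. c *\<^sub>R f x) = \<bar>c\<bar> * L2_norm \<Omega> f"
proof -
  have "L2_inner \<Omega> (\<lambda>x. c *\<^sub>R f x) (\<lambda>x. c *\<^sub>R f x) = c\<^sup>2 * L2_inner \<Omega> f f"
    by (simp add: L2_inner_scale_left L2_inner_scale_right power2_eq_square)
  then show ?thesis by (simp add: L2_norm_def real_sqrt_mult)
qed

text \<open>
  Serves the Cauchy-Schwarz inequality and, with \<open>a = 0\<close>, the Euler-Lagrange equation of a quadratic
  minimisation problem.
\<close>

lemma quadratic_nonneg_imp_discriminant:
  fixes a b c :: real
  assumes "\<And>t. 0 \<le> a + 2 * t * b + t\<^sup>2 * c"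
  shows "b\<^sup>2 \<le> a * c"
proof (cases "c = 0")
  case True
  have "b = 0"
  proof (rule ccontr)
    assume "b \<noteq> 0"
    then show False using assms[of "- (a + 1) / (2 * b)"] True by (simp add: field_simps)
  qed
  then show ?thesis using True by simp
next
  case False
  have "c > 0"
  proof (rule ccontr)
    assume "\<not> c > 0"
    with False have c: "c < 0" by simp
    \<comment> \<open>at \<open>t\<close> and \<open>- t\<close> the linear terms cancel, and \<open>t\<^sup>2 c\<close> beats \<open>a\<close>\<close>
    define t where "t = 1 + \<bar>a\<bar> / \<bar>c\<bar>"
    have "t \<ge> 1" by (simp add: t_def)
    then have "t\<^sup>2 \<ge> t" using self_le_power[of t 2] by simp
    then have "t\<^sup>2 * c \<le> t * c" using c by (simp add: mult_right_mono_neg)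
    also have "t * c = c - \<bar>a\<bar>" using c by (simp add: t_def field_simps)
    finally have "a + t\<^sup>2 * c < 0" using c by simp
    moreover have "0 \<le> a + t\<^sup>2 * c" using assms[of t] assms[of "-t"] by simp
    ultimately show False by simp
  qed
  have "0 \<le> a + 2 * (- b / c) * b + (- b / c)\<^sup>2 * c" by (rule assms)
  also have "\<dots> = a - b\<^sup>2 / c" using \<open>c > 0\<close> by (simp add: field_simps power2_eq_square)
  finally show ?thesis using \<open>c > 0\<close> by (simp add: field_simps)
qed

lemma L2_inner_add_scale_self:
  assumes "f \<in> L2 \<Omega>" "g \<in> L2 \<Omega>"
  shows "L2_inner \<Omega> (\<lambda>x. f x + t *\<^sub>R g x) (\<lambda>x. f x + t *\<^sub>R g x)
    = L2_inner \<Omega> f f + 2 * t * L2_inner \<Omega> f g + t\<^sup>2 * L2_inner \<Omega> g g"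
  using assms
  by (simp add: L2_inner_add_left L2_inner_add_right L2_scale L2_add L2_inner_scale_left
      L2_inner_scale_right L2_inner_commute[of \<Omega> g f] power2_eq_square algebra_simps)

lemma L2_Cauchy_Schwarz:
  assumes "f \<in> L2 \<Omega>" "g \<in> L2 \<Omega>"
  shows "\<bar>L2_inner \<Omega> f g\<bar> \<le> L2_norm \<Omega> f * L2_norm \<Omega> g"
proof -
  have "(L2_inner \<Omega> f g)\<^sup>2 \<le> L2_inner \<Omega> f f * L2_inner \<Omega> g g"
    by (rule quadratic_nonneg_imp_discriminant)
       (use assms in \<open>simp add: L2_inner_add_scale_self[symmetric] L2_inner_self_nonneg\<close>)
  also have "\<dots> = (L2_norm \<Omega> f * L2_norm \<Omega> g)\<^sup>2"
    by (simp add: power_mult_distrib L2_norm_sq)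
  finally show ?thesis by (metis L2_norm_nonneg abs_le_square_iff abs_of_nonneg mult_nonneg_nonneg)
qed

lemma L2_triangle:
  assumes "f \<in> L2 \<Omega>" "g \<in> L2 \<Omega>"
  shows "L2_norm \<Omega> (\<lambda>x. f x + g x) \<le> L2_norm \<Omega> f + L2_norm \<Omega> g"
proof (rule power2_le_imp_le)
  have "(L2_norm \<Omega> (\<lambda>x. f x + g x))\<^sup>2 = L2_inner \<Omega> f f + 2 * L2_inner \<Omega> f g + L2_inner \<Omega> g g"
    using L2_inner_add_scale_self[OF assms, of 1] by (simp add: L2_norm_sq)
  also have "\<dots> \<le> (L2_norm \<Omega> f + L2_norm \<Omega> g)\<^sup>2"
    using L2_Cauchy_Schwarz[OF assms] by (simp add: power2_sum L2_norm_sq)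
  finally show "(L2_norm \<Omega> (\<lambda>x. f x + g x))\<^sup>2 \<le> (L2_norm \<Omega> f + L2_norm \<Omega> g)\<^sup>2" .
qed simp

lemma L2_norm_minus_commute: "L2_norm \<Omega> (\<lambda>x. f x - g x) = L2_norm \<Omega> (\<lambda>x. g x - f x)"
  using L2_norm_scale[of \<Omega> "-1" "\<lambda>x. f x - g x"] by simp

lemma L2_triangle_diff:
  assumes "f \<in> L2 \<Omega>" "g \<in> L2 \<Omega>" "h \<in> L2 \<Omega>"
  shows "L2_norm \<Omega> (\<lambda>x. f x - h x) \<le> L2_norm \<Omega> (\<lambda>x. f x - g x) + L2_norm \<Omega> (\<lambda>x. g x - h x)"
  using L2_triangle[OF L2_diff[OF assms(1,2)] L2_diff[OF assms(2,3)]] by simp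

lemma lebesgue_on_finite_measure:
  assumes "bounded \<Omega>" "open \<Omega>"
  shows "finite_measure (lebesgue_on \<Omega>)"
proof (rule finite_measureI)
  have "\<Omega> \<in> lmeasurable" using assms by (intro lmeasurable_open) auto
  then show "emeasure (lebesgue_on \<Omega>) (space (lebesgue_on \<Omega>)) \<noteq> \<infinity>"
    by (simp add: space_restrict_space emeasure_restrict_space fmeasurable_def less_top del: emeasure_completion)
qed

lemma L2_const: "bounded \<Omega> \<Longrightarrow> open \<Omega> \<Longrightarrow> (\<lambda>x. c) \<in> L2 \<Omega>"
  by (simp add: L2_def finite_measure.integrable_const lebesgue_on_finite_measure)

lemma L2_integrable:
  assumes "bounded \<Omega>" "open \<Omega>" "f \<in> L2 \<Omega>"
  shows "integrable (lebesgue_on \<Omega>) f"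
proof (rule Bochner_Integration.integrable_bound)
  show "integrable (lebesgue_on \<Omega>) (\<lambda>x. (norm (f x))\<^sup>2 + 1)"
    using assms by (intro Bochner_Integration.integrable_add L2_integrable_sq)
      (auto intro: finite_measure.integrable_const lebesgue_on_finite_measure)
  have "norm y \<le> (norm y)\<^sup>2 + 1" for y :: 'b
    using zero_le_power2[of "norm y - 1"] norm_ge_zero[of y]
    unfolding power2_diff one_power2 by linarith
  then show "AE x in lebesgue_on \<Omega>. norm (f x) \<le> norm ((norm (f x))\<^sup>2 + 1)"
    by (auto intro!: AE_I2 order_trans[OF _ abs_ge_self])
qed (use assms in \<open>simp add: L2_measurable\<close>)

lemma L2_norm_sq_ennreal:
  assumes "f \<in> L2 \<Omega>"
  shows "(\<integral>\<^sup>+x. ennreal ((norm (f x))\<^sup>2) \<partial>lebesgue_on \<Omega>) = ennreal ((L2_norm \<Omega> f)\<^sup>2)"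
  using assms by (simp add: L2_norm_sq L2_inner_self nn_integral_eq_integral L2_integrable_sq)

text \<open>
  On a set of finite measure the \<open>L\<^sup>2\<close> norm dominates the \<open>L\<^sup>1\<close> norm, so that the summability of the
  increments already gives convergence almost everywhere.
\<close>

lemma L2_fast_Cauchy_converges_AE:
  fixes f :: "nat \<Rightarrow> real ^ 'n \<Rightarrow> 'b::euclidean_space"
  assumes dom: "bounded \<Omega>" "open \<Omega>"
    and f: "\<And>n. f n \<in> L2 \<Omega>"
    and fast: "\<And>n. L2_norm \<Omega> (\<lambda>x. f (Suc n) x - f n x) \<le> (1/2)^n"
  shows "AE x in lebesgue_on \<Omega>. convergent (\<lambda>n. f n x)"
proof -
  let ?M = "lebesgue_on \<Omega>"
  define d where "d n x = norm (f (Suc n) x - f n x)" for n x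
  have d_L2: "d n \<in> L2 \<Omega>" for n
  proof -
    have [measurable]: "f m \<in> borel_measurable ?M" for m by (rule L2_measurable[OF f])
    show ?thesis
      unfolding d_def
      by (rule L2_bound[OF _ L2_integrable_sq[OF L2_diff[OF f[of "Suc n"] f[of n]]]]) simp_all
  qed
  have [measurable]: "d n \<in> borel_measurable ?M" for n by (rule L2_measurable[OF d_L2])
  define C where "C = L2_norm \<Omega> (\<lambda>x. 1::real)"
  have int_d: "(\<integral>\<^sup>+x. ennreal (d n x) \<partial>?M) \<le> ennreal (C * (1/2)^n)" for n
  proof -
    have eq: "(\<integral>\<^sup>+x. ennreal (d n x) \<partial>?M) = ennreal (\<integral>x. d n x \<partial>?M)"
      by (intro nn_integral_eq_integral L2_integrable[OF dom d_L2]) (simp add: d_def)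
    have "(\<integral>x. d n x \<partial>?M) = L2_inner \<Omega> (d n) (\<lambda>x. 1)"
      by (simp add: L2_inner_def)
    also have "\<dots> \<le> L2_norm \<Omega> (d n) * C"
      using L2_Cauchy_Schwarz[OF d_L2 L2_const[OF dom, of 1], of n] by (simp add: C_def)
    also have "L2_norm \<Omega> (d n) = L2_norm \<Omega> (\<lambda>x. f (Suc n) x - f n x)"
      by (simp add: L2_norm_def L2_inner_self d_def)
    also have "\<dots> * C \<le> (1/2)^n * C"
      by (intro mult_right_mono fast) (simp add: C_def)
    finally have "(\<integral>x. d n x \<partial>?M) \<le> C * (1/2)^n" by (simp only: mult.commute)
    then show ?thesis unfolding eq by (rule ennreal_leI)
  qed
  have "(\<integral>\<^sup>+x. (\<Sum>n. ennreal (d n x)) \<partial>?M) = (\<Sum>n. \<integral>\<^sup>+x. ennreal (d n x) \<partial>?M)"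
    by (rule nn_integral_suminf) simp
  also have "\<dots> \<le> (\<Sum>n. ennreal (C * (1/2)^n))"
    by (rule suminf_le[OF int_d]) simp_all
  also have "\<dots> = ennreal (\<Sum>n. C * (1/2)^n)"
  proof (rule suminf_ennreal2)
    show "0 \<le> C * (1/2)^n" for n by (simp add: C_def)
    show "summable (\<lambda>n. C * (1/2)^n)" by (intro summable_mult summable_geometric) simp
  qed
  finally have "(\<integral>\<^sup>+x. (\<Sum>n. ennreal (d n x)) \<partial>?M) \<noteq> \<infinity>"
    using neq_top_trans[OF ennreal_neq_top] by (simp only: infinity_ennreal_def) blast
  then have "AE x in ?M. (\<Sum>n. ennreal (d n x)) \<noteq> \<infinity>"
    by (intro nn_integral_PInf_AE) simp_all
  then show ?thesis
  proof eventually_elim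
    case (elim x)
    have "summable (\<lambda>n. d n x)"
    proof (rule summable_suminf_not_top)
      show "0 \<le> d n x" for n by (simp add: d_def)
      show "(\<Sum>n. ennreal (d n x)) \<noteq> top" using elim by (simp only: infinity_ennreal_def) simp
    qed
    then have "summable (\<lambda>n. f (Suc n) x - f n x)"
      unfolding d_def by (rule summable_norm_cancel)
    then have "convergent (\<lambda>n. \<Sum>k<n. f (Suc k) x - f k x)"
      by (simp only: summable_iff_convergent)
    then have "convergent (\<lambda>n. f n x - f 0 x)"
      by (simp only: sum_lessThan_telescope[of "\<lambda>n. f n x"])
    then have "convergent (\<lambda>n. (f n x - f 0 x) + f 0 x)"
      by (rule convergent_add[OF _ convergent_const])
    then show ?case by (simp only: diff_add_cancel)
  qed
qed

text \<open>
  A subsequence with summable increments converges almost everywhere; by Fatou's lemma the original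
  sequence is close to that limit in norm as well.
\<close>

theorem L2_complete:
  fixes f :: "nat \<Rightarrow> real ^ 'n \<Rightarrow> 'b::euclidean_space"
  assumes dom: "bounded \<Omega>" "open \<Omega>"
    and f: "\<And>n. f n \<in> L2 \<Omega>"
    and Cauchy: "\<And>\<epsilon>. \<epsilon> > 0 \<Longrightarrow> \<exists>N. \<forall>m\<ge>N. \<forall>n\<ge>N. L2_norm \<Omega> (\<lambda>x. f m x - f n x) \<le> \<epsilon>"
  obtains g where "g \<in> L2 \<Omega>" "(\<lambda>n. L2_norm \<Omega> (\<lambda>x. f n x - g x)) \<longlonglongrightarrow> 0"
proof -
  let ?M = "lebesgue_on \<Omega>"
  have "\<exists>N. \<forall>m\<ge>N. \<forall>n\<ge>N. L2_norm \<Omega> (\<lambda>x. f m x - f n x) \<le> (1/2)^k" for k :: nat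
    by (rule Cauchy) simp
  then obtain N where N: "\<And>k m n. m \<ge> N k \<Longrightarrow> n \<ge> N k \<Longrightarrow> L2_norm \<Omega> (\<lambda>x. f m x - f n x) \<le> (1/2)^k"
    by metis
  \<comment> \<open>\<open>r\<close> dominates \<open>N\<close> and is increasing, so consecutive terms of the subsequence lie beyond \<open>N k\<close>\<close>
  define r where "r k = (\<Sum>j\<le>k. N j) + k" for k
  have rN: "r k \<ge> N k" for k by (cases k) (auto simp: r_def)
  have r_Suc: "r (Suc k) \<ge> N k" for k
    using rN[of k] by (simp add: r_def)
  have r_ge: "r k \<ge> k" for k by (simp add: r_def)
  define h where "h k = f (r k)" for k
  have h: "h k \<in> L2 \<Omega>" for k by (simp add: h_def f)
  have [measurable]: "h k \<in> borel_measurable ?M" "f k \<in> borel_measurable ?M" for k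
    by (auto intro!: L2_measurable h f)
  have conv: "AE x in ?M. convergent (\<lambda>k. h k x)"
    by (rule L2_fast_Cauchy_converges_AE[OF dom h]) (use N rN r_Suc in \<open>simp add: h_def\<close>)
  define g where "g x = lim (\<lambda>k. h k x)" for x
  have [measurable]: "g \<in> borel_measurable ?M" unfolding g_def by measurable
  have bound: "(\<integral>\<^sup>+x. ennreal ((norm (f n x - g x))\<^sup>2) \<partial>?M) \<le> ennreal (((1/2)^k)\<^sup>2)" if "n \<ge> N k" for n k
  proof -
    have "AE x in ?M. ennreal ((norm (f n x - g x))\<^sup>2) = liminf (\<lambda>j. ennreal ((norm (f n x - h j x))\<^sup>2))"
      using conv
    proof eventually_elim
      case (elim x)
      then have "(\<lambda>j. h j x) \<longlonglongrightarrow> g x" by (simp add: g_def convergent_LIMSEQ_iff)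
      then have "(\<lambda>j. ennreal ((norm (f n x - h j x))\<^sup>2)) \<longlonglongrightarrow> ennreal ((norm (f n x - g x))\<^sup>2)"
        by (intro tendsto_ennrealI tendsto_intros)
      then show ?case by (metis lim_imp_Liminf sequentially_bot)
    qed
    then have "(\<integral>\<^sup>+x. ennreal ((norm (f n x - g x))\<^sup>2) \<partial>?M)
        = (\<integral>\<^sup>+x. liminf (\<lambda>j. ennreal ((norm (f n x - h j x))\<^sup>2)) \<partial>?M)"
      by (rule nn_integral_cong_AE)
    also have "\<dots> \<le> liminf (\<lambda>j. \<integral>\<^sup>+x. ennreal ((norm (f n x - h j x))\<^sup>2) \<partial>?M)"
      by (rule nn_integral_liminf) measurable
    also have "\<dots> \<le> ennreal (((1/2)^k)\<^sup>2)"
    proof (rule Liminf_le)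
      show "\<forall>\<^sub>F j in sequentially. (\<integral>\<^sup>+x. ennreal ((norm (f n x - h j x))\<^sup>2) \<partial>?M) \<le> ennreal (((1/2)^k)\<^sup>2)"
        using eventually_ge_at_top[of "N k"]
      proof eventually_elim
        case (elim j)
        have "L2_norm \<Omega> (\<lambda>x. f n x - h j x) \<le> (1/2)^k"
          unfolding h_def using that elim r_ge[of j] by (intro N) auto
        then show ?case
          using L2_norm_sq_ennreal[OF L2_diff[OF f h], of n j]
          by (simp add: ennreal_leI power_mono del: power_divide)
      qed
    qed simp
    finally show ?thesis .
  qed
  have diff: "(\<lambda>x. f n x - g x) \<in> L2 \<Omega>" if "n \<ge> N 0" for n
    using bound[OF that]
    by (auto simp: L2_def integrable_iff_bounded intro: le_less_trans)
  have g: "g \<in> L2 \<Omega>" using L2_diff[OF f[of "N 0"] diff[of "N 0"]] by simp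
  moreover have "(\<lambda>n. L2_norm \<Omega> (\<lambda>x. f n x - g x)) \<longlonglongrightarrow> 0"
  proof (rule LIMSEQ_I)
    fix e :: real assume "e > 0"
    then obtain k where k: "(1/2)^k < e" using real_arch_pow_inv[of e "1/2"] by auto
    show "\<exists>no. \<forall>n\<ge>no. norm (L2_norm \<Omega> (\<lambda>x. f n x - g x) - 0) < e"
    proof (intro exI allI impI)
      fix n assume "n \<ge> N k"
      have "ennreal ((L2_norm \<Omega> (\<lambda>x. f n x - g x))\<^sup>2) \<le> ennreal (((1/2)^k)\<^sup>2)"
        using bound[OF \<open>n \<ge> N k\<close>] L2_norm_sq_ennreal[OF L2_diff[OF f g], of n] by simp
      then have "(L2_norm \<Omega> (\<lambda>x. f n x - g x))\<^sup>2 \<le> ((1/2)^k)\<^sup>2" by (simp del: power_divide)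
      then have "L2_norm \<Omega> (\<lambda>x. f n x - g x) \<le> (1/2)^k" by (rule power2_le_imp_le) simp
      then show "norm (L2_norm \<Omega> (\<lambda>x. f n x - g x) - 0) < e" using k by simp
    qed
  qed
  ultimately show ?thesis by (rule that)
qed

lemma L2_componentwise:
  fixes f :: "real ^ 'n \<Rightarrow> 'b::euclidean_space ^ 'm"
  shows "f \<in> L2 \<Omega> \<longleftrightarrow> (\<forall>i. (\<lambda>x. f x $ i) \<in> L2 \<Omega>)"
proof
  assume f: "f \<in> L2 \<Omega>"
  show "\<forall>i. (\<lambda>x. f x $ i) \<in> L2 \<Omega>"
  proof
    fix i
    have "(\<lambda>x. f x $ i) \<in> borel_measurable (lebesgue_on \<Omega>)"
      by (rule measurable_compose[OF L2_measurable[OF f]])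
         (intro borel_measurable_continuous_onI continuous_intros)
    then show "(\<lambda>x. f x $ i) \<in> L2 \<Omega>"
      by (rule L2_bound[OF _ L2_integrable_sq[OF f]]) (simp add: Finite_Cartesian_Product.norm_nth_le)
  qed
next
  assume c: "\<forall>i. (\<lambda>x. f x $ i) \<in> L2 \<Omega>"
  have "f \<in> borel_measurable (lebesgue_on \<Omega>)"
  proof (rule borel_measurable_euclidean_space[THEN iffD2], intro ballI)
    fix b :: "'b ^ 'm" assume "b \<in> Basis"
    then obtain i e where b: "b = axis i e" by (auto simp: Basis_vec_def)
    have [measurable]: "(\<lambda>x. f x $ i) \<in> borel_measurable (lebesgue_on \<Omega>)"
      using c L2_measurable by blast
    show "(\<lambda>x. f x \<bullet> b) \<in> borel_measurable (lebesgue_on \<Omega>)"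
      unfolding b inner_axis by measurable
  qed
  then show "f \<in> L2 \<Omega>"
    using c by (intro L2_bound[where h = "\<lambda>x. \<Sum>i\<in>UNIV. (norm (f x $ i))\<^sup>2"])
      (auto simp: L2_integrable_sq norm_vec_def L2_set_def sum_nonneg)
qed

lemma L2_inner_componentwise:
  fixes f g :: "real ^ 'n \<Rightarrow> 'b::euclidean_space ^ 'm"
  assumes "f \<in> L2 \<Omega>" "g \<in> L2 \<Omega>"
  shows "L2_inner \<Omega> f g = (\<Sum>i\<in>UNIV. L2_inner \<Omega> (\<lambda>x. f x $ i) (\<lambda>x. g x $ i))"
  unfolding L2_inner_def inner_vec_def
  using assms L2_componentwise[of f] L2_componentwise[of g]
  by (intro Bochner_Integration.integral_sum) (simp add: L2_integrable_inner)

lemma L2_norm_sq_componentwise: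
  fixes f :: "real ^ 'n \<Rightarrow> 'b::euclidean_space ^ 'm"
  assumes "f \<in> L2 \<Omega>"
  shows "(L2_norm \<Omega> f)\<^sup>2 = (\<Sum>i\<in>UNIV. (L2_norm \<Omega> (\<lambda>x. f x $ i))\<^sup>2)"
  using L2_inner_componentwise[OF assms assms] by (simp add: L2_norm_sq)

lemma L2_norm_component_le:
  fixes f :: "real ^ 'n \<Rightarrow> 'b::euclidean_space ^ 'm"
  assumes "f \<in> L2 \<Omega>"
  shows "L2_norm \<Omega> (\<lambda>x. f x $ i) \<le> L2_norm \<Omega> f"
  by (rule power2_le_imp_le) (auto simp: L2_norm_sq_componentwise[OF assms] intro!: member_le_sum)

section \<open>Differentiable functions of compact support\<close>

lemma partial_deriv_eq: "(f has_derivative D) (at x) \<Longrightarrow> partial_deriv i f x = D (axis i 1)"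
  unfolding partial_deriv_def using frechet_derivative_at by metis

lemma partial_deriv_add:
  assumes "f differentiable at x" "g differentiable at x"
  shows "partial_deriv i (\<lambda>x. f x + g x) x = partial_deriv i f x + partial_deriv i g x"
  using partial_deriv_eq[OF has_derivative_add[OF assms[THEN frechet_derivative_works[THEN iffD1]]]]
  by (simp add: partial_deriv_def)

lemma partial_deriv_scale:
  assumes "f differentiable at x"
  shows "partial_deriv i (\<lambda>x. c * f x) x = c * partial_deriv i f x"
  using partial_deriv_eq[OF has_derivative_mult_right[OF assms[THEN frechet_derivative_works[THEN iffD1]]]]
  by (simp add: partial_deriv_def)

lemma partial_deriv_mult:
  assumes "f differentiable at x" "g differentiable at x"
  shows "partial_deriv i (\<lambda>x. f x * g x) x = f x * partial_deriv i g x + partial_deriv i f x * g x"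
  using partial_deriv_eq[OF has_derivative_mult[OF assms[THEN frechet_derivative_works[THEN iffD1]]]]
  by (simp add: partial_deriv_def)

lemma partial_deriv_cong_open:
  assumes "open S" "x \<in> S" "\<And>y. y \<in> S \<Longrightarrow> f y = g y" "g differentiable at x"
  shows "partial_deriv i f x = partial_deriv i g x"
  using assms(4)[unfolded frechet_derivative_works]
    has_derivative_transform_within_open[of g _ x UNIV S f] assms(1-3)
  by (metis partial_deriv_def partial_deriv_eq)

lemma C_k_add: "C_k k f \<Longrightarrow> C_k k g \<Longrightarrow> C_k k (\<lambda>x. f x + g x)"
proof (induction k arbitrary: f g)
  case 0
  then show ?case by (simp add: continuous_on_add)
next
  case (Suc k)
  then have "partial_deriv i (\<lambda>x. f x + g x) = (\<lambda>x. partial_deriv i f x + partial_deriv i g x)" for i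
    by (auto simp: partial_deriv_add)
  with Suc show ?case by simp
qed

lemma C_k_scale: "C_k k f \<Longrightarrow> C_k k (\<lambda>x. c * f x)"
proof (induction k arbitrary: f)
  case 0
  then show ?case by (simp add: continuous_on_mult_left)
next
  case (Suc k)
  then have "partial_deriv i (\<lambda>x. c * f x) = (\<lambda>x. c * partial_deriv i f x)" for i
    by (auto simp: partial_deriv_scale)
  with Suc show ?case by simp
qed

lemma C_k_1_continuous:
  assumes "C_k (Suc 0) f" shows "continuous_on UNIV f"
  using assms by (auto intro!: differentiable_imp_continuous_on simp: differentiable_on_def
      differentiable_at_withinI)

lemma C_k_1_mult:
  assumes "C_k (Suc 0) f" "C_k (Suc 0) g"
  shows "C_k (Suc 0) (\<lambda>x. f x * g x)"
proof -
  have "partial_deriv i (\<lambda>x. f x * g x) = (\<lambda>x. f x * partial_deriv i g x + partial_deriv i f x * g x)" for i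
    using assms by (auto simp: partial_deriv_mult)
  then show ?thesis
    using assms C_k_1_continuous[OF assms(1)] C_k_1_continuous[OF assms(2)]
    by (auto intro!: continuous_intros)
qed

lemma C_k_coinduct:
  assumes "f \<in> F" "\<And>f x. f \<in> F \<Longrightarrow> f differentiable at x"
    "\<And>f i. f \<in> F \<Longrightarrow> partial_deriv i f \<in> F"
  shows "C_k k f"
  using assms(1)
proof (induction k arbitrary: f)
  case 0
  then show ?case
    using assms(2) by (auto intro!: differentiable_imp_continuous_on simp: differentiable_on_def
      differentiable_at_withinI)
qed (use assms in auto)

lemma partial_deriv_zero_outside:
  assumes "closed K" "\<And>x. x \<notin> K \<Longrightarrow> f x = 0" "x \<notin> K"
  shows "partial_deriv i f x = 0"
proof -
  have "partial_deriv i f x = partial_deriv i (\<lambda>x. 0) x"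
    by (rule partial_deriv_cong_open[of "- K"]) (use assms in auto)
  also have "\<dots> = 0"
    using partial_deriv_eq[OF has_derivative_const, of i 0 x] by simp
  finally show ?thesis .
qed

lemma compact_support_bounded:
  fixes f :: "'a::real_normed_vector \<Rightarrow> real"
  assumes "continuous_on UNIV f" "compact K" "\<And>x. x \<notin> K \<Longrightarrow> f x = 0"
  obtains B where "B \<ge> 0" "\<And>x. \<bar>f x\<bar> \<le> B"
proof -
  have "compact (f ` K)" using assms by (intro compact_continuous_image) (auto intro: continuous_on_subset)
  then obtain B where "\<And>y. y \<in> f ` K \<Longrightarrow> \<bar>y\<bar> \<le> B" "B > 0"
    by (metis bounded_pos compact_imp_bounded real_norm_def)
  then show ?thesis using assms(3) by (intro that[of B]) (auto, metis abs_zero imageI less_imp_le)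
qed

lemma integrable_compact_support:
  fixes f :: "'a::euclidean_space \<Rightarrow> real"
  assumes "f \<in> borel_measurable borel" "compact K" "\<And>x. x \<notin> K \<Longrightarrow> f x = 0" "\<And>x. \<bar>f x\<bar> \<le> B"
  shows "integrable lborel f"
proof (rule Bochner_Integration.integrable_bound)
  show "integrable lborel (\<lambda>x. B * indicator K x :: real)"
    using assms(2) by (intro integrable_mult_right integrable_real_indicator)
      (auto simp: borel_compact emeasure_bounded_finite[unfolded infinity_ennreal_def] compact_imp_bounded)
  show "AE x in lborel. norm (f x) \<le> norm (B * indicator K x :: real)"
    using assms(3,4) by (auto intro!: AE_I2 simp: indicator_def) (metis abs_ge_self order_trans)
qed (use assms(1) in simp)

lemma integral_lebesgue_on_eq_lborel:
  fixes f :: "'a::euclidean_space \<Rightarrow> real"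
  assumes "open \<Omega>" "f \<in> borel_measurable borel" "\<And>x. x \<notin> \<Omega> \<Longrightarrow> f x = 0"
  shows "(\<integral>x. f x \<partial>lebesgue_on \<Omega>) = (\<integral>x. f x \<partial>lborel)"
proof -
  have "(\<integral>x. f x \<partial>lebesgue_on \<Omega>) = (\<integral>x. indicator \<Omega> x *\<^sub>R f x \<partial>lebesgue)"
    using assms(1) by (intro integral_restrict_space) auto
  also have "(\<lambda>x. indicator \<Omega> x *\<^sub>R f x) = f" using assms(3) by (auto simp: fun_eq_iff indicator_def)
  also have "(\<integral>x. f x \<partial>lebesgue) = (\<integral>x. f x \<partial>lborel)"
    using assms(2) by (intro integral_completion) simp
  finally show ?thesis .
qed

text \<open>
  By translation invariance all difference quotients have integral zero, and the mean value theorem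
  gives the bound under which they converge dominatedly to the partial derivative.
\<close>

theorem integral_partial_deriv_eq_0:
  fixes f :: "real ^ 'n \<Rightarrow> real"
  assumes f: "C_k (Suc 0) f" and K: "compact K" and supp: "\<And>x. x \<notin> K \<Longrightarrow> f x = 0"
  shows "(\<integral>x. partial_deriv i f x \<partial>lborel) = 0"
proof -
  let ?e = "axis i 1 :: real ^ 'n"
  define D where "D = partial_deriv i f"
  have D_cont: "continuous_on UNIV D" using f by (simp add: D_def)
  have D_supp: "x \<notin> K \<Longrightarrow> D x = 0" for x
    unfolding D_def by (rule partial_deriv_zero_outside[OF compact_imp_closed[OF K] supp])
  have line: "((\<lambda>t. f (x + t *\<^sub>R ?e)) has_real_derivative D (x + t *\<^sub>R ?e)) (at t)" for x t
  proof -
    have "(f has_derivative frechet_derivative f (at (x + t *\<^sub>R ?e))) (at (x + t *\<^sub>R ?e))"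
      using f by (simp add: frechet_derivative_works[symmetric])
    moreover have "((\<lambda>t. x + t *\<^sub>R ?e) has_derivative (\<lambda>s. s *\<^sub>R ?e)) (at t)"
      by (auto intro!: derivative_eq_intros)
    ultimately have "((\<lambda>t. f (x + t *\<^sub>R ?e)) has_derivative
        (\<lambda>s. frechet_derivative f (at (x + t *\<^sub>R ?e)) (s *\<^sub>R ?e))) (at t)"
      by (rule has_derivative_compose[rotated])
    moreover have "frechet_derivative f (at (x + t *\<^sub>R ?e)) (s *\<^sub>R ?e) = s * D (x + t *\<^sub>R ?e)" for s
      using f by (simp add: D_def partial_deriv_def linear_frechet_derivative linear_cmul)
    ultimately show ?thesis by (simp add: has_field_derivative_def mult.commute[of _ "D _"])
  qed
  obtain B where B: "B \<ge> 0" "\<And>x. \<bar>D x\<bar> \<le> B"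
    using compact_support_bounded[OF D_cont K D_supp] by blast
  obtain B' where B': "\<And>x. \<bar>f x\<bar> \<le> B'"
    using compact_support_bounded[OF C_k_1_continuous[OF f] K supp] by blast
  have [measurable]: "f \<in> borel_measurable borel"
    by (intro borel_measurable_continuous_onI C_k_1_continuous f)
  have int_f: "integrable lborel f"
    by (rule integrable_compact_support[OF _ K supp B']) auto
  define h where "h n = 1 / real (Suc n)" for n
  have h: "h n > 0" "h n \<le> 1" for n by (auto simp: h_def)
  define q where "q n x = (f (x + h n *\<^sub>R ?e) - f x) / h n" for n x
  have shift: "integrable lborel (\<lambda>x. f (x + v))" "(\<integral>x. f (x + v) \<partial>lborel) = (\<integral>x. f x \<partial>lborel)" for v
  proof -
    have "integrable (distr lborel borel ((+) v)) f" using int_f by (simp add: lborel_distr_plus)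
    then show "integrable lborel (\<lambda>x. f (x + v))"
      by (subst (asm) integrable_distr_eq) (auto simp: add.commute)
    have "(\<integral>x. f x \<partial>lborel) = (\<integral>x. f x \<partial>distr lborel borel ((+) v))" by (simp add: lborel_distr_plus)
    also have "\<dots> = (\<integral>x. f (x + v) \<partial>lborel)" by (subst integral_distr) (auto simp: add.commute)
    finally show "(\<integral>x. f (x + v) \<partial>lborel) = (\<integral>x. f x \<partial>lborel)" by simp
  qed
  have int_q: "(\<integral>x. q n x \<partial>lborel) = 0" for n
    by (simp add: q_def shift int_f)
  obtain R where R: "\<And>x. x \<in> K \<Longrightarrow> norm x \<le> R"
    using compact_imp_bounded[OF K] by (auto simp: bounded_iff)
  have q_bound: "\<bar>q n x\<bar> \<le> B * indicator (cball 0 (R + 1)) x" for n x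
  proof -
    obtain z where z: "f (x + h n *\<^sub>R ?e) - f (x + 0 *\<^sub>R ?e) = (h n - 0) * D (x + z *\<^sub>R ?e)"
      using MVT2[OF h(1)[of n] line] by blast
    then have "\<bar>q n x\<bar> \<le> B" using B(2) h(1)[of n] by (simp add: q_def)
    moreover have "q n x = 0" if "norm x > R + 1"
    proof -
      have "norm x \<le> norm (x + h n *\<^sub>R ?e) + norm (h n *\<^sub>R ?e)"         using norm_triangle_ineq4[of "x + h n *\<^sub>R ?e" "h n *\<^sub>R ?e"] by simp
      also have "norm (h n *\<^sub>R ?e) \<le> 1" using h[of n] by simp
      finally have "norm (x + h n *\<^sub>R ?e) > R" using that by simp
      then have "x \<notin> K" "x + h n *\<^sub>R ?e \<notin> K" using R[of x] R[of "x + h n *\<^sub>R ?e"] that by auto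
      then show ?thesis by (simp add: q_def supp)
    qed
    ultimately show ?thesis by (auto simp: indicator_def)
  qed
  have "(\<lambda>n. \<integral>x. q n x \<partial>lborel) \<longlonglongrightarrow> (\<integral>x. D x \<partial>lborel)"
  proof (rule integral_dominated_convergence)
    show "D \<in> borel_measurable lborel" using D_cont by (simp add: borel_measurable_continuous_onI)
    show "q n \<in> borel_measurable lborel" for n unfolding q_def by measurable
    show "integrable lborel (\<lambda>x. B * indicator (cball 0 (R + 1)) x :: real)"
      by (intro integrable_mult_right integrable_real_indicator) (auto simp: emeasure_bounded_finite[unfolded infinity_ennreal_def])
    show "AE x in lborel. norm (q n x) \<le> B * indicator (cball 0 (R + 1)) x" for n
      using q_bound by auto
    have "(\<lambda>n. q n x) \<longlonglongrightarrow> D x" for x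
    proof -
      have "((\<lambda>y. (f (x + (0 + y) *\<^sub>R ?e) - f (x + 0 *\<^sub>R ?e)) / y) \<longlongrightarrow> D (x + 0 *\<^sub>R ?e)) (at 0)"
        using line[of x 0] by (simp only: DERIV_def)
      moreover have "filterlim h (at 0) sequentially"
        unfolding filterlim_at using h(1) LIMSEQ_Suc[OF lim_1_over_n[where ?'a = real]]
        by (auto simp: h_def[abs_def] less_imp_neq[symmetric])
      ultimately have "(\<lambda>n. (f (x + (0 + h n) *\<^sub>R ?e) - f (x + 0 *\<^sub>R ?e)) / h n) \<longlonglongrightarrow> D (x + 0 *\<^sub>R ?e)"
        by (rule filterlim_compose)
      then show ?thesis
        unfolding q_def by simp
    qed
    then show "AE x in lborel. (\<lambda>n. q n x) \<longlonglongrightarrow> D x" by auto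
  qed
  then show ?thesis using int_q by (simp add: D_def LIMSEQ_const_iff)
qed

section \<open>Test functions\<close>

lemma test_functions_C_k: "\<phi> \<in> test_functions \<Omega> \<Longrightarrow> C_k k \<phi>"
  by (simp add: test_functions_def)

lemma test_functions_supp:
  assumes "\<phi> \<in> test_functions \<Omega>"
  obtains K where "compact K" "K \<subseteq> \<Omega>" "\<And>x. x \<notin> K \<Longrightarrow> \<phi> x = 0"
proof (rule that)
  show "compact (closure {x. \<phi> x \<noteq> 0})" "closure {x. \<phi> x \<noteq> 0} \<subseteq> \<Omega>"
    using assms by (auto simp: test_functions_def)
  show "x \<notin> closure {x. \<phi> x \<noteq> 0} \<Longrightarrow> \<phi> x = 0" for x
    using closure_subset[of "{x. \<phi> x \<noteq> 0}"] by auto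
qed

lemma test_functionsI:
  assumes "\<And>k. C_k k \<phi>" "compact K" "K \<subseteq> \<Omega>" "\<And>x. x \<notin> K \<Longrightarrow> \<phi> x = 0"
  shows "\<phi> \<in> test_functions \<Omega>"
proof -
  have "{x. \<phi> x \<noteq> 0} \<subseteq> K" using assms(4) by auto
  then have *: "closure {x. \<phi> x \<noteq> 0} \<subseteq> K" using assms(2) by (simp add: closure_minimal compact_imp_closed)
  then have "compact (closure {x. \<phi> x \<noteq> 0})"
    using assms(2) by (metis closed_closure compact_Int_closed inf.absorb_iff2)
  then show ?thesis using * assms by (auto simp: test_functions_def)
qed

lemma test_functions_add:
  assumes "\<phi> \<in> test_functions \<Omega>" "\<eta> \<in> test_functions \<Omega>"
  shows "(\<lambda>x. \<phi> x + \<eta> x) \<in> test_functions \<Omega>"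
proof -
  obtain K where K: "compact K" "K \<subseteq> \<Omega>" "\<And>x. x \<notin> K \<Longrightarrow> \<phi> x = 0"
    using test_functions_supp[OF assms(1)] by blast
  obtain L where L: "compact L" "L \<subseteq> \<Omega>" "\<And>x. x \<notin> L \<Longrightarrow> \<eta> x = 0"
    using test_functions_supp[OF assms(2)] by blast
  show ?thesis
    by (rule test_functionsI[of _ "K \<union> L"])
       (use K L assms in \<open>auto intro!: C_k_add simp: test_functions_C_k compact_Un\<close>)
qed

lemma test_functions_scale:
  assumes "\<phi> \<in> test_functions \<Omega>"
  shows "(\<lambda>x. c * \<phi> x) \<in> test_functions \<Omega>"
proof -
  obtain K where K: "compact K" "K \<subseteq> \<Omega>" "\<And>x. x \<notin> K \<Longrightarrow> \<phi> x = 0"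
    using test_functions_supp[OF assms(1)] by blast
  show ?thesis
    by (rule test_functionsI[of _ K]) (use K assms in \<open>auto intro!: C_k_scale simp: test_functions_C_k\<close>)
qed

lemma test_functions_partial_deriv:
  assumes "\<phi> \<in> test_functions \<Omega>"
  shows "partial_deriv i \<phi> \<in> test_functions \<Omega>"
proof -
  obtain K where K: "compact K" "K \<subseteq> \<Omega>" "\<And>x. x \<notin> K \<Longrightarrow> \<phi> x = 0"
    using test_functions_supp[OF assms(1)] by blast
  have "C_k k (partial_deriv i \<phi>)" for k
    using test_functions_C_k[OF assms, of "Suc k"] by simp
  moreover have "x \<notin> K \<Longrightarrow> partial_deriv i \<phi> x = 0" for x
    by (rule partial_deriv_zero_outside[OF compact_imp_closed[OF K(1)] K(3)])
  ultimately show ?thesis using K by (intro test_functionsI[of _ K])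
qed

lemma test_functions_continuous: "\<phi> \<in> test_functions \<Omega> \<Longrightarrow> continuous_on UNIV \<phi>"
  using test_functions_C_k[of \<phi> \<Omega> 0] by simp

lemma test_functions_measurable: "\<phi> \<in> test_functions \<Omega> \<Longrightarrow> \<phi> \<in> borel_measurable borel"
  by (intro borel_measurable_continuous_onI test_functions_continuous)

lemma test_functions_zero: "\<phi> \<in> test_functions \<Omega> \<Longrightarrow> x \<notin> \<Omega> \<Longrightarrow> \<phi> x = 0"
  by (metis subsetD test_functions_supp)

lemma test_functions_bounded:
  assumes "\<phi> \<in> test_functions \<Omega>"
  obtains B where "B \<ge> 0" "\<And>x. \<bar>\<phi> x\<bar> \<le> B"
  using compact_support_bounded[OF test_functions_continuous[OF assms]] test_functions_supp[OF assms]
  by metis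

lemma borel_measurable_lebesgue_on:
  "f \<in> borel_measurable borel \<Longrightarrow> f \<in> borel_measurable (lebesgue_on \<Omega>)"
  by (intro measurable_restrict_space1 measurable_completion) simp

lemma bounded_L2:
  fixes f :: "real ^ 'n \<Rightarrow> 'b::euclidean_space"
  assumes "bounded \<Omega>" "open \<Omega>" "f \<in> borel_measurable borel" "\<And>x. norm (f x) \<le> B"
  shows "f \<in> L2 \<Omega>"
  by (rule L2_bound[where h = "\<lambda>x. B\<^sup>2"])
     (use assms in \<open>auto intro!: borel_measurable_lebesgue_on finite_measure.integrable_const
       lebesgue_on_finite_measure power_mono\<close>)

lemma test_functions_L2:
  assumes "bounded \<Omega>" "open \<Omega>" "\<phi> \<in> test_functions \<Omega>"
  shows "\<phi> \<in> L2 \<Omega>"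
proof -
  obtain B where "\<And>x. \<bar>\<phi> x\<bar> \<le> B" using test_functions_bounded[OF assms(3)] by blast
  then show ?thesis using assms by (intro bounded_L2) (auto intro: test_functions_measurable)
qed

section \<open>Bump functions and the fundamental lemma of the calculus of variations\<close>

text \<open>
  The powers of \<open>t\<close> make the family closed under differentiation, up to linear combinations.
\<close>

definition flat :: "nat \<Rightarrow> real \<Rightarrow> real" where
  "flat m t = (if t \<le> 0 then 0 else exp (- (1 / t)) / t ^ m)"

lemma flat_tendsto_0: "((\<lambda>t. exp (- (1 / t)) / t ^ m) \<longlongrightarrow> (0::real)) (at_right 0)"
proof -
  have "((\<lambda>t. (inverse t) ^ m / exp (inverse t)) \<longlongrightarrow> (0::real)) (at_right 0)"
    by (rule filterlim_compose[OF tendsto_power_div_exp_0 filterlim_inverse_at_top_right])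
  then show ?thesis
    by (simp add: exp_minus field_simps)
qed

lemma DERIV_flat:
  "(flat m has_real_derivative flat (m + 2) t - real m * flat (m + 1) t) (at t)"
proof -
  consider "t < 0" | "t > 0" | "t = 0" by linarith
  then show ?thesis
  proof cases
    case 1
    have "((\<lambda>t. 0) has_real_derivative 0) (at t)" by simp
    moreover have "\<forall>\<^sub>F s in nhds t. flat m s = 0"
      using eventually_nhds_in_open[of "{..<0}" t] 1 by (auto elim!: eventually_mono simp: flat_def)
    ultimately show ?thesis
      using 1 DERIV_cong_ev[of t t "flat m" "\<lambda>_. 0" 0 0] by (simp add: flat_def)
  next
    case 2
    have D: "((\<lambda>s. exp (- (1 / s)) / s ^ m) has_real_derivative
        flat (m + 2) t - real m * flat (m + 1) t) (at t)"
      using 2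
      by (auto intro!: derivative_eq_intros simp: flat_def field_simps power2_eq_square power_add)
         (cases m; simp add: field_simps)
    have "\<forall>\<^sub>F s in nhds t. flat m s = exp (- (1 / s)) / s ^ m"
      using eventually_nhds_in_open[of "{0<..}" t] 2 by (auto elim!: eventually_mono simp: flat_def)
    from DERIV_cong_ev[OF refl this refl] D show ?thesis by (rule iffD2)
  next
    case 3
    have "((\<lambda>y. (flat m (0 + y) - flat m 0) / y) \<longlongrightarrow> 0) (at_right 0)"
    proof (rule Lim_transform_eventually[OF flat_tendsto_0[of "Suc m"]])
      show "\<forall>\<^sub>F y in at_right 0. exp (- (1 / y)) / y ^ Suc m = (flat m (0 + y) - flat m 0) / y"
        by (auto simp: eventually_at_filter flat_def)
    qed
    moreover have "((\<lambda>y. (flat m (0 + y) - flat m 0) / y) \<longlongrightarrow> 0) (at_left 0)"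
      by (rule Lim_transform_eventually[OF tendsto_const]) (auto simp: eventually_at_filter flat_def)
    ultimately have "(flat m has_real_derivative 0) (at 0)"
      unfolding DERIV_def by (simp only: filterlim_split_at)
    then show ?thesis using 3 by (simp add: flat_def)
  qed
qed

text \<open>
  Products of one-dimensional flat functions, with all their derivatives, lie in this class; being
  closed under partial derivatives it consists of smooth functions.
\<close>

inductive flat_algebra :: "(real ^ 'n \<Rightarrow> real) \<Rightarrow> bool" where
  const: "flat_algebra (\<lambda>x. c)"
| flat: "flat_algebra (\<lambda>x. flat m (a * x $ i + b))"
| add: "flat_algebra f \<Longrightarrow> flat_algebra g \<Longrightarrow> flat_algebra (\<lambda>x. f x + g x)"
| mult: "flat_algebra f \<Longrightarrow> flat_algebra g \<Longrightarrow> flat_algebra (\<lambda>x. f x * g x)"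

lemma flat_algebra_prod:
  "finite I \<Longrightarrow> (\<And>i. i \<in> I \<Longrightarrow> flat_algebra (f i)) \<Longrightarrow> flat_algebra (\<lambda>x. \<Prod>i\<in>I. f i x)"
  by (induction I rule: finite_induct) (auto intro: flat_algebra.intros)

lemma flat_algebra_derivative:
  fixes f :: "real ^ 'n \<Rightarrow> real"
  shows "flat_algebra f \<Longrightarrow> (\<forall>x. f differentiable at x) \<and> (\<forall>j. flat_algebra (partial_deriv j f))"
proof (induction rule: flat_algebra.induct)
  case (const c)
  have "partial_deriv j (\<lambda>x::real^'n. c) = (\<lambda>x. 0)" for j
    using partial_deriv_eq[OF has_derivative_const, of j c] by auto
  then show ?case by (simp add: flat_algebra.const)
next
  case (flat m a i b)
  define d where "d t = flat (m + 2) t + (- real m) * flat (m + 1) t" for t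
  have D: "((\<lambda>x::real^'n. flat m (a * x $ i + b)) has_derivative (\<lambda>h. d (a * x $ i + b) * (a * h $ i))) (at x)" for x
  proof -
    have "((\<lambda>x::real^'n. a * x $ i + b) has_derivative (\<lambda>h. a * h $ i)) (at x)"
      by (auto intro!: derivative_eq_intros bounded_linear.has_derivative[OF bounded_linear_vec_nth])
    moreover have "(flat m has_derivative (*) (d (a * x $ i + b))) (at (a * x $ i + b))"
      using DERIV_flat[of m "a * x $ i + b"] by (simp add: has_field_derivative_def d_def)
    ultimately show ?thesis by (rule has_derivative_compose)
  qed
  have alg: "flat_algebra (\<lambda>x::real^'n. (flat (m + 2) (a * x $ i + b)
      + (- real m) * flat (m + 1) (a * x $ i + b)) * (a * axis j 1 $ i))" for j
    by (intro flat_algebra.intros)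
  have "partial_deriv j (\<lambda>x::real^'n. flat m (a * x $ i + b))
      = (\<lambda>x. (flat (m + 2) (a * x $ i + b) + (- real m) * flat (m + 1) (a * x $ i + b)) * (a * axis j 1 $ i))" for j
    using partial_deriv_eq[OF D, of j] by (auto simp: d_def)
  then show ?case using D alg by (simp only:) (auto simp: differentiable_def)
next
  case (add f g)
  then have "partial_deriv j (\<lambda>x. f x + g x) = (\<lambda>x. partial_deriv j f x + partial_deriv j g x)" for j
    by (auto simp: partial_deriv_add)
  with add show ?case by (auto intro: flat_algebra.intros)
next
  case (mult f g)
  then have "partial_deriv j (\<lambda>x. f x * g x) = (\<lambda>x. f x * partial_deriv j g x + partial_deriv j f x * g x)" for j
    by (auto simp: partial_deriv_mult)
  with mult show ?case by (auto intro!: flat_algebra.intros)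
qed

lemma flat_algebra_C_k: "flat_algebra f \<Longrightarrow> C_k k f"
  using C_k_coinduct[of f "Collect flat_algebra" k] flat_algebra_derivative by blast

text \<open>
  With \<open>flat 0 s = exp (-1/s)\<close> for \<open>s > 0\<close>, each factor tends to \<open>1\<close> inside the interval as \<open>n\<close> grows.
\<close>

definition bump :: "real ^ 'n \<Rightarrow> real ^ 'n \<Rightarrow> nat \<Rightarrow> real ^ 'n \<Rightarrow> real" where
  "bump a b n x = (\<Prod>i\<in>UNIV. flat 0 (real n * (x $ i - a $ i)) * flat 0 (real n * (b $ i - x $ i)))"

lemma flat_0_bounds: "0 \<le> flat 0 t" "flat 0 t \<le> 1"
  by (auto simp: flat_def)

lemma bump_zero: "x \<notin> box a b \<Longrightarrow> bump a b n x = 0"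
proof -
  assume "x \<notin> box a b"
  then obtain i where "x $ i \<le> a $ i \<or> b $ i \<le> x $ i" by (auto simp: mem_box_cart not_less)
  then have "flat 0 (real n * (x $ i - a $ i)) * flat 0 (real n * (b $ i - x $ i)) = 0"
    by (auto simp: flat_def mult_le_0_iff)
  then show ?thesis unfolding bump_def by (intro prod_zero) auto
qed

lemma bump_test_function:
  assumes "cbox a b \<subseteq> \<Omega>"
  shows "bump a b n \<in> test_functions \<Omega>"
proof (rule test_functionsI[of _ "cbox a b"])
  have "flat_algebra (\<lambda>x. \<Prod>i\<in>UNIV. flat 0 (real n * x $ i + (- real n * a $ i))
      * flat 0 (- real n * x $ i + real n * b $ i))"
    by (intro flat_algebra_prod flat_algebra.intros) auto
  also have "(\<lambda>x. \<Prod>i\<in>UNIV. flat 0 (real n * x $ i + (- real n * a $ i))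
      * flat 0 (- real n * x $ i + real n * b $ i)) = bump a b n"
    by (simp add: bump_def fun_eq_iff algebra_simps)
  finally show "C_k k (bump a b n)" for k by (rule flat_algebra_C_k)
qed (use assms box_subset_cbox in \<open>auto intro!: bump_zero\<close>)

lemma bump_bounded: "\<bar>bump a b n x\<bar> \<le> 1"
  unfolding bump_def abs_prod
  by (intro prod_le_1) (auto simp: abs_mult flat_0_bounds intro!: mult_le_one)

lemma bump_tendsto: "(\<lambda>n. bump a b n x) \<longlonglongrightarrow> indicator (box a b) x"
proof (cases "x \<in> box a b")
  case True
  have lim: "(\<lambda>n. flat 0 (real n * t)) \<longlonglongrightarrow> 1" if "t > 0" for t
  proof -
    have "(\<lambda>n. exp (- (inverse t * (1 / real n)))) \<longlonglongrightarrow> exp (- (inverse t * 0))"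
      by (intro tendsto_intros lim_1_over_n)
    moreover have "\<forall>\<^sub>F n in sequentially. exp (- (inverse t * (1 / real n))) = flat 0 (real n * t)"
      using eventually_gt_at_top[of 0]       by eventually_elim (use that in \<open>auto simp: flat_def field_simps not_le\<close>)
    ultimately show ?thesis by (auto dest: Lim_transform_eventually)
  qed
  have "(\<lambda>n. bump a b n x) \<longlonglongrightarrow> (\<Prod>i\<in>(UNIV::'a set). 1 * 1)"
    unfolding bump_def using True by (intro tendsto_prod tendsto_mult lim) (auto simp: mem_box_cart)
  then show ?thesis using True by simp
next
  case False
  then show ?thesis by (simp add: bump_zero)
qed

text \<open>
  Bumps converge boundedly to the indicators of boxes, so that the integral of \<open>g\<close> vanishes over
  every box inside \<open>\<Omega>\<close>; Lebesgue's differentiation theorem recovers \<open>g\<close> from these integrals.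
\<close>

theorem fundamental_lemma_calculus_of_variations:
  fixes g :: "real ^ 'n \<Rightarrow> real"
  assumes \<Omega>: "open \<Omega>" and g: "integrable (lebesgue_on \<Omega>) g"
    and orth: "\<And>\<phi>. \<phi> \<in> test_functions \<Omega> \<Longrightarrow> (\<integral>x. g x * \<phi> x \<partial>lebesgue_on \<Omega>) = 0"
  shows "AE x in lebesgue_on \<Omega>. g x = 0"
proof -
  define f where "f x = (if x \<in> \<Omega> then g x else 0)" for x
  have \<Omega>_sets: "\<Omega> \<in> sets lebesgue" using \<Omega> by auto
  have f_eq: "f = (\<lambda>x. indicator \<Omega> x *\<^sub>R g x)" by (auto simp: f_def indicator_def)
  have f: "integrable lebesgue f"
    using g \<Omega>_sets unfolding f_eq by (simp add: integrable_restrict_space)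
  then have f_int: "f integrable_on cbox a b" for a b
    by (metis integrable_on_lebesgue integrable_on_subcbox subset_UNIV)
  have zero: "integral (cbox a b) f = 0" if "cbox a b \<subseteq> \<Omega>" for a b
  proof -
    have "(\<lambda>n. \<integral>x. g x * bump a b n x \<partial>lebesgue_on \<Omega>) \<longlonglongrightarrow> (\<integral>x. g x * indicator (box a b) x \<partial>lebesgue_on \<Omega>)"
    proof (rule integral_dominated_convergence[where w = "\<lambda>x. \<bar>g x\<bar>"])
      have [measurable]: "g \<in> borel_measurable (lebesgue_on \<Omega>)" using g by simp
      have [measurable]: "bump a b n \<in> borel_measurable (lebesgue_on \<Omega>)" for n
        by (intro borel_measurable_lebesgue_on test_functions_measurable[OF bump_test_function[OF that]])
      have [measurable]: "(indicator (box a b) :: _ \<Rightarrow> real) \<in> borel_measurable (lebesgue_on \<Omega>)"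
        by (intro borel_measurable_lebesgue_on) simp
      show "(\<lambda>x. g x * indicator (box a b) x) \<in> borel_measurable (lebesgue_on \<Omega>)"
        "(\<lambda>x. g x * bump a b n x) \<in> borel_measurable (lebesgue_on \<Omega>)" for n by measurable
      show "AE x in lebesgue_on \<Omega>. norm (g x * bump a b n x) \<le> \<bar>g x\<bar>" for n
        using bump_bounded[of a b n] by (auto simp: abs_mult mult_left_le)
      show "AE x in lebesgue_on \<Omega>. (\<lambda>n. g x * bump a b n x) \<longlonglongrightarrow> g x * indicator (box a b) x"
        by (intro AE_I2 tendsto_mult tendsto_const bump_tendsto)
    qed (use g in simp)
    then have "(\<integral>x. g x * indicator (box a b) x \<partial>lebesgue_on \<Omega>) = 0"
      using orth[OF bump_test_function[OF that]] by (simp add: LIMSEQ_const_iff)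
    moreover have "(\<integral>x. g x * indicator (box a b) x \<partial>lebesgue_on \<Omega>)
        = (\<integral>x. indicator \<Omega> x *\<^sub>R (g x * indicator (box a b) x) \<partial>lebesgue)"
      using \<Omega>_sets by (intro integral_restrict_space) simp
    moreover have "(\<lambda>x. indicator \<Omega> x *\<^sub>R (g x * indicator (box a b) x)) = (\<lambda>x. indicator (box a b) x *\<^sub>R f x)"
      by (auto simp: f_def indicator_def)
    moreover have "(\<integral>x. indicator (box a b) x *\<^sub>R f x \<partial>lebesgue) = integral (box a b) f"
      using f by (intro set_lebesgue_integral_eq_integral(2)[unfolded set_lebesgue_integral_def])
        (simp_all add: set_integrable_def integrable_mult_indicator del: real_scaleR_def)
    ultimately show ?thesis by (simp add: integral_open_interval)
  qed
  obtain N where N: "negligible N"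
    "\<And>x e. \<lbrakk>x \<notin> N; 0 < e\<rbrakk> \<Longrightarrow> \<exists>d>0. \<forall>h. 0 < h \<and> h < d \<longrightarrow>
       norm (integral (cbox x (x + h *\<^sub>R One)) f /\<^sub>R h ^ DIM(real ^ 'n) - f x) < e"
    using integrable_ccontinuous_explicit[OF f_int] by blast
  have "f x = 0" if x: "x \<in> \<Omega> - N" for x
  proof (rule ccontr)
    assume "f x \<noteq> 0"
    then have "x \<notin> N" "0 < norm (f x)" using x by auto
    from N(2)[OF this] obtain d where d: "d > 0" "\<And>h. 0 < h \<Longrightarrow> h < d \<Longrightarrow>
       norm (integral (cbox x (x + h *\<^sub>R One)) f /\<^sub>R h ^ DIM(real ^ 'n) - f x) < norm (f x)"
      by blast
    obtain r where r: "r > 0" "ball x r \<subseteq> \<Omega>" using x \<Omega> by (auto simp: open_contains_ball)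
    define h where "h = min (d / 2) (r / (2 * (norm (One :: real ^ 'n) + 1)))"
    have One: "norm (One :: real ^ 'n) \<ge> 0" by simp
    have h: "0 < h" "h < d" using d(1) r(1) One by (auto simp: h_def min_less_iff_disj add_nonneg_pos)
    have "cbox x (x + h *\<^sub>R One) \<subseteq> ball x r"
    proof
      fix y assume y: "y \<in> cbox x (x + h *\<^sub>R One)"
      have "norm (y - x) \<le> norm (h *\<^sub>R (One :: real ^ 'n))"
        using y by (intro norm_le_componentwise) (auto simp: mem_box inner_diff_left inner_add_left)
      also have "\<dots> = h * norm (One :: real ^ 'n)" using h by simp
      also have "\<dots> \<le> r / (2 * (norm (One :: real ^ 'n) + 1)) * norm (One :: real ^ 'n)"
        by (intro mult_right_mono) (auto simp: h_def)
      also have "\<dots> < r"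
        using r(1) One by (simp add: field_simps add_pos_nonneg)
      finally show "y \<in> ball x r" by (simp add: dist_norm norm_minus_commute)
    qed
    then have "integral (cbox x (x + h *\<^sub>R One)) f = 0" using r(2) by (intro zero) auto
    then show False using d(2)[OF h] by simp
  qed
  then have "AE x in lebesgue. x \<in> \<Omega> \<longrightarrow> g x = 0"
    using N(1) by (intro AE_I'[of N]) (auto simp: negligible_iff_null_sets f_def)
  then show ?thesis using \<Omega>_sets by (simp add: AE_restrict_space_iff)
qed

section \<open>Weak gradients and the space of functions vanishing on the boundary\<close>

locale bounded_open_set =
  fixes \<Omega> :: "(real ^ 'n) set"
  assumes bounded: "bounded \<Omega>" and open_set: "open \<Omega>"
begin

lemma test_L2: "\<phi> \<in> test_functions \<Omega> \<Longrightarrow> \<phi> \<in> L2 \<Omega>"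
  by (rule test_functions_L2[OF bounded open_set])

lemma test_C1: "\<phi> \<in> test_functions \<Omega> \<Longrightarrow> C_k (Suc 0) \<phi>"
  by (rule test_functions_C_k)

lemma test_differentiable: "\<phi> \<in> test_functions \<Omega> \<Longrightarrow> \<phi> differentiable at x"
  using test_C1[of \<phi>] by simp

lemma integral_divergence_eq_0:
  assumes f: "C_k (Suc 0) f" and K: "compact K" "K \<subseteq> \<Omega>" and supp: "\<And>x. x \<notin> K \<Longrightarrow> f x = 0"
  shows "(\<integral>x. partial_deriv i f x \<partial>lebesgue_on \<Omega>) = 0"
proof -
  have "(\<integral>x. partial_deriv i f x \<partial>lebesgue_on \<Omega>) = (\<integral>x. partial_deriv i f x \<partial>lborel)"
  proof (rule integral_lebesgue_on_eq_lborel[OF open_set])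
    show "partial_deriv i f \<in> borel_measurable borel"
      using f by (intro borel_measurable_continuous_onI) simp
    show "x \<notin> \<Omega> \<Longrightarrow> partial_deriv i f x = 0" for x
      by (rule partial_deriv_zero_outside[OF compact_imp_closed[OF K(1)] supp]) (use K(2) in auto)
  qed
  then show ?thesis by (simp add: integral_partial_deriv_eq_0[OF f K(1) supp])
qed

lemma test_has_weak_gradient:
  assumes "\<phi> \<in> test_functions \<Omega>"
  shows "has_weak_gradient \<Omega> \<phi> (\<lambda>x. \<chi> i. partial_deriv i \<phi> x)"
  unfolding has_weak_gradient_def
proof (intro ballI allI)
  fix \<eta> i assume \<eta>: "\<eta> \<in> test_functions \<Omega>"
  obtain K where K: "compact K" "K \<subseteq> \<Omega>" "\<And>x. x \<notin> K \<Longrightarrow> \<phi> x = 0"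
    using test_functions_supp[OF assms] by blast
  have "(\<integral>x. \<phi> x * partial_deriv i \<eta> x \<partial>lebesgue_on \<Omega>) + (\<integral>x. partial_deriv i \<phi> x * \<eta> x \<partial>lebesgue_on \<Omega>)
      = (\<integral>x. \<phi> x * partial_deriv i \<eta> x + partial_deriv i \<phi> x * \<eta> x \<partial>lebesgue_on \<Omega>)"
    using L2_integrable_inner[OF test_L2[OF assms] test_L2[OF test_functions_partial_deriv[OF \<eta>]]]
      L2_integrable_inner[OF test_L2[OF test_functions_partial_deriv[OF assms]] test_L2[OF \<eta>]]
    by (simp add: Bochner_Integration.integral_add)
  also have "\<dots> = (\<integral>x. partial_deriv i (\<lambda>x. \<phi> x * \<eta> x) x \<partial>lebesgue_on \<Omega>)"
    using assms \<eta> by (simp add: partial_deriv_mult test_differentiable)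
  also have "\<dots> = 0"
    by (rule integral_divergence_eq_0[OF C_k_1_mult[OF test_C1[OF assms] test_C1[OF \<eta>]] K(1,2)])
       (simp add: K(3))
  finally show "(\<integral>x. \<phi> x * partial_deriv i \<eta> x \<partial>lebesgue_on \<Omega>)
      = - (\<integral>x. (\<chi> i. partial_deriv i \<phi> x) $ i * \<eta> x \<partial>lebesgue_on \<Omega>)" by simp
qed

lemma test_grad_L2: "\<phi> \<in> test_functions \<Omega> \<Longrightarrow> (\<lambda>x. \<chi> i. partial_deriv i \<phi> x) \<in> L2 \<Omega>"
  by (subst L2_componentwise) (simp add: test_L2 test_functions_partial_deriv)

lemma has_weak_gradient_iff:
  "has_weak_gradient \<Omega> u g \<longleftrightarrow> (\<forall>\<phi> \<in> test_functions \<Omega>. \<forall>i.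
     L2_inner \<Omega> u (partial_deriv i \<phi>) = - L2_inner \<Omega> (\<lambda>x. g x $ i) \<phi>)"
  by (simp add: has_weak_gradient_def L2_inner_def)

lemma has_weak_gradient_add:
  assumes "u \<in> L2 \<Omega>" "v \<in> L2 \<Omega>" "g \<in> L2 \<Omega>" "h \<in> L2 \<Omega>"
    "has_weak_gradient \<Omega> u g" "has_weak_gradient \<Omega> v h"
  shows "has_weak_gradient \<Omega> (\<lambda>x. u x + v x) (\<lambda>x. g x + h x)"
  using assms unfolding has_weak_gradient_iff
  by (auto simp: L2_inner_add_left test_L2 test_functions_partial_deriv L2_componentwise[of g]
      L2_componentwise[of h])

lemma has_weak_gradient_scale:
  "has_weak_gradient \<Omega> u g \<Longrightarrow> has_weak_gradient \<Omega> (\<lambda>x. c *\<^sub>R u x) (\<lambda>x. c *\<^sub>R g x)"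
  unfolding has_weak_gradient_iff
  using L2_inner_scale_left[of \<Omega> c] by (simp add: L2_inner_def algebra_simps)

lemma weak_gradient_unique:
  assumes g: "g \<in> L2 \<Omega>" and h: "h \<in> L2 \<Omega>"
    and "has_weak_gradient \<Omega> u g" "has_weak_gradient \<Omega> u h"
  shows "AE x in lebesgue_on \<Omega>. g x = h x"
proof -
  have comp: "(\<lambda>x. g x $ i) \<in> L2 \<Omega>" "(\<lambda>x. h x $ i) \<in> L2 \<Omega>" for i
    using g h by (auto simp: L2_componentwise[of g] L2_componentwise[of h])
  have "AE x in lebesgue_on \<Omega>. g x $ i - h x $ i = 0" for i
  proof (rule fundamental_lemma_calculus_of_variations[OF open_set])
    show "integrable (lebesgue_on \<Omega>) (\<lambda>x. g x $ i - h x $ i)"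
      by (intro L2_integrable[OF bounded open_set] L2_diff comp)
    fix \<phi> assume \<phi>: "\<phi> \<in> test_functions \<Omega>"
    have "(\<integral>x. (g x $ i - h x $ i) * \<phi> x \<partial>lebesgue_on \<Omega>) = L2_inner \<Omega> (\<lambda>x. g x $ i - h x $ i) \<phi>"
      by (simp add: L2_inner_def)
    also have "\<dots> = L2_inner \<Omega> (\<lambda>x. g x $ i) \<phi> - L2_inner \<Omega> (\<lambda>x. h x $ i) \<phi>"
      by (intro L2_inner_diff_left comp test_L2 \<phi>)
    also have "\<dots> = 0" using assms(3,4) \<phi> unfolding has_weak_gradient_iff
      by (metis add.inverse_inverse cancel_comm_monoid_add_class.diff_cancel)
    finally show "(\<integral>x. (g x $ i - h x $ i) * \<phi> x \<partial>lebesgue_on \<Omega>) = 0" .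
  qed
  then have "AE x in lebesgue_on \<Omega>. \<forall>i. g x $ i - h x $ i = 0"
    by (simp add: AE_all_countable)
  then show ?thesis by eventually_elim (simp add: vec_eq_iff)
qed

lemma H1_L2: "u \<in> H1 \<Omega> \<Longrightarrow> u \<in> L2 \<Omega>"
  by (simp add: H1_def)

lemma H1I: "u \<in> L2 \<Omega> \<Longrightarrow> g \<in> L2 \<Omega> \<Longrightarrow> has_weak_gradient \<Omega> u g \<Longrightarrow> u \<in> H1 \<Omega>"
  by (auto simp: H1_def)

lemma weak_grad:
  assumes "u \<in> H1 \<Omega>"
  shows weak_grad_L2: "weak_grad \<Omega> u \<in> L2 \<Omega>"
    and weak_grad_has_weak_gradient: "has_weak_gradient \<Omega> u (weak_grad \<Omega> u)"
proof -
  have "\<exists>g. g \<in> L2 \<Omega> \<and> has_weak_gradient \<Omega> u g" using assms by (auto simp: H1_def)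
  from someI_ex[OF this] show "weak_grad \<Omega> u \<in> L2 \<Omega>" "has_weak_gradient \<Omega> u (weak_grad \<Omega> u)"
    by (simp_all add: weak_grad_def)
qed

lemma weak_grad_AE_eq:
  assumes "u \<in> L2 \<Omega>" "g \<in> L2 \<Omega>" "has_weak_gradient \<Omega> u g"
  shows "AE x in lebesgue_on \<Omega>. weak_grad \<Omega> u x = g x"
  using weak_gradient_unique[OF weak_grad_L2 _ weak_grad_has_weak_gradient] H1I[OF assms] assms
  by blast

lemma H1_add:
  assumes "u \<in> H1 \<Omega>" "v \<in> H1 \<Omega>"
  shows "(\<lambda>x. u x + v x) \<in> H1 \<Omega>"
    and weak_grad_add: "AE x in lebesgue_on \<Omega>. weak_grad \<Omega> (\<lambda>x. u x + v x) x = weak_grad \<Omega> u x + weak_grad \<Omega> v x"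
proof -
  note * = L2_add[OF assms[THEN H1_L2]] L2_add[OF assms[THEN weak_grad_L2]]
    has_weak_gradient_add[OF assms[THEN H1_L2] assms[THEN weak_grad_L2] assms[THEN weak_grad_has_weak_gradient]]
  show "(\<lambda>x. u x + v x) \<in> H1 \<Omega>"
    "AE x in lebesgue_on \<Omega>. weak_grad \<Omega> (\<lambda>x. u x + v x) x = weak_grad \<Omega> u x + weak_grad \<Omega> v x"
    using H1I[OF *] weak_grad_AE_eq[OF *] by auto
qed

lemma H1_scale:
  assumes "u \<in> H1 \<Omega>"
  shows "(\<lambda>x. c * u x) \<in> H1 \<Omega>"
    and weak_grad_scale: "AE x in lebesgue_on \<Omega>. weak_grad \<Omega> (\<lambda>x. c * u x) x = c *\<^sub>R weak_grad \<Omega> u x"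
proof -
  note * = L2_scale[OF assms[THEN H1_L2], of c] L2_scale[OF assms[THEN weak_grad_L2], of c]
    has_weak_gradient_scale[OF assms[THEN weak_grad_has_weak_gradient], of c]
  show "(\<lambda>x. c * u x) \<in> H1 \<Omega>"
    "AE x in lebesgue_on \<Omega>. weak_grad \<Omega> (\<lambda>x. c * u x) x = c *\<^sub>R weak_grad \<Omega> u x"
    using H1I[OF *] weak_grad_AE_eq[OF *] by auto
qed

lemma H1_diff:
  assumes "u \<in> H1 \<Omega>" "v \<in> H1 \<Omega>"
  shows "(\<lambda>x. u x - v x) \<in> H1 \<Omega>"
    and weak_grad_diff: "AE x in lebesgue_on \<Omega>. weak_grad \<Omega> (\<lambda>x. u x - v x) x = weak_grad \<Omega> u x - weak_grad \<Omega> v x"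
proof -
  have v: "(\<lambda>x. - v x) \<in> H1 \<Omega>" "AE x in lebesgue_on \<Omega>. weak_grad \<Omega> (\<lambda>x. - v x) x = - weak_grad \<Omega> v x"
    using H1_scale[OF assms(2), of "-1"] weak_grad_scale[OF assms(2), of "-1"] by simp_all
  show "(\<lambda>x. u x - v x) \<in> H1 \<Omega>" using H1_add(1)[OF assms(1) v(1)] by simp
  have "AE x in lebesgue_on \<Omega>. weak_grad \<Omega> (\<lambda>x. u x - v x) x = weak_grad \<Omega> u x + weak_grad \<Omega> (\<lambda>x. - v x) x"
    using H1_add(2)[OF assms(1) v(1)] by simp
  then show "AE x in lebesgue_on \<Omega>. weak_grad \<Omega> (\<lambda>x. u x - v x) x = weak_grad \<Omega> u x - weak_grad \<Omega> v x"
    using v(2) by eventually_elim simp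
qed

lemma weak_grad_norm_diff:
  assumes "u \<in> H1 \<Omega>" "v \<in> H1 \<Omega>"
  shows "L2_norm \<Omega> (weak_grad \<Omega> (\<lambda>x. u x - v x)) = L2_norm \<Omega> (\<lambda>x. weak_grad \<Omega> u x - weak_grad \<Omega> v x)"
  by (intro L2_norm_cong_AE weak_grad_diff weak_grad_L2 H1_diff L2_diff assms)

lemma test_H1: "\<phi> \<in> test_functions \<Omega> \<Longrightarrow> \<phi> \<in> H1 \<Omega>"
  by (rule H1I[OF test_L2 test_grad_L2 test_has_weak_gradient])

lemma weak_grad_test:
  "\<phi> \<in> test_functions \<Omega> \<Longrightarrow> AE x in lebesgue_on \<Omega>. weak_grad \<Omega> \<phi> x = (\<chi> i. partial_deriv i \<phi> x)"
  by (rule weak_grad_AE_eq[OF test_L2 test_grad_L2 test_has_weak_gradient])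

lemma H1_0_iff:
  "u \<in> H1_0 \<Omega> \<longleftrightarrow> u \<in> H1 \<Omega> \<and> (\<forall>\<epsilon>>0. \<exists>\<phi>\<in>test_functions \<Omega>.
     L2_norm \<Omega> (\<lambda>x. u x - \<phi> x) < \<epsilon> \<and> L2_norm \<Omega> (\<lambda>x. weak_grad \<Omega> u x - weak_grad \<Omega> \<phi> x) < \<epsilon>)"
proof -
  have H: "H1_norm \<Omega> (\<lambda>x. u x - \<phi> x)
      = sqrt ((L2_norm \<Omega> (\<lambda>x. u x - \<phi> x))\<^sup>2 + (L2_norm \<Omega> (\<lambda>x. weak_grad \<Omega> u x - weak_grad \<Omega> \<phi> x))\<^sup>2)"
    if "u \<in> H1 \<Omega>" "\<phi> \<in> test_functions \<Omega>" for \<phi>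
    using weak_grad_norm_diff[OF that(1) test_H1[OF that(2)]] by (simp add: H1_norm_def)
  have le: "a \<le> sqrt (a\<^sup>2 + b\<^sup>2)" "b \<le> sqrt (a\<^sup>2 + b\<^sup>2)" for a b :: real
    by (auto intro: real_le_rsqrt)
  have ge: "sqrt (a\<^sup>2 + b\<^sup>2) < \<epsilon>" if "0 \<le> a" "0 \<le> b" "a < \<epsilon> / 2" "b < \<epsilon> / 2" for a b \<epsilon> :: real
    using sqrt_sum_squares_le_sum[OF that(1,2)] that by simp
  show ?thesis
  proof (intro iffI conjI allI impI)
    assume u: "u \<in> H1_0 \<Omega>"
    then show uH: "u \<in> H1 \<Omega>" by (simp add: H1_0_def)
    fix \<epsilon> :: real assume "\<epsilon> > 0"
    then obtain \<phi> where \<phi>: "\<phi> \<in> test_functions \<Omega>" "H1_norm \<Omega> (\<lambda>x. u x - \<phi> x) < \<epsilon>"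
      using u by (auto simp: H1_0_def)
    then show "\<exists>\<phi>\<in>test_functions \<Omega>. L2_norm \<Omega> (\<lambda>x. u x - \<phi> x) < \<epsilon>
        \<and> L2_norm \<Omega> (\<lambda>x. weak_grad \<Omega> u x - weak_grad \<Omega> \<phi> x) < \<epsilon>"
      unfolding H[OF uH \<phi>(1)] using le le_less_trans by blast
  next
    assume u: "u \<in> H1 \<Omega> \<and> (\<forall>\<epsilon>>0. \<exists>\<phi>\<in>test_functions \<Omega>.
     L2_norm \<Omega> (\<lambda>x. u x - \<phi> x) < \<epsilon> \<and> L2_norm \<Omega> (\<lambda>x. weak_grad \<Omega> u x - weak_grad \<Omega> \<phi> x) < \<epsilon>)"
    show "u \<in> H1_0 \<Omega>"
      unfolding H1_0_def
    proof (intro CollectI conjI allI impI)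
      fix \<epsilon> :: real assume "\<epsilon> > 0"
      then obtain \<phi> where \<phi>: "\<phi> \<in> test_functions \<Omega>" "L2_norm \<Omega> (\<lambda>x. u x - \<phi> x) < \<epsilon> / 2"
         "L2_norm \<Omega> (\<lambda>x. weak_grad \<Omega> u x - weak_grad \<Omega> \<phi> x) < \<epsilon> / 2"
        using u by (metis half_gt_zero)
      then show "\<exists>\<phi>\<in>test_functions \<Omega>. H1_norm \<Omega> (\<lambda>x. u x - \<phi> x) < \<epsilon>"
        using H[of \<phi>] u ge[OF L2_norm_nonneg L2_norm_nonneg \<phi>(2,3)] by metis
    qed (use u in simp)
  qed
qed

lemma H1_0_H1: "u \<in> H1_0 \<Omega> \<Longrightarrow> u \<in> H1 \<Omega>"
  by (simp add: H1_0_def)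

lemma H1_0_L2: "u \<in> H1_0 \<Omega> \<Longrightarrow> u \<in> L2 \<Omega>"
  by (simp add: H1_0_H1 H1_L2)

lemma H1_0_approx:
  assumes "u \<in> H1_0 \<Omega>" "\<epsilon> > 0"
  obtains \<phi> where "\<phi> \<in> test_functions \<Omega>" "L2_norm \<Omega> (\<lambda>x. u x - \<phi> x) < \<epsilon>"
    "L2_norm \<Omega> (\<lambda>x. weak_grad \<Omega> u x - weak_grad \<Omega> \<phi> x) < \<epsilon>"
  using assms unfolding H1_0_iff by blast

text \<open>
  This reduces closure of \<open>H1_0\<close> under linear operations and under limits to approximation by members
  of \<open>H1_0\<close> instead of test functions.
\<close>

lemma H1_0_closed:
  assumes u: "u \<in> H1 \<Omega>"
    and approx: "\<And>\<epsilon>. \<epsilon> > 0 \<Longrightarrow> \<exists>v\<in>H1_0 \<Omega>. L2_norm \<Omega> (\<lambda>x. u x - v x) < \<epsilon>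
      \<and> L2_norm \<Omega> (\<lambda>x. weak_grad \<Omega> u x - weak_grad \<Omega> v x) < \<epsilon>"
  shows "u \<in> H1_0 \<Omega>"
  unfolding H1_0_iff
proof (intro conjI u allI impI)
  fix \<epsilon> :: real assume "\<epsilon> > 0"
  then obtain v where v: "v \<in> H1_0 \<Omega>" "L2_norm \<Omega> (\<lambda>x. u x - v x) < \<epsilon> / 2"
    "L2_norm \<Omega> (\<lambda>x. weak_grad \<Omega> u x - weak_grad \<Omega> v x) < \<epsilon> / 2"
    using approx[of "\<epsilon> / 2"] by auto
  obtain \<phi> where \<phi>: "\<phi> \<in> test_functions \<Omega>" "L2_norm \<Omega> (\<lambda>x. v x - \<phi> x) < \<epsilon> / 2"
    "L2_norm \<Omega> (\<lambda>x. weak_grad \<Omega> v x - weak_grad \<Omega> \<phi> x) < \<epsilon> / 2"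
    using H1_0_approx[OF v(1), of "\<epsilon> / 2"] \<open>\<epsilon> > 0\<close> by auto
  have "L2_norm \<Omega> (\<lambda>x. u x - \<phi> x) < \<epsilon>"
    using L2_triangle_diff[OF H1_L2[OF u] H1_0_L2[OF v(1)] test_L2[OF \<phi>(1)]] v \<phi> by simp
  moreover have "L2_norm \<Omega> (\<lambda>x. weak_grad \<Omega> u x - weak_grad \<Omega> \<phi> x) < \<epsilon>"
    using L2_triangle_diff[OF weak_grad_L2[OF u] weak_grad_L2[OF H1_0_H1[OF v(1)]] weak_grad_L2[OF test_H1[OF \<phi>(1)]]]
      v \<phi> by simp
  ultimately show "\<exists>\<phi>\<in>test_functions \<Omega>. L2_norm \<Omega> (\<lambda>x. u x - \<phi> x) < \<epsilon>
        \<and> L2_norm \<Omega> (\<lambda>x. weak_grad \<Omega> u x - weak_grad \<Omega> \<phi> x) < \<epsilon>"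
    using \<phi>(1) by blast
qed

lemma test_H1_0:
  assumes "\<phi> \<in> test_functions \<Omega>"
  shows "\<phi> \<in> H1_0 \<Omega>"
proof -
  have "L2_norm \<Omega> (\<lambda>x. 0 :: real) = 0" "L2_norm \<Omega> (\<lambda>x. 0 :: real ^ 'n) = 0"
    by (simp_all add: L2_norm_def L2_inner_def)
  then show ?thesis unfolding H1_0_iff using assms by (auto intro!: test_H1 bexI[of _ \<phi>])
qed

lemma H1_0_add:
  assumes "u \<in> H1_0 \<Omega>" "v \<in> H1_0 \<Omega>"
  shows "(\<lambda>x. u x + v x) \<in> H1_0 \<Omega>"
proof (rule H1_0_closed)
  note uv = assms[THEN H1_0_H1]
  show "(\<lambda>x. u x + v x) \<in> H1 \<Omega>" by (rule H1_add(1)[OF uv])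
  fix \<epsilon> :: real assume "\<epsilon> > 0"
  obtain \<phi> where \<phi>: "\<phi> \<in> test_functions \<Omega>" "L2_norm \<Omega> (\<lambda>x. u x - \<phi> x) < \<epsilon> / 2"
    "L2_norm \<Omega> (\<lambda>x. weak_grad \<Omega> u x - weak_grad \<Omega> \<phi> x) < \<epsilon> / 2"
    using H1_0_approx[OF assms(1), of "\<epsilon> / 2"] \<open>\<epsilon> > 0\<close> by auto
  obtain \<eta> where \<eta>: "\<eta> \<in> test_functions \<Omega>" "L2_norm \<Omega> (\<lambda>x. v x - \<eta> x) < \<epsilon> / 2"
    "L2_norm \<Omega> (\<lambda>x. weak_grad \<Omega> v x - weak_grad \<Omega> \<eta> x) < \<epsilon> / 2"
    using H1_0_approx[OF assms(2), of "\<epsilon> / 2"] \<open>\<epsilon> > 0\<close> by auto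
  note te = test_H1[OF \<phi>(1)] test_H1[OF \<eta>(1)]
  have "L2_norm \<Omega> (\<lambda>x. (u x - \<phi> x) + (v x - \<eta> x)) < \<epsilon>"
    using L2_triangle[OF L2_diff L2_diff, OF uv(1)[THEN H1_L2] te(1)[THEN H1_L2] uv(2)[THEN H1_L2] te(2)[THEN H1_L2]] \<phi> \<eta> by simp
  then have 1: "L2_norm \<Omega> (\<lambda>x. (u x + v x) - (\<phi> x + \<eta> x)) < \<epsilon>" by (simp add: algebra_simps)
  have "L2_norm \<Omega> (\<lambda>x. weak_grad \<Omega> (\<lambda>x. u x + v x) x - weak_grad \<Omega> (\<lambda>x. \<phi> x + \<eta> x) x)
      = L2_norm \<Omega> (\<lambda>x. (weak_grad \<Omega> u x - weak_grad \<Omega> \<phi> x) + (weak_grad \<Omega> v x - weak_grad \<Omega> \<eta> x))"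
  proof (rule L2_norm_cong_AE)
    show "AE x in lebesgue_on \<Omega>. weak_grad \<Omega> (\<lambda>x. u x + v x) x - weak_grad \<Omega> (\<lambda>x. \<phi> x + \<eta> x) x
      = (weak_grad \<Omega> u x - weak_grad \<Omega> \<phi> x) + (weak_grad \<Omega> v x - weak_grad \<Omega> \<eta> x)"
      using weak_grad_add[OF uv] weak_grad_add[OF te] by eventually_elim simp
  qed (intro L2_diff L2_add weak_grad_L2 H1_add uv te)+
  also have "\<dots> < \<epsilon>"
    using L2_triangle[OF L2_diff L2_diff, OF uv(1)[THEN weak_grad_L2] te(1)[THEN weak_grad_L2] uv(2)[THEN weak_grad_L2] te(2)[THEN weak_grad_L2]] \<phi> \<eta> by simp
  finally show "\<exists>w\<in>H1_0 \<Omega>. L2_norm \<Omega> (\<lambda>x. u x + v x - w x) < \<epsilon> \<and>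
      L2_norm \<Omega> (\<lambda>x. weak_grad \<Omega> (\<lambda>x. u x + v x) x - weak_grad \<Omega> w x) < \<epsilon>"
    using 1 by (intro bexI[of _ "\<lambda>x. \<phi> x + \<eta> x"] conjI test_H1_0 test_functions_add \<phi>(1) \<eta>(1))
qed

lemma H1_0_scale:
  assumes "u \<in> H1_0 \<Omega>"
  shows "(\<lambda>x. c * u x) \<in> H1_0 \<Omega>"
proof (rule H1_0_closed)
  note u = assms[THEN H1_0_H1]
  show "(\<lambda>x. c * u x) \<in> H1 \<Omega>" by (rule H1_scale(1)[OF u])
  fix \<epsilon> :: real assume "\<epsilon> > 0"
  define \<delta> where "\<delta> = \<epsilon> / (\<bar>c\<bar> + 1)"
  have \<delta>: "\<delta> > 0" "\<bar>c\<bar> * \<delta> < \<epsilon>" using \<open>\<epsilon> > 0\<close> by (auto simp: \<delta>_def field_simps)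
  obtain \<phi> where \<phi>: "\<phi> \<in> test_functions \<Omega>" "L2_norm \<Omega> (\<lambda>x. u x - \<phi> x) < \<delta>"
    "L2_norm \<Omega> (\<lambda>x. weak_grad \<Omega> u x - weak_grad \<Omega> \<phi> x) < \<delta>"
    using H1_0_approx[OF assms \<delta>(1)] by auto
  note te = test_H1[OF \<phi>(1)]
  have small: "\<bar>c\<bar> * t < \<epsilon>" if "t < \<delta>" for t
    using mult_left_mono[of t \<delta> "\<bar>c\<bar>"] that \<delta>(2) by simp
  have 1: "L2_norm \<Omega> (\<lambda>x. c * u x - c * \<phi> x) < \<epsilon>"
    using small[OF \<phi>(2)] L2_norm_scale[of \<Omega> c "\<lambda>x. u x - \<phi> x"] by (simp add: right_diff_distrib)
  have "L2_norm \<Omega> (\<lambda>x. weak_grad \<Omega> (\<lambda>x. c * u x) x - weak_grad \<Omega> (\<lambda>x. c * \<phi> x) x)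
      = L2_norm \<Omega> (\<lambda>x. c *\<^sub>R (weak_grad \<Omega> u x - weak_grad \<Omega> \<phi> x))"
  proof (rule L2_norm_cong_AE)
    show "AE x in lebesgue_on \<Omega>. weak_grad \<Omega> (\<lambda>x. c * u x) x - weak_grad \<Omega> (\<lambda>x. c * \<phi> x) x
      = c *\<^sub>R (weak_grad \<Omega> u x - weak_grad \<Omega> \<phi> x)"
      using weak_grad_scale[OF u, of c] weak_grad_scale[OF te, of c]
      by eventually_elim (simp add: scaleR_diff_right)
  qed (intro L2_diff L2_scale weak_grad_L2 H1_scale u te)+
  also have "\<dots> < \<epsilon>" using small[OF \<phi>(3)] by (simp add: L2_norm_scale)
  finally show "\<exists>w\<in>H1_0 \<Omega>. L2_norm \<Omega> (\<lambda>x. c * u x - w x) < \<epsilon> \<and>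
      L2_norm \<Omega> (\<lambda>x. weak_grad \<Omega> (\<lambda>x. c * u x) x - weak_grad \<Omega> w x) < \<epsilon>"
    using 1 by (intro bexI[of _ "\<lambda>x. c * \<phi> x"] conjI test_H1_0 test_functions_scale \<phi>(1))
qed

lemma H1_0_diff: "u \<in> H1_0 \<Omega> \<Longrightarrow> v \<in> H1_0 \<Omega> \<Longrightarrow> (\<lambda>x. u x - v x) \<in> H1_0 \<Omega>"
  using H1_0_add[OF _ H1_0_scale[of v "-1"]] by simp

section \<open>The Poincare inequality and completeness\<close>

lemma C_k_1_coordinate: "C_k (Suc 0) (\<lambda>x::real^'n. x $ i)"
proof -
  have D: "((\<lambda>x::real^'n. x $ i) has_derivative (\<lambda>x. x $ i)) (at x)" for x
    by (rule bounded_linear_imp_has_derivative[OF bounded_linear_vec_nth])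
  have "partial_deriv j (\<lambda>x::real^'n. x $ i) = (\<lambda>x. axis j 1 $ i)" for j
    using partial_deriv_eq[OF D] by auto
  then show ?thesis using D by (auto simp: differentiable_def)
qed

text \<open>
  Integrate \<open>\<phi>\<^sup>2 = \<phi>\<^sup>2 \<partial>\<^sub>i x\<^sub>i\<close> by parts: on a bounded set the coordinate \<open>x\<^sub>i\<close> is a bounded factor.
\<close>

lemma Poincare_test:
  assumes R: "\<And>x. x \<in> \<Omega> \<Longrightarrow> norm x \<le> R" and "0 \<le> R" and \<phi>: "\<phi> \<in> test_functions \<Omega>"
  shows "L2_norm \<Omega> \<phi> \<le> 2 * R * L2_norm \<Omega> (weak_grad \<Omega> \<phi>)"
proof -
  fix i :: 'n
  obtain K where K: "compact K" "K \<subseteq> \<Omega>" "\<And>x. x \<notin> K \<Longrightarrow> \<phi> x = 0"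
    using test_functions_supp[OF \<phi>] by blast
  define \<xi> where "\<xi> x = x $ i * \<phi> x" for x
  have \<xi>_bound: "(norm (\<xi> x))\<^sup>2 \<le> R\<^sup>2 * (norm (\<phi> x))\<^sup>2" for x
  proof (cases "x \<in> \<Omega>")
    case True
    then have "\<bar>x $ i\<bar> \<le> R" using R[OF True] component_le_norm_cart[of x i] by simp
    then have "\<bar>x $ i * \<phi> x\<bar> \<le> R * \<bar>\<phi> x\<bar>" by (simp add: abs_mult mult_right_mono)
    then have "(\<bar>x $ i * \<phi> x\<bar>)\<^sup>2 \<le> (R * \<bar>\<phi> x\<bar>)\<^sup>2" by (intro power_mono) auto
    then show ?thesis by (simp add: \<xi>_def power_mult_distrib)
  next
    case False
    then show ?thesis using test_functions_zero[OF \<phi>] by (simp add: \<xi>_def)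
  qed
  have [measurable]: "\<phi> \<in> borel_measurable borel" by (rule test_functions_measurable[OF \<phi>])
  have \<xi>_int: "integrable (lebesgue_on \<Omega>) (\<lambda>x. R\<^sup>2 * (norm (\<phi> x))\<^sup>2)"
    by (intro integrable_mult_right L2_integrable_sq test_L2 \<phi>)
  have \<xi>_L2: "\<xi> \<in> L2 \<Omega>"
    unfolding \<xi>_def[abs_def]
    by (rule L2_bound[OF _ \<xi>_int]) (use \<xi>_bound in \<open>auto simp: \<xi>_def intro!: borel_measurable_lebesgue_on\<close>)
  have \<xi>_norm: "L2_norm \<Omega> \<xi> \<le> R * L2_norm \<Omega> \<phi>"
  proof (rule power2_le_imp_le)
    have "(L2_norm \<Omega> \<xi>)\<^sup>2 \<le> (\<integral>x. R\<^sup>2 * (norm (\<phi> x))\<^sup>2 \<partial>lebesgue_on \<Omega>)"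
      unfolding L2_norm_sq L2_inner_self
      by (intro integral_mono L2_integrable_sq[OF \<xi>_L2] \<xi>_int \<xi>_bound)
    then show "(L2_norm \<Omega> \<xi>)\<^sup>2 \<le> (R * L2_norm \<Omega> \<phi>)\<^sup>2"
      by (simp add: power_mult_distrib L2_norm_sq L2_inner_self)
  qed (use \<open>0 \<le> R\<close> in simp)
  define D where "D = partial_deriv i \<phi>"
  have D_L2: "D \<in> L2 \<Omega>" unfolding D_def by (intro test_L2 test_functions_partial_deriv \<phi>)
  have deriv: "partial_deriv i (\<lambda>x. x $ i * (\<phi> x * \<phi> x)) x = 2 * (\<xi> x * D x) + \<phi> x * \<phi> x" for x
  proof -
    have "((\<lambda>x::real^'n. x $ i) has_derivative (\<lambda>x. x $ i)) (at x)"
      by (rule bounded_linear_imp_has_derivative[OF bounded_linear_vec_nth])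
    from partial_deriv_eq[OF this, of i] C_k_1_coordinate[of i] C_k_1_mult[OF test_C1 test_C1, OF \<phi> \<phi>]
    show ?thesis
      using \<phi> by (simp add: partial_deriv_mult test_differentiable D_def \<xi>_def algebra_simps)
  qed
  have "(\<integral>x. partial_deriv i (\<lambda>x. x $ i * (\<phi> x * \<phi> x)) x \<partial>lebesgue_on \<Omega>) = 0"
    by (rule integral_divergence_eq_0[OF _ K(1,2)])
       (intro C_k_1_mult C_k_1_coordinate test_C1 \<phi>, simp add: K(3))
  then have "2 * L2_inner \<Omega> \<xi> D + L2_inner \<Omega> \<phi> \<phi> = 0"
    using L2_integrable_inner[OF \<xi>_L2 D_L2] L2_integrable_inner[OF test_L2[OF \<phi>] test_L2[OF \<phi>]]
    by (simp add: deriv L2_inner_def)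
  then have "(L2_norm \<Omega> \<phi>)\<^sup>2 \<le> 2 * \<bar>L2_inner \<Omega> \<xi> D\<bar>" by (simp add: L2_norm_sq)
  also have "\<dots> \<le> 2 * (L2_norm \<Omega> \<xi> * L2_norm \<Omega> D)"
    using L2_Cauchy_Schwarz[OF \<xi>_L2 D_L2] by simp
  also have "\<dots> \<le> 2 * ((R * L2_norm \<Omega> \<phi>) * L2_norm \<Omega> D)"
    by (intro mult_left_mono mult_right_mono \<xi>_norm) auto
  finally have sq: "L2_norm \<Omega> \<phi> * L2_norm \<Omega> \<phi> \<le> L2_norm \<Omega> \<phi> * (2 * R * L2_norm \<Omega> D)"
    by (simp add: power2_eq_square algebra_simps)
  have "L2_norm \<Omega> \<phi> \<le> 2 * R * L2_norm \<Omega> D"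
  proof (cases "L2_norm \<Omega> \<phi> = 0")
    case False
    then show ?thesis using sq L2_norm_nonneg[of \<Omega> \<phi>] by (metis mult_le_cancel_left_pos order_le_neq_trans)
  qed (use \<open>0 \<le> R\<close> in simp)
  also have "L2_norm \<Omega> D \<le> L2_norm \<Omega> (\<lambda>x. \<chi> i. partial_deriv i \<phi> x)"
    using L2_norm_component_le[OF test_grad_L2[OF \<phi>], of i] by (simp add: D_def)
  also have "\<dots> = L2_norm \<Omega> (weak_grad \<Omega> \<phi>)"
    using weak_grad_test[OF \<phi>] weak_grad_L2[OF test_H1[OF \<phi>]] test_grad_L2[OF \<phi>]
    by (intro L2_norm_cong_AE) (auto elim: eventually_mono)
  finally show ?thesis using \<open>0 \<le> R\<close> by (simp add: mult_left_mono)
qed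

theorem Poincare:
  obtains C where "C \<ge> 0" "\<And>u. u \<in> H1_0 \<Omega> \<Longrightarrow> L2_norm \<Omega> u \<le> C * L2_norm \<Omega> (weak_grad \<Omega> u)"
proof -
  obtain R where R: "R > 0" "\<And>x. x \<in> \<Omega> \<Longrightarrow> norm x \<le> R"
    using bounded by (auto simp: bounded_pos)
  have "L2_norm \<Omega> u \<le> 2 * R * L2_norm \<Omega> (weak_grad \<Omega> u)" if u: "u \<in> H1_0 \<Omega>" for u
  proof (rule field_le_epsilon)
    fix e :: real assume "e > 0"
    define \<epsilon> where "\<epsilon> = e / (2 * R + 1)"
    have \<epsilon>: "\<epsilon> > 0" "(2 * R + 1) * \<epsilon> = e" using \<open>e > 0\<close> R(1) by (auto simp: \<epsilon>_def)
    obtain \<phi> where \<phi>: "\<phi> \<in> test_functions \<Omega>" "L2_norm \<Omega> (\<lambda>x. u x - \<phi> x) < \<epsilon>"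
      "L2_norm \<Omega> (\<lambda>x. weak_grad \<Omega> u x - weak_grad \<Omega> \<phi> x) < \<epsilon>"
      using H1_0_approx[OF u \<epsilon>(1)] by auto
    note L = H1_0_L2[OF u] test_L2[OF \<phi>(1)]
    note G = weak_grad_L2[OF H1_0_H1[OF u]] weak_grad_L2[OF test_H1[OF \<phi>(1)]]
    have "L2_norm \<Omega> u \<le> L2_norm \<Omega> (\<lambda>x. u x - \<phi> x) + L2_norm \<Omega> \<phi>"
      using L2_triangle[OF L2_diff[OF L] L(2)] by simp
    also have "L2_norm \<Omega> \<phi> \<le> 2 * R * L2_norm \<Omega> (weak_grad \<Omega> \<phi>)"
      using Poincare_test[OF R(2) _ \<phi>(1)] R(1) by simp
    also have "L2_norm \<Omega> (weak_grad \<Omega> \<phi>) \<le> L2_norm \<Omega> (\<lambda>x. weak_grad \<Omega> \<phi> x - weak_grad \<Omega> u x) + L2_norm \<Omega> (weak_grad \<Omega> u)"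
      using L2_triangle[OF L2_diff[OF G(2,1)] G(1)] by simp
    also have "L2_norm \<Omega> (\<lambda>x. weak_grad \<Omega> \<phi> x - weak_grad \<Omega> u x) \<le> \<epsilon>"
      using \<phi>(3) by (subst L2_norm_minus_commute) simp
    finally have "L2_norm \<Omega> u \<le> \<epsilon> + 2 * R * (\<epsilon> + L2_norm \<Omega> (weak_grad \<Omega> u))"
      using \<phi>(2) R(1) by (simp add: mult_left_mono)
    then show "L2_norm \<Omega> u \<le> 2 * R * L2_norm \<Omega> (weak_grad \<Omega> u) + e"
      using \<epsilon>(2) by (simp add: algebra_simps)
  qed
  then show ?thesis using that[of "2 * R"] R(1) by simp
qed

end

lemma L2_inner_tendsto:
  assumes "\<And>n. f n \<in> L2 \<Omega>" "g \<in> L2 \<Omega>" "h \<in> L2 \<Omega>" "(\<lambda>n. L2_norm \<Omega> (\<lambda>x. f n x - g x)) \<longlonglongrightarrow> 0"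
  shows "(\<lambda>n. L2_inner \<Omega> (f n) h) \<longlonglongrightarrow> L2_inner \<Omega> g h"
proof (rule LIM_zero_cancel, rule Lim_null_comparison)
  show "\<forall>\<^sub>F n in sequentially. norm (L2_inner \<Omega> (f n) h - L2_inner \<Omega> g h)
      \<le> L2_norm \<Omega> (\<lambda>x. f n x - g x) * L2_norm \<Omega> h"
  proof (rule always_eventually, rule allI)
    fix n
    show "norm (L2_inner \<Omega> (f n) h - L2_inner \<Omega> g h) \<le> L2_norm \<Omega> (\<lambda>x. f n x - g x) * L2_norm \<Omega> h"
      using L2_Cauchy_Schwarz[OF L2_diff[OF assms(1,2)] assms(3)]
      by (simp add: L2_inner_diff_left[OF assms(1,2,3)])
  qed
  show "(\<lambda>n. L2_norm \<Omega> (\<lambda>x. f n x - g x) * L2_norm \<Omega> h) \<longlonglongrightarrow> 0"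
    using tendsto_mult_left_zero[OF assms(4)] by simp
qed

context bounded_open_set
begin

text \<open>
  By the Poincare inequality a sequence whose gradients are Cauchy is itself Cauchy in \<open>L\<^sup>2\<close>, and the
  defining identity of weak gradients passes to \<open>L\<^sup>2\<close> limits.
\<close>

theorem H1_0_complete:
  fixes u :: "nat \<Rightarrow> real ^ 'n \<Rightarrow> real"
  assumes u: "\<And>n. u n \<in> H1_0 \<Omega>"
    and Cauchy: "\<And>\<epsilon>. \<epsilon> > 0 \<Longrightarrow> \<exists>N. \<forall>m\<ge>N. \<forall>n\<ge>N. L2_norm \<Omega> (weak_grad \<Omega> (\<lambda>x. u m x - u n x)) \<le> \<epsilon>"
  obtains v where "v \<in> H1_0 \<Omega>" "(\<lambda>n. L2_norm \<Omega> (weak_grad \<Omega> (\<lambda>x. u n x - v x))) \<longlonglongrightarrow> 0"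
proof -
  note uH = u[THEN H1_0_H1]
  obtain C where C: "C \<ge> 0" "\<And>u. u \<in> H1_0 \<Omega> \<Longrightarrow> L2_norm \<Omega> u \<le> C * L2_norm \<Omega> (weak_grad \<Omega> u)"
    using Poincare by blast
  have "\<exists>N. \<forall>m\<ge>N. \<forall>n\<ge>N. L2_norm \<Omega> (\<lambda>x. u m x - u n x) \<le> \<epsilon>" if "\<epsilon> > 0" for \<epsilon>
  proof -
    have "\<epsilon> / (C + 1) > 0" using that C(1) by simp
    from Cauchy[OF this] obtain N where N: "\<And>m n. m \<ge> N \<Longrightarrow> n \<ge> N \<Longrightarrow>
      L2_norm \<Omega> (weak_grad \<Omega> (\<lambda>x. u m x - u n x)) \<le> \<epsilon> / (C + 1)" by blast
    show ?thesis
    proof (intro exI allI impI)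
      fix m n assume "N \<le> m" "N \<le> n"
      have "L2_norm \<Omega> (\<lambda>x. u m x - u n x) \<le> C * L2_norm \<Omega> (weak_grad \<Omega> (\<lambda>x. u m x - u n x))"
        by (intro C(2) H1_0_diff u)
      also have "\<dots> \<le> C * (\<epsilon> / (C + 1))" using N[OF \<open>N \<le> m\<close> \<open>N \<le> n\<close>] C(1) by (intro mult_left_mono)
      also have "\<dots> \<le> \<epsilon>" using C(1) that by (simp add: field_simps)
      finally show "L2_norm \<Omega> (\<lambda>x. u m x - u n x) \<le> \<epsilon>" .
    qed
  qed
  then obtain v where v: "v \<in> L2 \<Omega>" "(\<lambda>n. L2_norm \<Omega> (\<lambda>x. u n x - v x)) \<longlonglongrightarrow> 0"
    using L2_complete[where f = u, OF bounded open_set H1_0_L2[OF u]] by blast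
  obtain g where g: "g \<in> L2 \<Omega>" "(\<lambda>n. L2_norm \<Omega> (\<lambda>x. weak_grad \<Omega> (u n) x - g x)) \<longlonglongrightarrow> 0"
    using L2_complete[where f = "\<lambda>n. weak_grad \<Omega> (u n)", OF bounded open_set weak_grad_L2[OF uH]] Cauchy
    by (auto simp: weak_grad_norm_diff[OF uH uH])
  have "has_weak_gradient \<Omega> v g"
    unfolding has_weak_gradient_iff
  proof (intro ballI allI)
    fix \<phi> i assume \<phi>: "\<phi> \<in> test_functions \<Omega>"
    have lim1: "(\<lambda>n. L2_inner \<Omega> (u n) (partial_deriv i \<phi>)) \<longlonglongrightarrow> L2_inner \<Omega> v (partial_deriv i \<phi>)"
      by (intro L2_inner_tendsto H1_0_L2 u v test_L2 test_functions_partial_deriv \<phi>)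
    have "(\<lambda>n. L2_norm \<Omega> (\<lambda>x. weak_grad \<Omega> (u n) x $ i - g x $ i)) \<longlonglongrightarrow> 0"
    proof (rule Lim_null_comparison[OF _ g(2)], rule always_eventually, rule allI)
      fix n
      show "norm (L2_norm \<Omega> (\<lambda>x. weak_grad \<Omega> (u n) x $ i - g x $ i)) \<le> L2_norm \<Omega> (\<lambda>x. weak_grad \<Omega> (u n) x - g x)"
        using L2_norm_component_le[OF L2_diff[OF weak_grad_L2[OF uH] g(1)], of n i] by simp
    qed
    then have "(\<lambda>n. L2_inner \<Omega> (\<lambda>x. weak_grad \<Omega> (u n) x $ i) \<phi>) \<longlonglongrightarrow> L2_inner \<Omega> (\<lambda>x. g x $ i) \<phi>"
      using weak_grad_L2[OF uH] g(1) test_L2[OF \<phi>]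
      by (intro L2_inner_tendsto) (auto simp: L2_componentwise[of g] L2_componentwise[of "weak_grad \<Omega> (u _)"])
    then have lim2: "(\<lambda>n. - L2_inner \<Omega> (\<lambda>x. weak_grad \<Omega> (u n) x $ i) \<phi>) \<longlonglongrightarrow> - L2_inner \<Omega> (\<lambda>x. g x $ i) \<phi>"
      by (rule tendsto_minus)
    have "L2_inner \<Omega> (u n) (partial_deriv i \<phi>) = - L2_inner \<Omega> (\<lambda>x. weak_grad \<Omega> (u n) x $ i) \<phi>" for n
      using weak_grad_has_weak_gradient[OF uH] \<phi> by (simp add: has_weak_gradient_iff)
    then show "L2_inner \<Omega> v (partial_deriv i \<phi>) = - L2_inner \<Omega> (\<lambda>x. g x $ i) \<phi>"
      using lim1 lim2 LIMSEQ_unique by auto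
  qed
  then have vH: "v \<in> H1 \<Omega>" and vg: "AE x in lebesgue_on \<Omega>. weak_grad \<Omega> v x = g x"
    using H1I[OF v(1) g(1)] weak_grad_AE_eq[OF v(1) g(1)] by auto
  have diff: "L2_norm \<Omega> (\<lambda>x. weak_grad \<Omega> (u n) x - weak_grad \<Omega> v x) = L2_norm \<Omega> (\<lambda>x. weak_grad \<Omega> (u n) x - g x)" for n
    using vg by (intro L2_norm_cong_AE L2_diff weak_grad_L2 uH vH g(1)) (auto elim: eventually_mono)
  have "v \<in> H1_0 \<Omega>"
  proof (rule H1_0_closed[OF vH])
    fix \<epsilon> :: real assume "\<epsilon> > 0"
    have "\<forall>\<^sub>F n in sequentially. L2_norm \<Omega> (\<lambda>x. u n x - v x) < \<epsilon>"
      "\<forall>\<^sub>F n in sequentially. L2_norm \<Omega> (\<lambda>x. weak_grad \<Omega> (u n) x - weak_grad \<Omega> v x) < \<epsilon>"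
      using order_tendstoD(2)[OF v(2) \<open>\<epsilon> > 0\<close>] order_tendstoD(2)[OF g(2) \<open>\<epsilon> > 0\<close>] by (simp_all add: diff)
    then have "\<forall>\<^sub>F n in sequentially. L2_norm \<Omega> (\<lambda>x. u n x - v x) < \<epsilon> \<and>
       L2_norm \<Omega> (\<lambda>x. weak_grad \<Omega> (u n) x - weak_grad \<Omega> v x) < \<epsilon>" by (rule eventually_conj)
    then obtain n where "L2_norm \<Omega> (\<lambda>x. u n x - v x) < \<epsilon>"
       "L2_norm \<Omega> (\<lambda>x. weak_grad \<Omega> (u n) x - weak_grad \<Omega> v x) < \<epsilon>"
      by (auto simp: eventually_sequentially)
    then show "\<exists>w\<in>H1_0 \<Omega>. L2_norm \<Omega> (\<lambda>x. v x - w x) < \<epsilon> \<and> L2_norm \<Omega> (\<lambda>x. weak_grad \<Omega> v x - weak_grad \<Omega> w x) < \<epsilon>"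
      using u[of n] by (auto simp: L2_norm_minus_commute[of _ "u n"] L2_norm_minus_commute[of _ "weak_grad \<Omega> (u n)"])
  qed
  moreover have "(\<lambda>n. L2_norm \<Omega> (weak_grad \<Omega> (\<lambda>x. u n x - v x))) \<longlonglongrightarrow> 0"
    using g(2) by (simp add: weak_grad_norm_diff[OF uH vH] diff)
  ultimately show ?thesis by (rule that)
qed

end

context bounded_open_set
begin

section \<open>The velocity space as a Hilbert space\<close>

abbreviation grad_norm :: "(real ^ 'n \<Rightarrow> real ^ 'n) \<Rightarrow> real" where
  "grad_norm v \<equiv> L2_norm \<Omega> (vgrad \<Omega> v)"

lemma X_component: "v \<in> X_space \<Omega> \<Longrightarrow> (\<lambda>x. v x $ i) \<in> H1_0 \<Omega>"
  by (simp add: X_space_def)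

lemma X_component_H1: "v \<in> X_space \<Omega> \<Longrightarrow> (\<lambda>x. v x $ i) \<in> H1 \<Omega>"
  by (simp add: X_component H1_0_H1)

lemma X_add: "u \<in> X_space \<Omega> \<Longrightarrow> v \<in> X_space \<Omega> \<Longrightarrow> (\<lambda>x. u x + v x) \<in> X_space \<Omega>"
  by (simp add: X_space_def H1_0_add)

lemma X_scale: "v \<in> X_space \<Omega> \<Longrightarrow> (\<lambda>x. c *\<^sub>R v x) \<in> X_space \<Omega>"
  by (simp add: X_space_def H1_0_scale)

lemma X_diff: "u \<in> X_space \<Omega> \<Longrightarrow> v \<in> X_space \<Omega> \<Longrightarrow> (\<lambda>x. u x - v x) \<in> X_space \<Omega>"
  by (simp add: X_space_def H1_0_diff)

lemma test_X: "(\<And>i. (\<lambda>x. v x $ i) \<in> test_functions \<Omega>) \<Longrightarrow> v \<in> X_space \<Omega>"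
  by (simp add: X_space_def test_H1_0)

lemma zero_test: "(\<lambda>x. 0) \<in> test_functions \<Omega>"
  by (rule test_functionsI[of _ "{}"]) (auto intro: flat_algebra_C_k flat_algebra.const)

lemma X_zero: "(\<lambda>x. 0) \<in> X_space \<Omega>"
  by (rule test_X) (simp add: zero_test)

lemma vgrad_nth: "vgrad \<Omega> v x $ i = weak_grad \<Omega> (\<lambda>y. v y $ i) x"
  by (simp add: vgrad_def)

lemma vgrad_L2: "v \<in> X_space \<Omega> \<Longrightarrow> vgrad \<Omega> v \<in> L2 \<Omega>"
  by (subst L2_componentwise) (simp add: vgrad_nth weak_grad_L2 X_component_H1)

lemma grad_norm_sq: "v \<in> X_space \<Omega> \<Longrightarrow> (grad_norm v)\<^sup>2 = (\<Sum>i\<in>UNIV. (L2_norm \<Omega> (weak_grad \<Omega> (\<lambda>y. v y $ i)))\<^sup>2)"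
  using L2_norm_sq_componentwise[OF vgrad_L2] by (simp add: vgrad_nth)

lemma component_le_grad_norm: "v \<in> X_space \<Omega> \<Longrightarrow> L2_norm \<Omega> (weak_grad \<Omega> (\<lambda>y. v y $ i)) \<le> grad_norm v"
  using L2_norm_component_le[OF vgrad_L2, of v i] by (simp add: vgrad_nth)

lemma vgrad_add:
  assumes "u \<in> X_space \<Omega>" "v \<in> X_space \<Omega>"
  shows "AE x in lebesgue_on \<Omega>. vgrad \<Omega> (\<lambda>x. u x + v x) x = vgrad \<Omega> u x + vgrad \<Omega> v x"
proof -
  have "AE x in lebesgue_on \<Omega>. \<forall>i. weak_grad \<Omega> (\<lambda>x. u x $ i + v x $ i) x
      = weak_grad \<Omega> (\<lambda>x. u x $ i) x + weak_grad \<Omega> (\<lambda>x. v x $ i) x"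
    by (intro AE_all_countable[THEN iffD2] allI weak_grad_add X_component_H1 assms)
  then show ?thesis by eventually_elim (simp add: vec_eq_iff[of "vgrad \<Omega> _ _"] vgrad_nth)
qed

lemma vgrad_scale:
  assumes "v \<in> X_space \<Omega>"
  shows "AE x in lebesgue_on \<Omega>. vgrad \<Omega> (\<lambda>x. c *\<^sub>R v x) x = c *\<^sub>R vgrad \<Omega> v x"
proof -
  have "AE x in lebesgue_on \<Omega>. \<forall>i. weak_grad \<Omega> (\<lambda>x. c * v x $ i) x
      = c *\<^sub>R weak_grad \<Omega> (\<lambda>x. v x $ i) x"
    by (intro AE_all_countable[THEN iffD2] allI weak_grad_scale X_component_H1 assms)
  then show ?thesis by eventually_elim (simp add: vec_eq_iff[of "vgrad \<Omega> _ _"] vgrad_nth)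
qed

lemma vgrad_component_L2:
  assumes "v \<in> X_space \<Omega>"
  shows "(\<lambda>x. vgrad \<Omega> v x $ i $ j) \<in> L2 \<Omega>"
proof -
  have "(\<lambda>x. vgrad \<Omega> v x $ i) \<in> L2 \<Omega>" using vgrad_L2[OF assms] by (simp add: L2_componentwise[of "vgrad \<Omega> v"])
  then show ?thesis using L2_componentwise[of "\<lambda>x. vgrad \<Omega> v x $ i"] by simp
qed

lemma vdiv_eq: "vdiv \<Omega> v = (\<lambda>x. \<Sum>i\<in>UNIV. vgrad \<Omega> v x $ i $ i)"
  by (simp add: vdiv_def[abs_def] trace_def)

lemma vdiv_L2: "v \<in> X_space \<Omega> \<Longrightarrow> vdiv \<Omega> v \<in> L2 \<Omega>"
  unfolding vdiv_eq by (intro L2_sum vgrad_component_L2) auto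

lemma vdiv_add:
  assumes "u \<in> X_space \<Omega>" "v \<in> X_space \<Omega>"
  shows "AE x in lebesgue_on \<Omega>. vdiv \<Omega> (\<lambda>x. u x + v x) x = vdiv \<Omega> u x + vdiv \<Omega> v x"
  using vgrad_add[OF assms] by eventually_elim (simp add: vdiv_eq sum.distrib)

lemma vdiv_scale:
  assumes "v \<in> X_space \<Omega>"
  shows "AE x in lebesgue_on \<Omega>. vdiv \<Omega> (\<lambda>x. c *\<^sub>R v x) x = c *\<^sub>R vdiv \<Omega> v x"
  using vgrad_scale[OF assms, of c] by eventually_elim (simp add: vdiv_eq sum_distrib_left)

lemma L2_norm_sum_le:
  "finite I \<Longrightarrow> (\<And>i. i \<in> I \<Longrightarrow> f i \<in> L2 \<Omega>) \<Longrightarrow> L2_norm \<Omega> (\<lambda>x. \<Sum>i\<in>I. f i x) \<le> (\<Sum>i\<in>I. L2_norm \<Omega> (f i))"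
proof (induction I rule: finite_induct)
  case empty
  then show ?case by (simp add: L2_norm_def L2_inner_def)
next
  case (insert i I)
  have "L2_norm \<Omega> (\<lambda>x. f i x + (\<Sum>i\<in>I. f i x)) \<le> L2_norm \<Omega> (f i) + L2_norm \<Omega> (\<lambda>x. \<Sum>i\<in>I. f i x)"
    using insert by (intro L2_triangle L2_sum) auto
  with insert show ?case by simp
qed

lemma vdiv_le_grad_norm:
  assumes "v \<in> X_space \<Omega>"
  shows "L2_norm \<Omega> (vdiv \<Omega> v) \<le> real CARD('n) * grad_norm v"
proof -
  have "L2_norm \<Omega> (vdiv \<Omega> v) \<le> (\<Sum>i\<in>UNIV. L2_norm \<Omega> (\<lambda>x. vgrad \<Omega> v x $ i $ i))"
    unfolding vdiv_eq by (intro L2_norm_sum_le vgrad_component_L2 assms) auto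
  also have "\<dots> \<le> (\<Sum>i\<in>(UNIV::'n set). grad_norm v)"
  proof (rule sum_mono)
    fix i
    have *: "(\<lambda>x. vgrad \<Omega> v x $ i) \<in> L2 \<Omega>"
      using vgrad_L2[OF assms] by (simp add: L2_componentwise[of "vgrad \<Omega> v"])
    show "L2_norm \<Omega> (\<lambda>x. vgrad \<Omega> v x $ i $ i) \<le> grad_norm v"
      using L2_norm_component_le[OF *, of i] L2_norm_component_le[OF vgrad_L2[OF assms], of i] by simp
  qed
  finally show ?thesis by simp
qed

lemma inner_vgrad_add:
  assumes "u \<in> X_space \<Omega>" "v \<in> X_space \<Omega>" "h \<in> L2 \<Omega>"
  shows "L2_inner \<Omega> (vgrad \<Omega> (\<lambda>x. u x + v x)) h = L2_inner \<Omega> (vgrad \<Omega> u) h + L2_inner \<Omega> (vgrad \<Omega> v) h"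
proof -
  have "L2_inner \<Omega> (vgrad \<Omega> (\<lambda>x. u x + v x)) h = L2_inner \<Omega> (\<lambda>x. vgrad \<Omega> u x + vgrad \<Omega> v x) h"
    by (intro L2_inner_cong_AE vgrad_add vgrad_L2 X_add L2_add assms) simp
  then show ?thesis by (simp add: L2_inner_add_left vgrad_L2 assms)
qed

lemma inner_vgrad_scale:
  assumes "v \<in> X_space \<Omega>" "h \<in> L2 \<Omega>"
  shows "L2_inner \<Omega> (vgrad \<Omega> (\<lambda>x. c *\<^sub>R v x)) h = c * L2_inner \<Omega> (vgrad \<Omega> v) h"
proof -
  have "L2_inner \<Omega> (vgrad \<Omega> (\<lambda>x. c *\<^sub>R v x)) h = L2_inner \<Omega> (\<lambda>x. c *\<^sub>R vgrad \<Omega> v x) h"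
    by (intro L2_inner_cong_AE vgrad_scale vgrad_L2 X_scale L2_scale assms) simp
  then show ?thesis by (simp add: L2_inner_scale_left)
qed

lemma inner_vdiv_add:
  assumes "u \<in> X_space \<Omega>" "v \<in> X_space \<Omega>" "h \<in> L2 \<Omega>"
  shows "L2_inner \<Omega> (vdiv \<Omega> (\<lambda>x. u x + v x)) h = L2_inner \<Omega> (vdiv \<Omega> u) h + L2_inner \<Omega> (vdiv \<Omega> v) h"
proof -
  have "L2_inner \<Omega> (vdiv \<Omega> (\<lambda>x. u x + v x)) h = L2_inner \<Omega> (\<lambda>x. vdiv \<Omega> u x + vdiv \<Omega> v x) h"
    by (intro L2_inner_cong_AE vdiv_add vdiv_L2 X_add L2_add assms) simp
  then show ?thesis by (simp add: L2_inner_add_left vdiv_L2 assms)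
qed

lemma inner_vdiv_scale:
  assumes "v \<in> X_space \<Omega>" "h \<in> L2 \<Omega>"
  shows "L2_inner \<Omega> (vdiv \<Omega> (\<lambda>x. c *\<^sub>R v x)) h = c * L2_inner \<Omega> (vdiv \<Omega> v) h"
proof -
  have "L2_inner \<Omega> (vdiv \<Omega> (\<lambda>x. c *\<^sub>R v x)) h = L2_inner \<Omega> (\<lambda>x. c *\<^sub>R vdiv \<Omega> v x) h"
    by (intro L2_inner_cong_AE vdiv_scale vdiv_L2 X_scale L2_scale assms) simp
  then show ?thesis by (simp only: L2_inner_scale_left)
qed

lemma a_commute: "a_form \<nu> \<gamma> \<Omega> u v = a_form \<nu> \<gamma> \<Omega> v u"
  by (simp add: a_form_def L2_inner_commute)

lemma a_add_left:
  "u \<in> X_space \<Omega> \<Longrightarrow> v \<in> X_space \<Omega> \<Longrightarrow> w \<in> X_space \<Omega> \<Longrightarrow>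
    a_form \<nu> \<gamma> \<Omega> (\<lambda>x. u x + v x) w = a_form \<nu> \<gamma> \<Omega> u w + a_form \<nu> \<gamma> \<Omega> v w"
  by (simp add: a_form_def inner_vgrad_add inner_vdiv_add vgrad_L2 vdiv_L2 algebra_simps)

lemma a_scale_left:
  "v \<in> X_space \<Omega> \<Longrightarrow> w \<in> X_space \<Omega> \<Longrightarrow> a_form \<nu> \<gamma> \<Omega> (\<lambda>x. c *\<^sub>R v x) w = c * a_form \<nu> \<gamma> \<Omega> v w"
  by (simp add: a_form_def inner_vgrad_scale inner_vdiv_scale vgrad_L2 vdiv_L2 algebra_simps)

lemma a_diff_left:
  "u \<in> X_space \<Omega> \<Longrightarrow> v \<in> X_space \<Omega> \<Longrightarrow> w \<in> X_space \<Omega> \<Longrightarrow>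
    a_form \<nu> \<gamma> \<Omega> (\<lambda>x. u x - v x) w = a_form \<nu> \<gamma> \<Omega> u w - a_form \<nu> \<gamma> \<Omega> v w"
  using a_add_left[OF _ X_scale[of v "-1"]] a_scale_left[of v w \<nu> \<gamma> "-1"] by simp

lemma a_add_right:
  "u \<in> X_space \<Omega> \<Longrightarrow> v \<in> X_space \<Omega> \<Longrightarrow> w \<in> X_space \<Omega> \<Longrightarrow>
    a_form \<nu> \<gamma> \<Omega> w (\<lambda>x. u x + v x) = a_form \<nu> \<gamma> \<Omega> w u + a_form \<nu> \<gamma> \<Omega> w v"
  using a_add_left[of u v w] by (simp add: a_commute)

lemma a_scale_right:
  "v \<in> X_space \<Omega> \<Longrightarrow> w \<in> X_space \<Omega> \<Longrightarrow> a_form \<nu> \<gamma> \<Omega> w (\<lambda>x. c *\<^sub>R v x) = c * a_form \<nu> \<gamma> \<Omega> w v"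
  using a_scale_left[of v w] by (simp add: a_commute)

lemma a_diff_right:
  "u \<in> X_space \<Omega> \<Longrightarrow> v \<in> X_space \<Omega> \<Longrightarrow> w \<in> X_space \<Omega> \<Longrightarrow>
    a_form \<nu> \<gamma> \<Omega> w (\<lambda>x. u x - v x) = a_form \<nu> \<gamma> \<Omega> w u - a_form \<nu> \<gamma> \<Omega> w v"
  using a_diff_left[of u v w] by (simp add: a_commute)

lemma a_self: "a_form \<nu> \<gamma> \<Omega> v v = \<nu> * (grad_norm v)\<^sup>2 + \<gamma> * (L2_norm \<Omega> (vdiv \<Omega> v))\<^sup>2"
  by (simp add: a_form_def L2_norm_sq)

lemma a_bound:
  assumes "0 \<le> \<nu>" "0 \<le> \<gamma>" "u \<in> X_space \<Omega>" "v \<in> X_space \<Omega>"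
  shows "\<bar>a_form \<nu> \<gamma> \<Omega> u v\<bar> \<le> (\<nu> + \<gamma> * (real CARD('n))\<^sup>2) * grad_norm u * grad_norm v"
proof -
  have "\<bar>a_form \<nu> \<gamma> \<Omega> u v\<bar> \<le> \<nu> * \<bar>L2_inner \<Omega> (vgrad \<Omega> u) (vgrad \<Omega> v)\<bar> + \<gamma> * \<bar>L2_inner \<Omega> (vdiv \<Omega> u) (vdiv \<Omega> v)\<bar>"
    unfolding a_form_def using assms(1,2) by (intro order_trans[OF abs_triangle_ineq]) (simp add: abs_mult)
  also have "\<dots> \<le> \<nu> * (grad_norm u * grad_norm v) + \<gamma> * (L2_norm \<Omega> (vdiv \<Omega> u) * L2_norm \<Omega> (vdiv \<Omega> v))"
    using assms by (intro add_mono mult_left_mono L2_Cauchy_Schwarz vgrad_L2 vdiv_L2)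
  also have "\<dots> \<le> \<nu> * (grad_norm u * grad_norm v) + \<gamma> * ((real CARD('n) * grad_norm u) * (real CARD('n) * grad_norm v))"
    using assms by (intro add_left_mono mult_left_mono mult_mono vdiv_le_grad_norm) auto
  finally show ?thesis by (simp add: algebra_simps power2_eq_square)
qed

lemma grad_norm_scale:
  assumes "v \<in> X_space \<Omega>"
  shows "grad_norm (\<lambda>x. c *\<^sub>R v x) = \<bar>c\<bar> * grad_norm v"
proof -
  have "grad_norm (\<lambda>x. c *\<^sub>R v x) = L2_norm \<Omega> (\<lambda>x. c *\<^sub>R vgrad \<Omega> v x)"
    by (intro L2_norm_cong_AE vgrad_scale vgrad_L2 X_scale L2_scale assms)
  then show ?thesis by (simp add: L2_norm_scale)
qed

lemma grad_norm_triangle: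
  assumes "u \<in> X_space \<Omega>" "v \<in> X_space \<Omega>"
  shows "grad_norm (\<lambda>x. u x + v x) \<le> grad_norm u + grad_norm v"
proof -
  have "grad_norm (\<lambda>x. u x + v x) = L2_norm \<Omega> (\<lambda>x. vgrad \<Omega> u x + vgrad \<Omega> v x)"
    by (intro L2_norm_cong_AE vgrad_add vgrad_L2 X_add L2_add assms)
  then show ?thesis by (simp add: L2_triangle vgrad_L2 assms)
qed

lemma X_complete:
  fixes u :: "nat \<Rightarrow> real ^ 'n \<Rightarrow> real ^ 'n"
  assumes u: "\<And>n. u n \<in> X_space \<Omega>"
    and Cauchy: "\<And>\<epsilon>. \<epsilon> > 0 \<Longrightarrow> \<exists>N. \<forall>m\<ge>N. \<forall>n\<ge>N. grad_norm (\<lambda>x. u m x - u n x) \<le> \<epsilon>"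
  obtains v where "v \<in> X_space \<Omega>" "(\<lambda>n. grad_norm (\<lambda>x. u n x - v x)) \<longlonglongrightarrow> 0"
proof -
  have "\<exists>w. w \<in> H1_0 \<Omega> \<and> (\<lambda>n. L2_norm \<Omega> (weak_grad \<Omega> (\<lambda>x. u n x $ i - w x))) \<longlonglongrightarrow> 0" for i
  proof (rule H1_0_complete[of "\<lambda>n x. u n x $ i"])
    show "(\<lambda>x. u n x $ i) \<in> H1_0 \<Omega>" for n by (rule X_component[OF u])
    fix \<epsilon> :: real assume "\<epsilon> > 0"
    then obtain N where "\<And>m n. N \<le> m \<Longrightarrow> N \<le> n \<Longrightarrow> grad_norm (\<lambda>x. u m x - u n x) \<le> \<epsilon>" using Cauchy by blast
    then show "\<exists>N. \<forall>m\<ge>N. \<forall>n\<ge>N. L2_norm \<Omega> (weak_grad \<Omega> (\<lambda>x. u m x $ i - u n x $ i)) \<le> \<epsilon>"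
      using order_trans[OF component_le_grad_norm[OF X_diff[OF u u], of _ _ i]] by (simp, blast)
  qed blast
  then have "\<exists>w. \<forall>i. w i \<in> H1_0 \<Omega> \<and> (\<lambda>n. L2_norm \<Omega> (weak_grad \<Omega> (\<lambda>x. u n x $ i - w i x))) \<longlonglongrightarrow> 0"
    by (intro choice allI)
  then obtain w where w: "\<And>i. w i \<in> H1_0 \<Omega>"
    "\<And>i. (\<lambda>n. L2_norm \<Omega> (weak_grad \<Omega> (\<lambda>x. u n x $ i - w i x))) \<longlonglongrightarrow> 0" by blast
  define v where "v x = (\<chi> i. w i x)" for x
  have v: "v \<in> X_space \<Omega>" using w(1) by (simp add: X_space_def v_def)
  have "(\<lambda>n. sqrt (\<Sum>i\<in>UNIV. (L2_norm \<Omega> (weak_grad \<Omega> (\<lambda>x. u n x $ i - w i x)))\<^sup>2)) \<longlonglongrightarrow> sqrt (\<Sum>i\<in>(UNIV::'n set). 0\<^sup>2)"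
    by (intro tendsto_intros w(2))
  moreover have "grad_norm (\<lambda>x. u n x - v x) = sqrt (\<Sum>i\<in>UNIV. (L2_norm \<Omega> (weak_grad \<Omega> (\<lambda>x. u n x $ i - w i x)))\<^sup>2)" for n
    using grad_norm_sq[OF X_diff[OF u v], of n] by (simp add: v_def real_sqrt_unique)
  ultimately have "(\<lambda>n. grad_norm (\<lambda>x. u n x - v x)) \<longlonglongrightarrow> 0" by simp
  with v show ?thesis by (rule that)
qed

lemma X_approx:
  assumes v: "v \<in> X_space \<Omega>" and "\<epsilon> > 0"
  obtains \<phi> where "\<And>i. (\<lambda>x. \<phi> x $ i) \<in> test_functions \<Omega>" "grad_norm (\<lambda>x. v x - \<phi> x) < \<epsilon>"
proof -
  define \<delta> where "\<delta> = \<epsilon> / real CARD('n)"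
  have \<delta>: "\<delta> > 0" using assms(2) by (simp add: \<delta>_def)
  have "\<exists>\<phi>. \<phi> \<in> test_functions \<Omega> \<and> L2_norm \<Omega> (\<lambda>x. weak_grad \<Omega> (\<lambda>x. v x $ i) x - weak_grad \<Omega> \<phi> x) < \<delta>" for i
    using H1_0_approx[OF X_component[OF v] \<delta>] by blast
  then have "\<exists>w. \<forall>i. w i \<in> test_functions \<Omega> \<and>
      L2_norm \<Omega> (\<lambda>x. weak_grad \<Omega> (\<lambda>x. v x $ i) x - weak_grad \<Omega> (w i) x) < \<delta>"
    by (intro choice allI)
  then obtain w where w: "\<And>i. w i \<in> test_functions \<Omega>"
    "\<And>i. L2_norm \<Omega> (\<lambda>x. weak_grad \<Omega> (\<lambda>x. v x $ i) x - weak_grad \<Omega> (w i) x) < \<delta>" by blast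
  define \<phi> where "\<phi> x = (\<chi> i. w i x)" for x
  have \<phi>: "(\<lambda>x. \<phi> x $ i) \<in> test_functions \<Omega>" for i using w by (simp add: \<phi>_def)
  have "grad_norm (\<lambda>x. v x - \<phi> x) = sqrt (\<Sum>i\<in>UNIV. (L2_norm \<Omega> (weak_grad \<Omega> (\<lambda>x. v x $ i - w i x)))\<^sup>2)"
    using grad_norm_sq[OF X_diff[OF v test_X[OF \<phi>]]] by (simp add: \<phi>_def real_sqrt_unique)
  also have "\<dots> \<le> (\<Sum>i\<in>UNIV. L2_norm \<Omega> (weak_grad \<Omega> (\<lambda>x. v x $ i - w i x)))"
    using L2_set_le_sum[of UNIV "\<lambda>i. L2_norm \<Omega> (weak_grad \<Omega> (\<lambda>x. v x $ i - w i x))"] by (simp add: L2_set_def)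
  also have "\<dots> < (\<Sum>i\<in>(UNIV::'n set). \<delta>)"
    by (intro sum_strict_mono) (simp_all add: weak_grad_norm_diff X_component_H1 v test_H1 w)
  also have "\<dots> = \<epsilon>" by (simp add: \<delta>_def)
  finally show ?thesis using that \<phi> by blast
qed

text \<open>
  The solution minimises \<open>J v = a(v, v) - 2 g(v)\<close>; by the parallelogram identity minimising sequences
  are Cauchy in the energy norm.
\<close>

theorem Riesz_representation:
  assumes \<nu>: "\<nu> > 0" and \<gamma>: "\<gamma> \<ge> 0" and g: "g \<in> X_dual \<Omega>"
  obtains u where "u \<in> X_space \<Omega>" "\<And>v. v \<in> X_space \<Omega> \<Longrightarrow> a_form \<nu> \<gamma> \<Omega> u v = g v"
proof -
  let ?X = "X_space \<Omega>" and ?a = "a_form \<nu> \<gamma> \<Omega>"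
  have g_add: "g (\<lambda>x. u x + v x) = g u + g v" if "u \<in> ?X" "v \<in> ?X" for u v
    using g that by (simp add: X_dual_def)
  have g_scale: "g (\<lambda>x. c *\<^sub>R v x) = c * g v" if "v \<in> ?X" for c v
    using g that by (simp add: X_dual_def)
  obtain C where C: "\<And>v. v \<in> ?X \<Longrightarrow> \<bar>g v\<bar> \<le> C * grad_norm v"
    using g unfolding X_dual_def by blast
  have coer: "\<nu> * (grad_norm v)\<^sup>2 \<le> ?a v v" for v using \<gamma> by (simp add: a_self)
  define J where "J v = ?a v v - 2 * g v" for v
  have J_lower: "- C\<^sup>2 / \<nu> \<le> J v" if "v \<in> ?X" for v
  proof -
    have "0 \<le> (\<nu> * grad_norm v - C)\<^sup>2 / \<nu>" using \<nu> by simp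
    also have "\<dots> = \<nu> * (grad_norm v)\<^sup>2 - 2 * (C * grad_norm v) + C\<^sup>2 / \<nu>"
      using \<nu> by (simp add: field_simps power2_eq_square)
    finally show ?thesis unfolding J_def using coer[of v] C[OF that] by linarith
  qed
  define m where "m = Inf (J ` ?X)"
  have m_le: "m \<le> J v" if "v \<in> ?X" for v
    unfolding m_def using J_lower that by (intro cInf_lower) (auto simp: bdd_below_def)
  have "\<exists>v\<in>?X. J v < m + 1 / real (Suc n)" for n
  proof -
    have "Inf (J ` ?X) < m + 1 / real (Suc n)" by (simp add: m_def)
    then show ?thesis using cInf_lessD[of "J ` ?X"] X_zero by blast
  qed
  then obtain v where v: "\<And>n. v n \<in> ?X" "\<And>n. J (v n) < m + 1 / real (Suc n)" by metis
  have J_add: "J (\<lambda>x. u x + t *\<^sub>R w x) = J u + 2 * t * (?a u w - g w) + t\<^sup>2 * ?a w w"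
    if "u \<in> ?X" "w \<in> ?X" for u w t
    using that
    by (simp add: J_def a_add_left a_add_right a_scale_left a_scale_right X_add X_scale g_add g_scale
        a_commute[of _ _ w u] power2_eq_square algebra_simps)
  have parallelogram: "?a (\<lambda>x. u x - w x) (\<lambda>x. u x - w x) \<le> 2 * (J u - m) + 2 * (J w - m)"
    if "u \<in> ?X" "w \<in> ?X" for u w
  proof -
    note d = X_diff[OF that(2,1)]
    have mid: "(\<lambda>x. u x + (1/2) *\<^sub>R (w x - u x)) \<in> ?X" by (intro X_add X_scale d that)
    have "m \<le> J (\<lambda>x. u x + (1/2) *\<^sub>R (w x - u x))" by (rule m_le[OF mid])
    also have "\<dots> = J u + (?a u (\<lambda>x. w x - u x) - g (\<lambda>x. w x - u x)) + 1/4 * ?a (\<lambda>x. w x - u x) (\<lambda>x. w x - u x)"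
      using J_add[OF that(1) d, of "1/2"] by (simp add: power2_eq_square)
    finally have 1: "m \<le> \<dots>" .
    have 2: "J w = J u + 2 * (?a u (\<lambda>x. w x - u x) - g (\<lambda>x. w x - u x)) + ?a (\<lambda>x. w x - u x) (\<lambda>x. w x - u x)"
      using J_add[OF that(1) d, of 1] by simp
    have 3: "?a (\<lambda>x. u x - w x) (\<lambda>x. u x - w x) = ?a (\<lambda>x. w x - u x) (\<lambda>x. w x - u x)"
      using that by (simp add: a_diff_left a_diff_right X_diff)
    show ?thesis unfolding 3 using 1 2 by simp
  qed
  have "\<exists>N. \<forall>i\<ge>N. \<forall>j\<ge>N. grad_norm (\<lambda>x. v i x - v j x) \<le> \<epsilon>" if "\<epsilon> > 0" for \<epsilon>
  proof -
    have "\<nu> * \<epsilon>\<^sup>2 / 4 > 0" using \<nu> that by simp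
    then obtain N where N: "1 / real (Suc N) < \<nu> * \<epsilon>\<^sup>2 / 4" using nat_approx_posE by metis
    have vN: "J (v i) - m \<le> \<nu> * \<epsilon>\<^sup>2 / 4" if "i \<ge> N" for i
    proof -
      have "1 / real (Suc i) \<le> 1 / real (Suc N)" using that by (simp add: field_simps)
      then show ?thesis using v(2)[of i] N by linarith
    qed
    show ?thesis
    proof (intro exI allI impI)
      fix i j assume ij: "N \<le> i" "N \<le> j"
      have "\<nu> * (grad_norm (\<lambda>x. v i x - v j x))\<^sup>2 \<le> \<nu> * \<epsilon>\<^sup>2"
        using coer[of "\<lambda>x. v i x - v j x"] parallelogram[OF v(1)[of i] v(1)[of j]] vN[OF ij(1)] vN[OF ij(2)] by simp
      then have "(grad_norm (\<lambda>x. v i x - v j x))\<^sup>2 \<le> \<epsilon>\<^sup>2" using \<nu> by simp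
      then show "grad_norm (\<lambda>x. v i x - v j x) \<le> \<epsilon>" using that by (rule power2_le_imp_le[OF _ less_imp_le])
    qed
  qed
  then obtain u where u: "u \<in> ?X" "(\<lambda>n. grad_norm (\<lambda>x. v n x - u x)) \<longlonglongrightarrow> 0"
    using X_complete[of v] v(1) by blast
  have "?a u w = g w" if w: "w \<in> ?X" for w
  proof -
    have lim: "(\<lambda>n. ?a (v n) w) \<longlonglongrightarrow> ?a u w"
    proof (rule LIM_zero_cancel, rule Lim_null_comparison)
      let ?A = "\<nu> + \<gamma> * (real CARD('n))\<^sup>2"
      show "\<forall>\<^sub>F n in sequentially. norm (?a (v n) w - ?a u w) \<le> ?A * grad_norm (\<lambda>x. v n x - u x) * grad_norm w"
        using a_bound[OF _ \<gamma> X_diff[OF v(1) u(1)] w, of \<nu>] \<nu> by (simp add: a_diff_left v(1) u(1) w)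
      show "(\<lambda>n. ?A * grad_norm (\<lambda>x. v n x - u x) * grad_norm w) \<longlonglongrightarrow> 0"
        using tendsto_mult_left_zero[OF tendsto_mult_right_zero[OF u(2)], of ?A "grad_norm w"] by simp
    qed
    have "0 \<le> 0 + 2 * t * (?a u w - g w) + t\<^sup>2 * ?a w w" for t
    proof (rule LIMSEQ_le_const)
      show "(\<lambda>n. 1 / real (Suc n) + 2 * t * (?a (v n) w - g w) + t\<^sup>2 * ?a w w)
          \<longlonglongrightarrow> 0 + 2 * t * (?a u w - g w) + t\<^sup>2 * ?a w w"
        by (intro tendsto_intros lim LIMSEQ_Suc[OF lim_1_over_n])
      have "0 \<le> 1 / real (Suc n) + 2 * t * (?a (v n) w - g w) + t\<^sup>2 * ?a w w" for n
        using m_le[OF X_add[OF v(1)[of n] X_scale[OF w, of t]]] v(2)[of n] J_add[OF v(1)[of n] w, of t] by linarith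
      then show "\<exists>N. \<forall>n\<ge>N. 0 \<le> 1 / real (Suc n) + 2 * t * (?a (v n) w - g w) + t\<^sup>2 * ?a w w" by blast
    qed
    then have "(?a u w - g w)\<^sup>2 \<le> 0 * ?a w w" by (rule quadratic_nonneg_imp_discriminant)
    then show ?thesis by simp
  qed
  with u(1) show ?thesis by (rule that)
qed

lemma L_op_inverse:
  assumes "\<nu> > 0" "\<gamma> \<ge> 0" "g \<in> X_dual \<Omega>"
  shows "X_inverse \<Omega> (L_op \<nu> \<gamma> \<Omega>) g \<in> X_space \<Omega>"
    and "v \<in> X_space \<Omega> \<Longrightarrow> a_form \<nu> \<gamma> \<Omega> (X_inverse \<Omega> (L_op \<nu> \<gamma> \<Omega>) g) v = g v"
proof -
  have "\<exists>u. u \<in> X_space \<Omega> \<and> (\<forall>v \<in> X_space \<Omega>. L_op \<nu> \<gamma> \<Omega> u v = g v)"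
  proof (rule Riesz_representation[OF assms])
    fix u assume "u \<in> X_space \<Omega>" "\<And>v. v \<in> X_space \<Omega> \<Longrightarrow> a_form \<nu> \<gamma> \<Omega> u v = g v"
    then show ?thesis unfolding L_op_def by (intro exI[of _ u]) simp
  qed
  from someI_ex[OF this] have "X_inverse \<Omega> (L_op \<nu> \<gamma> \<Omega>) g \<in> X_space \<Omega> \<and>
      (\<forall>v \<in> X_space \<Omega>. L_op \<nu> \<gamma> \<Omega> (X_inverse \<Omega> (L_op \<nu> \<gamma> \<Omega>) g) v = g v)"
    unfolding X_inverse_def .
  then show "X_inverse \<Omega> (L_op \<nu> \<gamma> \<Omega>) g \<in> X_space \<Omega>"
    "v \<in> X_space \<Omega> \<Longrightarrow> a_form \<nu> \<gamma> \<Omega> (X_inverse \<Omega> (L_op \<nu> \<gamma> \<Omega>) g) v = g v"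
    by (auto simp: L_op_def)
qed

text \<open>
  The dual norm is the gradient norm of the Riesz representative, so the estimate is Cauchy-Schwarz.
\<close>

lemma dual_norm_bound:
  assumes f: "f \<in> X_dual \<Omega>"
  shows "v \<in> X_space \<Omega> \<Longrightarrow> \<bar>f v\<bar> \<le> dual_norm \<Omega> f * grad_norm v" and "0 \<le> dual_norm \<Omega> f"
proof -
  have "neg_laplacian \<Omega> = L_op 1 0 \<Omega>"
    by (simp add: neg_laplacian_def L_op_def a_form_def fun_eq_iff)
  then obtain w where w: "w = X_inverse \<Omega> (neg_laplacian \<Omega>) f" "w \<in> X_space \<Omega>"
    "\<And>v. v \<in> X_space \<Omega> \<Longrightarrow> a_form 1 0 \<Omega> w v = f v"
    using L_op_inverse[OF _ _ f, of 1 0] by simp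
  have "dual_norm \<Omega> f = grad_norm w"
    unfolding dual_norm_def w(1)[symmetric] w(3)[OF w(2), symmetric] by (simp add: a_self)
  then show "v \<in> X_space \<Omega> \<Longrightarrow> \<bar>f v\<bar> \<le> dual_norm \<Omega> f * grad_norm v" "0 \<le> dual_norm \<Omega> f"
    using w(3)[of v] a_bound[of 1 0 w v] w(2) by auto
qed

end

section \<open>Ladyzhenskaya's inequality\<close>

lemma nn_integral_lborel_pair:
  fixes F :: "'a::euclidean_space \<times> 'b::euclidean_space \<Rightarrow> ennreal"
  assumes [measurable]: "F \<in> borel_measurable borel"
  shows "(\<integral>\<^sup>+z. F z \<partial>lborel) = (\<integral>\<^sup>+x. \<integral>\<^sup>+y. F (x, y) \<partial>lborel \<partial>lborel)"
    and "(\<integral>\<^sup>+z. F z \<partial>lborel) = (\<integral>\<^sup>+y. \<integral>\<^sup>+x. F (x, y) \<partial>lborel \<partial>lborel)"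
proof -
  have F: "F \<in> borel_measurable (lborel \<Otimes>\<^sub>M lborel)" by (simp add: lborel_prod)
  show "(\<integral>\<^sup>+z. F z \<partial>lborel) = (\<integral>\<^sup>+x. \<integral>\<^sup>+y. F (x, y) \<partial>lborel \<partial>lborel)"
    using lborel.nn_integral_fst[OF F] by (simp add: lborel_prod)
  show "(\<integral>\<^sup>+z. F z \<partial>lborel) = (\<integral>\<^sup>+y. \<integral>\<^sup>+x. F (x, y) \<partial>lborel \<partial>lborel)"
    using lborel_pair.nn_integral_snd[of "F"] F by (simp add: lborel_prod)
qed

text \<open>
  A function dominated on every line by the integral of \<open>W\<close> over that line is dominated by a product
  of a function of \<open>x\<close> and a function of \<open>y\<close>, whose integral factorises.
\<close>

lemma square_integral_le_of_line_bounds: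
  fixes F W :: "real \<times> real \<Rightarrow> ennreal"
  assumes [measurable]: "F \<in> borel_measurable borel" "W \<in> borel_measurable borel"
    and 1: "\<And>x y. F (x, y) \<le> (\<integral>\<^sup>+t. W (t, y) \<partial>lborel)"
    and 2: "\<And>x y. F (x, y) \<le> (\<integral>\<^sup>+t. W (x, t) \<partial>lborel)"
  shows "(\<integral>\<^sup>+z. (F z)\<^sup>2 \<partial>lborel) \<le> (\<integral>\<^sup>+z. W z \<partial>lborel)\<^sup>2"
proof -
  have "(\<integral>\<^sup>+z. (F z)\<^sup>2 \<partial>lborel) = (\<integral>\<^sup>+x. \<integral>\<^sup>+y. (F (x, y))\<^sup>2 \<partial>lborel \<partial>lborel)"
    by (rule nn_integral_lborel_pair) measurable
  also have "\<dots> \<le> (\<integral>\<^sup>+x. \<integral>\<^sup>+y. (\<integral>\<^sup>+t. W (x, t) \<partial>lborel) * (\<integral>\<^sup>+t. W (t, y) \<partial>lborel) \<partial>lborel \<partial>lborel)"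
    unfolding power2_eq_square by (intro nn_integral_mono mult_mono 1 2) auto
  also have "\<dots> = (\<integral>\<^sup>+x. (\<integral>\<^sup>+t. W (x, t) \<partial>lborel) * (\<integral>\<^sup>+y. \<integral>\<^sup>+t. W (t, y) \<partial>lborel \<partial>lborel) \<partial>lborel)"
    by (intro nn_integral_cong nn_integral_cmult) measurable
  also have "\<dots> = (\<integral>\<^sup>+x. \<integral>\<^sup>+t. W (x, t) \<partial>lborel \<partial>lborel) * (\<integral>\<^sup>+y. \<integral>\<^sup>+t. W (t, y) \<partial>lborel \<partial>lborel)"
    by (intro nn_integral_multc) measurable
  also have "\<dots> = (\<integral>\<^sup>+z. W z \<partial>lborel)\<^sup>2"
    using nn_integral_lborel_pair[of W] by (simp add: power2_eq_square)
  finally show ?thesis .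
qed

text \<open>
  On each horizontal slice the two-dimensional estimate and Cauchy-Schwarz give a product of the slice
  masses of \<open>f\<^sup>2\<close> and \<open>g\<^sup>2\<close>. The mass of \<open>f\<^sup>2\<close> is bounded uniformly over the slices by the estimate along
  vertical lines, so only the mass of \<open>g\<^sup>2\<close> remains to be integrated.
\<close>

lemma fourth_power_integral_le_of_line_bounds:
  fixes f g :: "(real \<times> real) \<times> real \<Rightarrow> ennreal"
  assumes [measurable]: "f \<in> borel_measurable borel" "g \<in> borel_measurable borel"
    and 1: "\<And>x y z. (f ((x, y), z))\<^sup>2 \<le> (\<integral>\<^sup>+t. 2 * f ((t, y), z) * g ((t, y), z) \<partial>lborel)"
    and 2: "\<And>x y z. (f ((x, y), z))\<^sup>2 \<le> (\<integral>\<^sup>+t. 2 * f ((x, t), z) * g ((x, t), z) \<partial>lborel)"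
    and 3: "\<And>w z. (f (w, z))\<^sup>2 \<le> (\<integral>\<^sup>+t. 2 * f (w, t) * g (w, t) \<partial>lborel)"
  shows "(\<integral>\<^sup>+p. ((f p)\<^sup>2)\<^sup>2 \<partial>lborel) \<le> 4 * (\<integral>\<^sup>+p. 2 * f p * g p \<partial>lborel) * (\<integral>\<^sup>+p. (g p)\<^sup>2 \<partial>lborel)"
proof -
  define S where "S = (\<integral>\<^sup>+p. 2 * f p * g p \<partial>lborel)"
  have slice: "(\<integral>\<^sup>+w. ((f (w, z))\<^sup>2)\<^sup>2 \<partial>lborel) \<le> 4 * S * (\<integral>\<^sup>+w. (g (w, z))\<^sup>2 \<partial>lborel)" for z
  proof -
    have "(\<integral>\<^sup>+w. ((f (w, z))\<^sup>2)\<^sup>2 \<partial>lborel) \<le> (\<integral>\<^sup>+w. 2 * f (w, z) * g (w, z) \<partial>lborel)\<^sup>2"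
      by (rule square_integral_le_of_line_bounds) (use 1 2 in measurable)
    also have "(\<integral>\<^sup>+w. 2 * f (w, z) * g (w, z) \<partial>lborel) = 2 * (\<integral>\<^sup>+w. f (w, z) * g (w, z) \<partial>lborel)"
      unfolding mult.assoc by (rule nn_integral_cmult) measurable
    also have "\<dots>\<^sup>2 = 4 * (\<integral>\<^sup>+w. f (w, z) * g (w, z) \<partial>lborel)\<^sup>2"
      by (simp add: power_mult_distrib)
    also have "\<dots> \<le> 4 * ((\<integral>\<^sup>+w. (f (w, z))\<^sup>2 \<partial>lborel) * (\<integral>\<^sup>+w. (g (w, z))\<^sup>2 \<partial>lborel))"
      by (intro mult_left_mono Cauchy_Schwarz_nn_integral) simp_all
    also have "(\<integral>\<^sup>+w. (f (w, z))\<^sup>2 \<partial>lborel) \<le> (\<integral>\<^sup>+w. \<integral>\<^sup>+t. 2 * f (w, t) * g (w, t) \<partial>lborel \<partial>lborel)"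
      by (intro nn_integral_mono 3)
    also have "\<dots> = S" unfolding S_def by (rule nn_integral_lborel_pair(1)[symmetric]) measurable
    finally show ?thesis by (simp add: mult.assoc mult_left_mono mult_right_mono)
  qed
  have "(\<integral>\<^sup>+p. ((f p)\<^sup>2)\<^sup>2 \<partial>lborel) = (\<integral>\<^sup>+z. \<integral>\<^sup>+w. ((f (w, z))\<^sup>2)\<^sup>2 \<partial>lborel \<partial>lborel)"
    by (rule nn_integral_lborel_pair(2)) measurable
  also have "\<dots> \<le> (\<integral>\<^sup>+z. 4 * S * (\<integral>\<^sup>+w. (g (w, z))\<^sup>2 \<partial>lborel) \<partial>lborel)"
    by (intro nn_integral_mono slice)
  also have "\<dots> = 4 * S * (\<integral>\<^sup>+z. \<integral>\<^sup>+w. (g (w, z))\<^sup>2 \<partial>lborel \<partial>lborel)"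
    by (rule nn_integral_cmult) measurable
  also have "(\<integral>\<^sup>+z. \<integral>\<^sup>+w. (g (w, z))\<^sup>2 \<partial>lborel \<partial>lborel) = (\<integral>\<^sup>+p. (g p)\<^sup>2 \<partial>lborel)"
    by (rule nn_integral_lborel_pair(2)[symmetric]) measurable
  finally show ?thesis by (simp add: S_def)
qed

lemma prod_Basis_cart: "(\<Prod>b\<in>Basis. v \<bullet> b) = (\<Prod>k\<in>UNIV. v $ k)" for v :: "real ^ 'n"
proof -
  have basis: "Basis = range (\<lambda>k. axis k 1 :: real ^ 'n)" by (auto simp: Basis_vec_def)
  have "inj (\<lambda>k. axis k 1 :: real ^ 'n)" by (auto simp: inj_def axis_eq_axis)
  then show ?thesis unfolding basis by (simp add: prod.reindex inner_axis)
qed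

lemma emeasure_lborel_Times:
  fixes A :: "'a::euclidean_space set" and B :: "'b::euclidean_space set"
  assumes "A \<in> sets borel" "B \<in> sets borel"
  shows "emeasure lborel (A \<times> B) = emeasure lborel A * emeasure lborel B"
proof -
  have "emeasure (lborel \<Otimes>\<^sub>M lborel) (A \<times> B) = emeasure lborel A * emeasure lborel B"
    using assms by (intro lborel.emeasure_pair_measure_Times) auto
  then show ?thesis by (simp add: lborel_prod)
qed

text \<open>
  Tonelli's theorem is stated for product types; these maps carry it to vectors with two and with
  three components.
\<close>

lemma lborel_real_2:
  fixes i j :: "'n::finite"
  assumes ij: "i \<noteq> j" and univ: "(UNIV :: 'n set) = {i, j}"
  shows "(lborel :: (real ^ 'n) measure) = distr lborel borel (\<lambda>w. fst w *\<^sub>R axis i 1 + snd w *\<^sub>R axis j 1)"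
    (is "_ = distr _ _ ?T")
proof (rule lborel_eqI)
  fix l u :: "real ^ 'n" assume lu: "\<And>b. b \<in> Basis \<Longrightarrow> l \<bullet> b \<le> u \<bullet> b"
  then have le: "l $ k \<le> u $ k" for k
    using lu[of "axis k 1"] by (simp add: cart_eq_inner_axis axis_in_Basis_iff)

  have all: "(\<forall>k. P k) \<longleftrightarrow> P i \<and> P j" for P using univ by (metis UNIV_I insertE singletonD)
  have "?T \<in> borel_measurable lborel" by (simp add: borel_measurable_continuous_onI continuous_intros)
  then have "emeasure (distr lborel borel ?T) (box l u) = emeasure lborel (?T -` box l u)"
    by (subst emeasure_distr) auto
  also have "?T -` box l u = {l $ i <..< u $ i} \<times> {l $ j <..< u $ j}"
    using ij by (auto simp: mem_box_cart all axis_def)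
  also have "emeasure lborel \<dots> = (\<Prod>b\<in>Basis. (u - l) \<bullet> b)"
    using le ij by (simp add: emeasure_lborel_Times prod_Basis_cart univ ennreal_mult)
  finally show "emeasure (distr lborel borel ?T) (box l u) = (\<Prod>b\<in>Basis. (u - l) \<bullet> b)" .
qed simp

lemma lborel_real_3:
  fixes i j k :: "'n::finite"
  assumes ijk: "i \<noteq> j" "i \<noteq> k" "j \<noteq> k" and univ: "(UNIV :: 'n set) = {i, j, k}"
  shows "(lborel :: (real ^ 'n) measure) = distr lborel borel
    (\<lambda>w. fst (fst w) *\<^sub>R axis i 1 + snd (fst w) *\<^sub>R axis j 1 + snd w *\<^sub>R axis k 1)"
    (is "_ = distr _ _ ?T")
proof (rule lborel_eqI)
  fix l u :: "real ^ 'n" assume lu: "\<And>b. b \<in> Basis \<Longrightarrow> l \<bullet> b \<le> u \<bullet> b"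
  then have le: "l $ k \<le> u $ k" for k
    using lu[of "axis k 1"] by (simp add: cart_eq_inner_axis axis_in_Basis_iff)

  have all: "(\<forall>k. P k) \<longleftrightarrow> P i \<and> P j \<and> P k" for P using univ by (metis UNIV_I insertE singletonD)
  have "?T \<in> borel_measurable lborel" by (simp add: borel_measurable_continuous_onI continuous_intros)
  then have "emeasure (distr lborel borel ?T) (box l u) = emeasure lborel (?T -` box l u)"
    by (subst emeasure_distr) auto
  also have "?T -` box l u = ({l $ i <..< u $ i} \<times> {l $ j <..< u $ j}) \<times> {l $ k <..< u $ k}"
    using ijk by (auto simp: mem_box_cart all axis_def)
  also have "emeasure lborel \<dots> = (\<Prod>b\<in>Basis. (u - l) \<bullet> b)"
  proof -
    have "{l $ i <..< u $ i} \<times> {l $ j <..< u $ j} \<in> sets borel" by (intro borel_open open_Times) auto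
    then show ?thesis
      using le ijk by (simp add: emeasure_lborel_Times prod_Basis_cart univ ennreal_mult mult.assoc)
  qed
  finally show "emeasure (distr lborel borel ?T) (box l u) = (\<Prod>b\<in>Basis. (u - l) \<bullet> b)" .
qed simp

text \<open>
  Integrate \<open>(f\<^sup>2)' = 2 f f'\<close> from a point outside the support.
\<close>

lemma square_le_integral_of_derivative:
  fixes f f' :: "real \<Rightarrow> real"
  assumes f: "\<And>t. (f has_real_derivative f' t) (at t)" and f': "continuous_on UNIV f'"
    and supp: "\<And>t. \<bar>t\<bar> > R \<Longrightarrow> f t = 0"
  shows "ennreal ((f x)\<^sup>2) \<le> (\<integral>\<^sup>+t. ennreal (2 * \<bar>f t\<bar> * \<bar>f' t\<bar>) \<partial>lborel)"
proof -
  define a where "a = min x (- \<bar>R\<bar> - 1)"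
  have "\<bar>a\<bar> > R" by (auto simp: a_def)
  then have a: "a \<le> x" "f a = 0" using supp by (auto simp: a_def)
  have cont: "continuous_on UNIV f" using f by (auto intro!: continuous_at_imp_continuous_on DERIV_isCont)
  have D: "((\<lambda>t. (f t)\<^sup>2) has_real_derivative 2 * f t * f' t) (at t)" for t
    using f[of t] by (auto intro!: derivative_eq_intros)
  have c: "continuous_on UNIV (\<lambda>t. 2 * f t * f' t)" by (intro continuous_intros cont f')
  have I: "integrable lborel (\<lambda>t. 2 * f t * f' t * indicator {a..x} t)"
    "(\<integral>t. 2 * f t * f' t * indicator {a..x} t \<partial>lborel) = (f x)\<^sup>2 - (f a)\<^sup>2"
    using has_bochner_integral_FTC_Icc_real[OF a(1), of "\<lambda>t. (f t)\<^sup>2" "\<lambda>t. 2 * f t * f' t"] D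
      c[unfolded continuous_on_eq_continuous_at[OF open_UNIV]]
    by (auto simp: has_bochner_integral_iff)
  have "(f x)\<^sup>2 \<le> (\<integral>t. norm (2 * f t * f' t * indicator {a..x} t) \<partial>lborel)"
    using integral_norm_bound[of lborel "\<lambda>t. 2 * f t * f' t * indicator {a..x} t"] I a(2) by simp
  then have "ennreal ((f x)\<^sup>2) \<le> ennreal (\<integral>t. norm (2 * f t * f' t * indicator {a..x} t) \<partial>lborel)"
    by (rule ennreal_leI)
  also have "\<dots> = (\<integral>\<^sup>+t. ennreal (norm (2 * f t * f' t * indicator {a..x} t)) \<partial>lborel)"
    using I(1) by (intro nn_integral_eq_integral[symmetric]) auto
  also have "\<dots> \<le> (\<integral>\<^sup>+t. ennreal (2 * \<bar>f t\<bar> * \<bar>f' t\<bar>) \<partial>lborel)"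
    by (intro nn_integral_mono ennreal_leI) (auto simp: abs_mult indicator_def)
  finally show ?thesis .
qed

lemma square_le_line_integral:
  fixes \<phi> :: "real ^ 'n \<Rightarrow> real"
  assumes \<phi>: "\<phi> \<in> test_functions \<Omega>"
  shows "(ennreal \<bar>\<phi> (y + s *\<^sub>R axis i 1)\<bar>)\<^sup>2 \<le> (\<integral>\<^sup>+t. 2 * ennreal \<bar>\<phi> (y + t *\<^sub>R axis i 1)\<bar>
      * ennreal (norm (\<chi> j. partial_deriv j \<phi> (y + t *\<^sub>R axis i 1))) \<partial>lborel)"
proof -
  let ?e = "axis i 1 :: real ^ 'n"
  obtain K where K: "compact K" "K \<subseteq> \<Omega>" "\<And>x. x \<notin> K \<Longrightarrow> \<phi> x = 0"
    using test_functions_supp[OF \<phi>] by blast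
  obtain R where R: "\<And>x. x \<in> K \<Longrightarrow> norm x \<le> R"
    using compact_imp_bounded[OF K(1)] by (auto simp: bounded_iff)
  have "ennreal ((\<phi> (y + s *\<^sub>R ?e))\<^sup>2) \<le> (\<integral>\<^sup>+t. ennreal (2 * \<bar>\<phi> (y + t *\<^sub>R ?e)\<bar>
      * \<bar>partial_deriv i \<phi> (y + t *\<^sub>R ?e)\<bar>) \<partial>lborel)"
  proof (rule square_le_integral_of_derivative)
    fix t
    have "(\<phi> has_derivative frechet_derivative \<phi> (at (y + t *\<^sub>R ?e))) (at (y + t *\<^sub>R ?e))"
      using test_functions_C_k[OF \<phi>, of "Suc 0"] by (simp add: frechet_derivative_works[symmetric])
    moreover have "((\<lambda>t. y + t *\<^sub>R ?e) has_derivative (\<lambda>s. s *\<^sub>R ?e)) (at t)"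
      by (auto intro!: derivative_eq_intros)
    ultimately have "((\<lambda>t. \<phi> (y + t *\<^sub>R ?e)) has_derivative
        (\<lambda>s. frechet_derivative \<phi> (at (y + t *\<^sub>R ?e)) (s *\<^sub>R ?e))) (at t)"
      by (rule has_derivative_compose[rotated])
    moreover have "frechet_derivative \<phi> (at (y + t *\<^sub>R ?e)) (s *\<^sub>R ?e) = s * partial_deriv i \<phi> (y + t *\<^sub>R ?e)" for s
      using test_functions_C_k[OF \<phi>, of "Suc 0"]
      by (simp add: partial_deriv_def linear_frechet_derivative linear_cmul)
    ultimately show "((\<lambda>t. \<phi> (y + t *\<^sub>R ?e)) has_real_derivative partial_deriv i \<phi> (y + t *\<^sub>R ?e)) (at t)"
      by (simp add: has_field_derivative_def mult.commute[of _ "partial_deriv _ _ _"])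
  next
    show "continuous_on UNIV (\<lambda>t. partial_deriv i \<phi> (y + t *\<^sub>R ?e))"
      by (rule continuous_on_compose2[OF test_functions_continuous[OF test_functions_partial_deriv[OF \<phi>]]])
         (auto intro!: continuous_intros)
  next
    fix t assume t: "\<bar>t\<bar> > R + norm y"
    have "\<bar>t\<bar> = norm (t *\<^sub>R ?e)" by simp
    also have "\<dots> \<le> norm (y + t *\<^sub>R ?e) + norm y"
      using norm_triangle_ineq4[of "y + t *\<^sub>R ?e" y] by simp
    finally show "\<phi> (y + t *\<^sub>R ?e) = 0" using t R[of "y + t *\<^sub>R ?e"] K(3) by fastforce
  qed
  also have "\<dots> \<le> (\<integral>\<^sup>+t. ennreal (2 * \<bar>\<phi> (y + t *\<^sub>R ?e)\<bar>
      * norm (\<chi> j. partial_deriv j \<phi> (y + t *\<^sub>R ?e))) \<partial>lborel)"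
  proof (intro nn_integral_mono ennreal_leI mult_left_mono)
    fix t
    show "\<bar>partial_deriv i \<phi> (y + t *\<^sub>R ?e)\<bar> \<le> norm (\<chi> j. partial_deriv j \<phi> (y + t *\<^sub>R ?e))"
      using component_le_norm_cart[of "\<chi> j. partial_deriv j \<phi> (y + t *\<^sub>R ?e)" i] by simp
  qed simp
  finally show ?thesis by (simp add: ennreal_power ennreal_mult)
qed

text \<open>
  The function \<open>\<phi>\<^sup>2\<close> is dominated on every line in a coordinate direction by the integral of
  \<open>2 |\<phi>| |\<nabla>\<phi>|\<close> over that line, and the slicing estimates apply. A common bound \<open>N\<close> for the norms of \<open>\<phi>\<close>
  and \<open>\<nabla>\<phi>\<close> covers both dimensions in a form that is stable under approximation.
\<close>

theorem Ladyzhenskaya_inequality: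
  fixes \<phi> :: "real ^ 'n \<Rightarrow> real"
  assumes dim: "CARD('n) = 2 \<or> CARD('n) = 3" and \<phi>: "\<phi> \<in> test_functions \<Omega>"
    and N: "(\<integral>\<^sup>+x. ennreal ((\<phi> x)\<^sup>2) \<partial>lborel) \<le> ennreal (N\<^sup>2)"
      "(\<integral>\<^sup>+x. ennreal ((norm (\<chi> j. partial_deriv j \<phi> x))\<^sup>2) \<partial>lborel) \<le> ennreal (N\<^sup>2)"
  shows "(\<integral>\<^sup>+x. ennreal ((\<phi> x) ^ 4) \<partial>lborel) \<le> ennreal (8 * N ^ 4)"
proof -
  define f where "f x = ennreal \<bar>\<phi> x\<bar>" for x
  define g where "g x = ennreal (norm (\<chi> j. partial_deriv j \<phi> x))" for x
  have [measurable]: "\<phi> \<in> borel_measurable borel" "partial_deriv j \<phi> \<in> borel_measurable borel" for j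
    by (auto intro: test_functions_measurable test_functions_partial_deriv \<phi>)
  have f[measurable]: "f \<in> borel_measurable borel" unfolding f_def by measurable
  have g[measurable]: "g \<in> borel_measurable borel"     unfolding g_def norm_vec_def L2_set_def vec_lambda_beta by measurable
  have f2: "(f x)\<^sup>2 = ennreal ((\<phi> x)\<^sup>2)" "((f x)\<^sup>2)\<^sup>2 = ennreal ((\<phi> x) ^ 4)" for x
    by (simp_all add: f_def ennreal_power power_mult[symmetric] power_even_abs)
  have g2: "(g x)\<^sup>2 = ennreal ((norm (\<chi> j. partial_deriv j \<phi> x))\<^sup>2)" for x
    by (simp add: g_def ennreal_power)
  have line: "(f (y + s *\<^sub>R axis i 1))\<^sup>2 \<le> (\<integral>\<^sup>+t. 2 * f (y + t *\<^sub>R axis i 1) * g (y + t *\<^sub>R axis i 1) \<partial>lborel)" for y s i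
    unfolding f_def g_def by (rule square_le_line_integral[OF \<phi>])
  have S: "(\<integral>\<^sup>+x. 2 * f x * g x \<partial>lborel) \<le> ennreal (2 * N\<^sup>2)"
  proof -
    have "2 * f x * g x \<le> ennreal ((\<phi> x)\<^sup>2) + ennreal ((norm (\<chi> j. partial_deriv j \<phi> x))\<^sup>2)" for x
    proof -
      have "2 * f x * g x = ennreal (2 * \<bar>\<phi> x\<bar> * norm (\<chi> j. partial_deriv j \<phi> x))"
        by (simp add: f_def g_def ennreal_mult)
      also have "\<dots> \<le> ennreal ((\<phi> x)\<^sup>2 + (norm (\<chi> j. partial_deriv j \<phi> x))\<^sup>2)"
        using sum_squares_bound[of "\<bar>\<phi> x\<bar>" "norm (\<chi> j. partial_deriv j \<phi> x)"] by (intro ennreal_leI) simp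
      finally show ?thesis by (simp add: ennreal_plus)
    qed
    then have "(\<integral>\<^sup>+x. 2 * f x * g x \<partial>lborel) \<le> (\<integral>\<^sup>+x. (f x)\<^sup>2 + (g x)\<^sup>2 \<partial>lborel)"
      unfolding f2 g2 by (rule nn_integral_mono)
    also have "\<dots> = (\<integral>\<^sup>+x. (f x)\<^sup>2 \<partial>lborel) + (\<integral>\<^sup>+x. (g x)\<^sup>2 \<partial>lborel)"
      by (rule nn_integral_add) measurable
    also have "\<dots> \<le> ennreal (N\<^sup>2) + ennreal (N\<^sup>2)" unfolding f2 g2 by (intro add_mono N)
    finally show ?thesis by (simp add: ennreal_plus[symmetric] del: ennreal_plus)
  qed
  have "(\<integral>\<^sup>+x. ((f x)\<^sup>2)\<^sup>2 \<partial>lborel) \<le> ennreal (8 * N ^ 4)"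
    using dim
  proof
    assume "CARD('n) = 2"
    then obtain i j :: 'n where ij: "i \<noteq> j" "(UNIV :: 'n set) = {i, j}" by (auto simp: card_2_iff)
    define T where "T w = fst w *\<^sub>R axis i 1 + snd w *\<^sub>R (axis j 1 :: real ^ 'n)" for w :: "real \<times> real"
    have T[measurable]: "T \<in> borel_measurable borel"
      unfolding T_def by (intro borel_measurable_continuous_onI continuous_intros)
    have lb: "(lborel :: (real ^ 'n) measure) = distr lborel borel T"
      unfolding T_def by (rule lborel_real_2[OF ij])
    have "(\<integral>\<^sup>+x. ((f x)\<^sup>2)\<^sup>2 \<partial>lborel) = (\<integral>\<^sup>+w. ((f (T w))\<^sup>2)\<^sup>2 \<partial>lborel)"
      by (subst lb, subst nn_integral_distr) measurable
    also have "\<dots> \<le> (\<integral>\<^sup>+w. 2 * f (T w) * g (T w) \<partial>lborel)\<^sup>2"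
    proof (rule square_integral_le_of_line_bounds)
      show "(f (T (x, y)))\<^sup>2 \<le> (\<integral>\<^sup>+t. 2 * f (T (t, y)) * g (T (t, y)) \<partial>lborel)" for x y
        using line[of "y *\<^sub>R axis j 1" x i] by (simp add: T_def add.commute)
      show "(f (T (x, y)))\<^sup>2 \<le> (\<integral>\<^sup>+t. 2 * f (T (x, t)) * g (T (x, t)) \<partial>lborel)" for x y
        using line[of "x *\<^sub>R axis i 1" y j] by (simp add: T_def)
    qed measurable
    also have "(\<integral>\<^sup>+w. 2 * f (T w) * g (T w) \<partial>lborel) = (\<integral>\<^sup>+x. 2 * f x * g x \<partial>lborel)"
      by (subst lb, subst nn_integral_distr) measurable
    also have "\<dots>\<^sup>2 \<le> (ennreal (2 * N\<^sup>2))\<^sup>2" by (intro power_mono S) simp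
    also have "\<dots> \<le> ennreal (8 * N ^ 4)"
      by (simp add: ennreal_power power_mult_distrib power_mult[symmetric] ennreal_leI)
    finally show ?thesis .
  next
    assume "CARD('n) = 3"
    then obtain i j k :: 'n where ijk: "i \<noteq> j" "i \<noteq> k" "j \<noteq> k" "(UNIV :: 'n set) = {i, j, k}"
      by (auto simp: card_3_iff)
    define T where "T w = fst (fst w) *\<^sub>R axis i 1 + snd (fst w) *\<^sub>R axis j 1 + snd w *\<^sub>R (axis k 1 :: real ^ 'n)"
      for w :: "(real \<times> real) \<times> real"
    have T[measurable]: "T \<in> borel_measurable borel"
      unfolding T_def by (intro borel_measurable_continuous_onI continuous_intros)
    have lb: "(lborel :: (real ^ 'n) measure) = distr lborel borel T"
      unfolding T_def by (rule lborel_real_3[OF ijk])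
    have "(\<integral>\<^sup>+x. ((f x)\<^sup>2)\<^sup>2 \<partial>lborel) = (\<integral>\<^sup>+w. ((f (T w))\<^sup>2)\<^sup>2 \<partial>lborel)"
      by (subst lb, subst nn_integral_distr) measurable
    also have "\<dots> \<le> 4 * (\<integral>\<^sup>+w. 2 * f (T w) * g (T w) \<partial>lborel) * (\<integral>\<^sup>+w. (g (T w))\<^sup>2 \<partial>lborel)"
    proof (rule fourth_power_integral_le_of_line_bounds)
      show "(f (T ((x, y), z)))\<^sup>2 \<le> (\<integral>\<^sup>+t. 2 * f (T ((t, y), z)) * g (T ((t, y), z)) \<partial>lborel)" for x y z
        using line[of "y *\<^sub>R axis j 1 + z *\<^sub>R axis k 1" x i] by (simp add: T_def algebra_simps)
      show "(f (T ((x, y), z)))\<^sup>2 \<le> (\<integral>\<^sup>+t. 2 * f (T ((x, t), z)) * g (T ((x, t), z)) \<partial>lborel)" for x y z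
        using line[of "x *\<^sub>R axis i 1 + z *\<^sub>R axis k 1" y j] by (simp add: T_def algebra_simps)
      show "(f (T (w, z)))\<^sup>2 \<le> (\<integral>\<^sup>+t. 2 * f (T (w, t)) * g (T (w, t)) \<partial>lborel)" for w z
        using line[of "fst w *\<^sub>R axis i 1 + snd w *\<^sub>R axis j 1" z k] by (simp add: T_def)
    qed measurable
    also have "(\<integral>\<^sup>+w. 2 * f (T w) * g (T w) \<partial>lborel) = (\<integral>\<^sup>+x. 2 * f x * g x \<partial>lborel)"
      by (subst lb, subst nn_integral_distr) measurable
    also have "(\<integral>\<^sup>+w. (g (T w))\<^sup>2 \<partial>lborel) = (\<integral>\<^sup>+x. (g x)\<^sup>2 \<partial>lborel)"
      by (subst lb, subst nn_integral_distr) measurable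
    also have "4 * (\<integral>\<^sup>+x. 2 * f x * g x \<partial>lborel) * (\<integral>\<^sup>+x. (g x)\<^sup>2 \<partial>lborel) \<le> 4 * ennreal (2 * N\<^sup>2) * ennreal (N\<^sup>2)"
      unfolding g2 by (intro mult_mono S N(2)) auto
    also have "\<dots> = ennreal (4 * (2 * N\<^sup>2) * N\<^sup>2)" by (simp add: ennreal_mult)
    also have "4 * (2 * N\<^sup>2) * N\<^sup>2 = 8 * N ^ 4" by (simp add: power2_eq_square power4_eq_xxxx)
    finally show ?thesis .
  qed
  then show ?thesis by (simp only: f2(2))
qed

section \<open>The convection form\<close>

context bounded_open_set
begin

lemma nn_integral_lebesgue_on_eq_lborel:
  fixes h :: "real ^ 'n \<Rightarrow> real"
  assumes "h \<in> borel_measurable borel" "\<And>x. x \<notin> \<Omega> \<Longrightarrow> h x = 0"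
  shows "(\<integral>\<^sup>+x. ennreal (h x) \<partial>lebesgue_on \<Omega>) = (\<integral>\<^sup>+x. ennreal (h x) \<partial>lborel)"
proof -
  have "(\<integral>\<^sup>+x. ennreal (h x) \<partial>lebesgue_on \<Omega>) = (\<integral>\<^sup>+x. ennreal (h x) * indicator \<Omega> x \<partial>lebesgue)"
    using open_set by (intro nn_integral_restrict_space) auto
  also have "\<dots> = (\<integral>\<^sup>+x. ennreal (h x) \<partial>lebesgue)"
    using assms(2) by (intro nn_integral_cong) (auto simp: indicator_def)
  finally show ?thesis by (simp add: nn_integral_completion)
qed

lemma L4_test:
  assumes dim: "CARD('n) = 2 \<or> CARD('n) = 3" and \<phi>: "\<phi> \<in> test_functions \<Omega>"
    and N: "L2_norm \<Omega> \<phi> \<le> N" "L2_norm \<Omega> (weak_grad \<Omega> \<phi>) \<le> N"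
  shows "(\<integral>\<^sup>+x. ennreal ((\<phi> x) ^ 4) \<partial>lebesgue_on \<Omega>) \<le> ennreal (8 * N ^ 4)"
proof -
  have [measurable]: "\<phi> \<in> borel_measurable borel" "partial_deriv j \<phi> \<in> borel_measurable borel" for j
    by (auto intro: test_functions_measurable test_functions_partial_deriv \<phi>)
  have zero: "x \<notin> \<Omega> \<Longrightarrow> \<phi> x = 0" "x \<notin> \<Omega> \<Longrightarrow> partial_deriv j \<phi> x = 0" for x j
    by (auto intro: test_functions_zero test_functions_partial_deriv \<phi>)
  let ?D = "\<lambda>x. \<chi> j. partial_deriv j \<phi> x"
  have [measurable]: "(\<lambda>x. norm (?D x)) \<in> borel_measurable borel"
    unfolding norm_vec_def L2_set_def vec_lambda_beta by measurable
  have zero': "x \<notin> \<Omega> \<Longrightarrow> ?D x = 0" for x using zero(2) by (simp add: vec_eq_iff)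
  have "(\<integral>\<^sup>+x. ennreal ((\<phi> x)\<^sup>2) \<partial>lborel) = (\<integral>\<^sup>+x. ennreal ((\<phi> x)\<^sup>2) \<partial>lebesgue_on \<Omega>)"
    by (rule nn_integral_lebesgue_on_eq_lborel[symmetric]) (simp_all add: zero)
  also have "\<dots> = ennreal ((L2_norm \<Omega> \<phi>)\<^sup>2)" using L2_norm_sq_ennreal[OF test_L2[OF \<phi>]] by simp
  also have "\<dots> \<le> ennreal (N\<^sup>2)" using N(1) by (intro ennreal_leI power_mono) auto
  finally have 1: "(\<integral>\<^sup>+x. ennreal ((\<phi> x)\<^sup>2) \<partial>lborel) \<le> ennreal (N\<^sup>2)" .
  have "(\<integral>\<^sup>+x. ennreal ((norm (?D x))\<^sup>2) \<partial>lborel) = (\<integral>\<^sup>+x. ennreal ((norm (?D x))\<^sup>2) \<partial>lebesgue_on \<Omega>)"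
    by (rule nn_integral_lebesgue_on_eq_lborel[symmetric]) (simp_all add: zero')
  also have "\<dots> = ennreal ((L2_norm \<Omega> ?D)\<^sup>2)" by (rule L2_norm_sq_ennreal[OF test_grad_L2[OF \<phi>]])
  also have "L2_norm \<Omega> ?D = L2_norm \<Omega> (weak_grad \<Omega> \<phi>)"
    using weak_grad_test[OF \<phi>] weak_grad_L2[OF test_H1[OF \<phi>]] test_grad_L2[OF \<phi>]
    by (intro L2_norm_cong_AE) (auto elim: eventually_mono)
  also have "ennreal (\<dots>\<^sup>2) \<le> ennreal (N\<^sup>2)" using N(2) by (intro ennreal_leI power_mono) auto
  finally have 2: "(\<integral>\<^sup>+x. ennreal ((norm (?D x))\<^sup>2) \<partial>lborel) \<le> ennreal (N\<^sup>2)" .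
  have "(\<integral>\<^sup>+x. ennreal ((\<phi> x) ^ 4) \<partial>lebesgue_on \<Omega>) = (\<integral>\<^sup>+x. ennreal ((\<phi> x) ^ 4) \<partial>lborel)"
    by (rule nn_integral_lebesgue_on_eq_lborel) (simp_all add: zero)
  then show ?thesis using Ladyzhenskaya_inequality[OF dim \<phi> 1 2] by simp
qed

text \<open>
  Approximating test functions are bounded in \<open>L\<^sup>4\<close> by Ladyzhenskaya's inequality, and Fatou's lemma
  carries the bound to the limit.
\<close>

theorem H1_0_L4:
  assumes dim: "CARD('n) = 2 \<or> CARD('n) = 3" and u: "u \<in> H1_0 \<Omega>"
  shows "integrable (lebesgue_on \<Omega>) (\<lambda>x. (u x) ^ 4)"
proof -
  let ?M = "lebesgue_on \<Omega>"
  have "\<exists>\<phi>. \<phi> \<in> test_functions \<Omega> \<and> L2_norm \<Omega> (\<lambda>x. u x - \<phi> x) < (1/2)^n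
      \<and> L2_norm \<Omega> (\<lambda>x. weak_grad \<Omega> u x - weak_grad \<Omega> \<phi> x) < (1/2)^n" for n :: nat
    by (rule H1_0_approx[OF u, of "(1/2)^n"]) auto
  then have "\<exists>\<phi>. \<forall>n::nat. \<phi> n \<in> test_functions \<Omega> \<and> L2_norm \<Omega> (\<lambda>x. u x - \<phi> n x) < (1/2)^n
      \<and> L2_norm \<Omega> (\<lambda>x. weak_grad \<Omega> u x - weak_grad \<Omega> (\<phi> n) x) < (1/2)^n"
    by (intro choice allI)
  then obtain \<phi> where \<phi>: "\<And>n. \<phi> n \<in> test_functions \<Omega>"
    "\<And>n. L2_norm \<Omega> (\<lambda>x. u x - \<phi> n x) < (1/2)^n"
    "\<And>n. L2_norm \<Omega> (\<lambda>x. weak_grad \<Omega> u x - weak_grad \<Omega> (\<phi> n) x) < (1/2)^n" by blast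
  define N where "N = max (L2_norm \<Omega> u) (L2_norm \<Omega> (weak_grad \<Omega> u)) + 1"
  have N: "(\<integral>\<^sup>+x. ennreal ((\<phi> n x) ^ 4) \<partial>?M) \<le> ennreal (8 * N ^ 4)" for n
  proof (rule L4_test[OF dim \<phi>(1)])
    have le1: "(1/2::real)^n \<le> 1" by (simp add: power_le_one)
    have "L2_norm \<Omega> (\<phi> n) \<le> L2_norm \<Omega> (\<lambda>x. \<phi> n x - u x) + L2_norm \<Omega> u"
      using L2_triangle[OF L2_diff[OF test_L2[OF \<phi>(1)[of n]] H1_0_L2[OF u]] H1_0_L2[OF u]] by simp
    then show "L2_norm \<Omega> (\<phi> n) \<le> N"
      using \<phi>(2)[of n] le1 L2_norm_minus_commute[of \<Omega> "\<phi> n" u] by (simp add: N_def)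
    have "L2_norm \<Omega> (weak_grad \<Omega> (\<phi> n)) \<le> L2_norm \<Omega> (\<lambda>x. weak_grad \<Omega> (\<phi> n) x - weak_grad \<Omega> u x) + L2_norm \<Omega> (weak_grad \<Omega> u)"
      using L2_triangle[OF L2_diff[OF weak_grad_L2[OF test_H1[OF \<phi>(1)[of n]]] weak_grad_L2[OF H1_0_H1[OF u]]] weak_grad_L2[OF H1_0_H1[OF u]]] by simp
    then show "L2_norm \<Omega> (weak_grad \<Omega> (\<phi> n)) \<le> N"
      using \<phi>(3)[of n] le1 L2_norm_minus_commute[of \<Omega> "weak_grad \<Omega> (\<phi> n)" "weak_grad \<Omega> u"] by (simp add: N_def)
  qed
  \<comment> \<open>interleaving with the constant sequence \<open>u\<close> identifies the almost everywhere limit\<close>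
  define h where "h n = (if even n then \<phi> n else u)" for n
  have "AE x in ?M. convergent (\<lambda>n. h n x)"
  proof (rule L2_fast_Cauchy_converges_AE[OF bounded open_set])
    show "h n \<in> L2 \<Omega>" for n by (simp add: h_def test_L2 \<phi>(1) H1_0_L2[OF u])
    show "L2_norm \<Omega> (\<lambda>x. h (Suc n) x - h n x) \<le> (1/2)^n" for n
    proof (cases "even n")
      case True
      then show ?thesis using \<phi>(2)[of n] by (simp add: h_def less_imp_le)
    next
      case False
      have "(1/2::real) ^ Suc n \<le> (1/2) ^ n" by simp
      with \<phi>(2)[of "Suc n"] have "L2_norm \<Omega> (\<lambda>x. u x - \<phi> (Suc n) x) \<le> (1/2) ^ n" by linarith
      with False show ?thesis by (simp add: h_def L2_norm_minus_commute[of \<Omega> "\<phi> (Suc n)" u])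
    qed
  qed
  then have lim: "AE x in ?M. (\<lambda>n. \<phi> (2 * n) x) \<longlonglongrightarrow> u x"
  proof eventually_elim
    case (elim x)
    then obtain l where l: "(\<lambda>n. h n x) \<longlonglongrightarrow> l" by (auto simp: convergent_def)
    have "(\<lambda>n. h (2 * n + 1) x) \<longlonglongrightarrow> l"
      using LIMSEQ_subseq_LIMSEQ[OF l, of "\<lambda>n. 2 * n + 1"] by (simp add: strict_mono_def o_def)
    then have "l = u x" by (simp add: h_def LIMSEQ_const_iff)
    moreover have "(\<lambda>n. h (2 * n) x) \<longlonglongrightarrow> l"
      using LIMSEQ_subseq_LIMSEQ[OF l, of "\<lambda>n. 2 * n"] by (simp add: strict_mono_def o_def)
    ultimately show ?case by (simp add: h_def)
  qed
  have [measurable]: "\<phi> n \<in> borel_measurable ?M" "u \<in> borel_measurable ?M" for n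
    by (auto intro: L2_measurable test_L2 \<phi>(1) H1_0_L2 u)
  have "(\<integral>\<^sup>+x. ennreal ((u x) ^ 4) \<partial>?M) = (\<integral>\<^sup>+x. liminf (\<lambda>n. ennreal ((\<phi> (2 * n) x) ^ 4)) \<partial>?M)"
  proof (rule nn_integral_cong_AE)
    show "AE x in ?M. ennreal ((u x) ^ 4) = liminf (\<lambda>n. ennreal ((\<phi> (2 * n) x) ^ 4))"
      using lim
    proof eventually_elim
      case (elim x)
      then have "(\<lambda>n. ennreal ((\<phi> (2 * n) x) ^ 4)) \<longlonglongrightarrow> ennreal ((u x) ^ 4)"
        by (intro tendsto_ennrealI tendsto_intros)
      then show ?case by (metis lim_imp_Liminf sequentially_bot)
    qed
  qed
  also have "\<dots> \<le> liminf (\<lambda>n. \<integral>\<^sup>+x. ennreal ((\<phi> (2 * n) x) ^ 4) \<partial>?M)"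
    by (rule nn_integral_liminf) measurable
  also have "\<dots> \<le> ennreal (8 * N ^ 4)"
    by (rule Liminf_le) (simp_all add: N)
  finally have "(\<integral>\<^sup>+x. ennreal (norm ((u x) ^ 4)) \<partial>?M) < \<infinity>"
    by (simp add: power_even_abs le_less_trans)
  then show ?thesis by (simp add: integrable_iff_bounded)
qed

end

locale bounded_open_set_2_3 = bounded_open_set \<Omega> for \<Omega> :: "(real ^ 'n) set" +
  assumes dim: "CARD('n) = 2 \<or> CARD('n) = 3"
begin

lemma H1_0_mult_L2:
  assumes "u \<in> H1_0 \<Omega>" "v \<in> H1_0 \<Omega>"
  shows "(\<lambda>x. u x * v x) \<in> L2 \<Omega>"
proof (rule L2_bound)
  show "integrable (lebesgue_on \<Omega>) (\<lambda>x. (u x) ^ 4 + (v x) ^ 4)"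
    by (intro Bochner_Integration.integrable_add H1_0_L4[OF dim] assms)
  have "u \<in> borel_measurable (lebesgue_on \<Omega>)" "v \<in> borel_measurable (lebesgue_on \<Omega>)"
    by (auto intro: L2_measurable H1_0_L2 assms)
  then show "(\<lambda>x. u x * v x) \<in> borel_measurable (lebesgue_on \<Omega>)" by simp
  fix x
  have "0 \<le> ((u x)\<^sup>2 - (v x)\<^sup>2)\<^sup>2" "0 \<le> ((u x)\<^sup>2)\<^sup>2" "0 \<le> ((v x)\<^sup>2)\<^sup>2" by simp_all
  then have "(u x)\<^sup>2 * (v x)\<^sup>2 \<le> ((u x)\<^sup>2)\<^sup>2 + ((v x)\<^sup>2)\<^sup>2"
    unfolding power2_diff by linarith
  then show "(norm (u x * v x))\<^sup>2 \<le> (u x) ^ 4 + (v x) ^ 4"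
    by (simp add: power_mult_distrib power_mult[symmetric])
qed

text \<open>
  Products of components lie in \<open>L\<^sup>2\<close>, so the integrand is a sum of products of two \<open>L\<^sup>2\<close> functions. The
  integral of a function that is not integrable is \<open>0\<close> by convention, which is why additivity of the
  form rests on this.
\<close>

lemma convection_integrable:
  assumes "u \<in> X_space \<Omega>" "v \<in> X_space \<Omega>" "w \<in> X_space \<Omega>"
  shows "integrable (lebesgue_on \<Omega>) (\<lambda>x. (vgrad \<Omega> v x *v u x) \<bullet> w x)"
proof -
  have "integrable (lebesgue_on \<Omega>) (\<lambda>x. \<Sum>i\<in>UNIV. \<Sum>j\<in>UNIV. vgrad \<Omega> v x $ i $ j \<bullet> (u x $ j * w x $ i))"
    by (intro Bochner_Integration.integrable_sum L2_integrable_inner vgrad_component_L2 H1_0_mult_L2 X_component assms)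
  then show ?thesis
    by (simp add: inner_vec_def matrix_vector_mult_def sum_distrib_right mult.assoc)
qed

lemma divergence_term_integrable:
  assumes "u \<in> X_space \<Omega>" "v \<in> X_space \<Omega>" "w \<in> X_space \<Omega>"
  shows "integrable (lebesgue_on \<Omega>) (\<lambda>x. (vdiv \<Omega> u x *\<^sub>R v x) \<bullet> w x)"
proof -
  have "integrable (lebesgue_on \<Omega>) (\<lambda>x. vdiv \<Omega> u x \<bullet> (\<Sum>i\<in>UNIV. v x $ i * w x $ i))"
    by (intro L2_integrable_inner vdiv_L2 L2_sum H1_0_mult_L2 X_component assms) auto
  then show ?thesis by (simp add: inner_vec_def sum_distrib_left mult.assoc)
qed

lemma vgrad_diff:
  assumes "u \<in> X_space \<Omega>" "v \<in> X_space \<Omega>"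
  shows "AE x in lebesgue_on \<Omega>. vgrad \<Omega> (\<lambda>x. u x - v x) x = vgrad \<Omega> u x - vgrad \<Omega> v x"
  using vgrad_add[OF assms(1) X_scale[OF assms(2), of "-1"]] vgrad_scale[OF assms(2), of "-1"]
  by eventually_elim simp

lemma vdiv_diff:
  assumes "u \<in> X_space \<Omega>" "v \<in> X_space \<Omega>"
  shows "AE x in lebesgue_on \<Omega>. vdiv \<Omega> (\<lambda>x. u x - v x) x = vdiv \<Omega> u x - vdiv \<Omega> v x"
  using vgrad_diff[OF assms] by eventually_elim (simp add: vdiv_eq sum_subtractf)

lemma c_form_eq:
  assumes "u \<in> X_space \<Omega>" "v \<in> X_space \<Omega>" "w \<in> X_space \<Omega>"
  shows "c_form \<Omega> u v w = (\<integral>x. (vgrad \<Omega> v x *v u x) \<bullet> w x + 1/2 * ((vdiv \<Omega> u x *\<^sub>R v x) \<bullet> w x) \<partial>lebesgue_on \<Omega>)"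
  using convection_integrable[OF assms] divergence_term_integrable[OF assms]
  by (simp add: c_form_def L2_inner_def)

lemma c_form_integrable:
  assumes "u \<in> X_space \<Omega>" "v \<in> X_space \<Omega>" "w \<in> X_space \<Omega>"
  shows "integrable (lebesgue_on \<Omega>) (\<lambda>x. (vgrad \<Omega> v x *v u x) \<bullet> w x + 1/2 * ((vdiv \<Omega> u x *\<^sub>R v x) \<bullet> w x))"
  by (intro Bochner_Integration.integrable_add integrable_mult_right convection_integrable
      divergence_term_integrable assms)

text \<open>
  The three additivity laws differ only in the pointwise identity of their integrands.
\<close>

lemma c_form_diff_eqI:
  assumes X: "u \<in> X_space \<Omega>" "v \<in> X_space \<Omega>" "w \<in> X_space \<Omega>" "u1 \<in> X_space \<Omega>" "v1 \<in> X_space \<Omega>"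
    "w1 \<in> X_space \<Omega>" "u2 \<in> X_space \<Omega>" "v2 \<in> X_space \<Omega>" "w2 \<in> X_space \<Omega>"
    and eq: "AE x in lebesgue_on \<Omega>. (vgrad \<Omega> v x *v u x) \<bullet> w x + 1/2 * ((vdiv \<Omega> u x *\<^sub>R v x) \<bullet> w x)
      = ((vgrad \<Omega> v1 x *v u1 x) \<bullet> w1 x + 1/2 * ((vdiv \<Omega> u1 x *\<^sub>R v1 x) \<bullet> w1 x))
      - ((vgrad \<Omega> v2 x *v u2 x) \<bullet> w2 x + 1/2 * ((vdiv \<Omega> u2 x *\<^sub>R v2 x) \<bullet> w2 x))"
  shows "c_form \<Omega> u v w = c_form \<Omega> u1 v1 w1 - c_form \<Omega> u2 v2 w2"
proof -
  have "c_form \<Omega> u v w = (\<integral>x. ((vgrad \<Omega> v1 x *v u1 x) \<bullet> w1 x + 1/2 * ((vdiv \<Omega> u1 x *\<^sub>R v1 x) \<bullet> w1 x))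
      - ((vgrad \<Omega> v2 x *v u2 x) \<bullet> w2 x + 1/2 * ((vdiv \<Omega> u2 x *\<^sub>R v2 x) \<bullet> w2 x)) \<partial>lebesgue_on \<Omega>)"
    unfolding c_form_eq[OF X(1-3)]
    by (intro integral_cong_AE eq borel_measurable_diff borel_measurable_integrable c_form_integrable X)
  also have "\<dots> = c_form \<Omega> u1 v1 w1 - c_form \<Omega> u2 v2 w2"
    unfolding c_form_eq[OF X(4-6)] c_form_eq[OF X(7-9)]
    by (intro Bochner_Integration.integral_diff c_form_integrable X)
  finally show ?thesis .
qed

lemma c_diff_1:
  assumes "u1 \<in> X_space \<Omega>" "u2 \<in> X_space \<Omega>" "v \<in> X_space \<Omega>" "w \<in> X_space \<Omega>"
  shows "c_form \<Omega> (\<lambda>x. u1 x - u2 x) v w = c_form \<Omega> u1 v w - c_form \<Omega> u2 v w"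
proof (rule c_form_diff_eqI)
  show "AE x in lebesgue_on \<Omega>. (vgrad \<Omega> v x *v (u1 x - u2 x)) \<bullet> w x + 1/2 * ((vdiv \<Omega> (\<lambda>x. u1 x - u2 x) x *\<^sub>R v x) \<bullet> w x)
      = ((vgrad \<Omega> v x *v u1 x) \<bullet> w x + 1/2 * ((vdiv \<Omega> u1 x *\<^sub>R v x) \<bullet> w x))
      - ((vgrad \<Omega> v x *v u2 x) \<bullet> w x + 1/2 * ((vdiv \<Omega> u2 x *\<^sub>R v x) \<bullet> w x))"
    using vdiv_diff[OF assms(1,2)]
  proof eventually_elim
    case (elim x)
    show ?case unfolding elim by (simp add: matrix_vector_mult_diff_distrib inner_diff_left algebra_simps)
  qed
qed (intro X_diff assms)+

lemma c_diff_2: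
  assumes "u \<in> X_space \<Omega>" "v1 \<in> X_space \<Omega>" "v2 \<in> X_space \<Omega>" "w \<in> X_space \<Omega>"
  shows "c_form \<Omega> u (\<lambda>x. v1 x - v2 x) w = c_form \<Omega> u v1 w - c_form \<Omega> u v2 w"
proof (rule c_form_diff_eqI)
  show "AE x in lebesgue_on \<Omega>. (vgrad \<Omega> (\<lambda>x. v1 x - v2 x) x *v u x) \<bullet> w x + 1/2 * ((vdiv \<Omega> u x *\<^sub>R (v1 x - v2 x)) \<bullet> w x)
      = ((vgrad \<Omega> v1 x *v u x) \<bullet> w x + 1/2 * ((vdiv \<Omega> u x *\<^sub>R v1 x) \<bullet> w x))
      - ((vgrad \<Omega> v2 x *v u x) \<bullet> w x + 1/2 * ((vdiv \<Omega> u x *\<^sub>R v2 x) \<bullet> w x))"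
    using vgrad_diff[OF assms(2,3)]
  proof eventually_elim
    case (elim x)
    show ?case unfolding elim by (simp add: matrix_vector_mult_diff_rdistrib inner_diff_left algebra_simps)
  qed
qed (intro X_diff assms)+

lemma c_diff_3:
  assumes "u \<in> X_space \<Omega>" "v \<in> X_space \<Omega>" "w1 \<in> X_space \<Omega>" "w2 \<in> X_space \<Omega>"
  shows "c_form \<Omega> u v (\<lambda>x. w1 x - w2 x) = c_form \<Omega> u v w1 - c_form \<Omega> u v w2"
  by (rule c_form_diff_eqI) (intro X_diff assms AE_I2 | simp add: inner_diff_right algebra_simps)+

text \<open>
  For test functions the integrand of \<open>c(\<phi>, \<eta>, \<eta>)\<close> is half the divergence of \<open>|\<eta>|\<^sup>2 \<phi>\<close>.
\<close>

lemma c_skew_test: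
  assumes \<phi>: "\<And>i. (\<lambda>x. \<phi> x $ i) \<in> test_functions \<Omega>" and \<eta>: "\<And>i. (\<lambda>x. \<eta> x $ i) \<in> test_functions \<Omega>"
  shows "c_form \<Omega> \<phi> \<eta> \<eta> = 0"
proof -
  note X = test_X[OF \<phi>] test_X[OF \<eta>]
  define F where "F i j x = \<phi> x $ j * (\<eta> x $ i * \<eta> x $ i)" for i j x
  have F_C1: "C_k (Suc 0) (F i j)" for i j
    unfolding F_def by (intro C_k_1_mult test_C1 \<phi> \<eta>)
  have F_supp: "\<exists>K. compact K \<and> K \<subseteq> \<Omega> \<and> (\<forall>x. x \<notin> K \<longrightarrow> F i j x = 0)" for i j
    by (rule test_functions_supp[OF \<phi>[of j]]) (auto simp: F_def)
  have F_zero: "(\<integral>x. partial_deriv j (F i j) x \<partial>lebesgue_on \<Omega>) = 0" for i j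
    using F_supp[of i j] integral_divergence_eq_0[OF F_C1] by blast
  have F_int: "integrable (lebesgue_on \<Omega>) (partial_deriv j (F i j))" for i j
  proof -
    obtain K where K: "compact K" "\<And>x. x \<notin> K \<Longrightarrow> F i j x = 0" using F_supp by blast
    have cont: "continuous_on UNIV (partial_deriv j (F i j))" using F_C1 by simp
    have "x \<notin> K \<Longrightarrow> partial_deriv j (F i j) x = 0" for x
      by (rule partial_deriv_zero_outside[OF compact_imp_closed[OF K(1)] K(2)])
    then obtain B where "\<And>x. \<bar>partial_deriv j (F i j) x\<bar> \<le> B"
      using compact_support_bounded[OF cont K(1)] by blast
    then have "partial_deriv j (F i j) \<in> L2 \<Omega>"
      using cont by (intro bounded_L2[OF bounded open_set]) (auto intro: borel_measurable_continuous_onI)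
    then show ?thesis by (rule L2_integrable[OF bounded open_set])
  qed
  have F_deriv: "partial_deriv j (F i j) x
      = \<phi> x $ j * (2 * (\<eta> x $ i * partial_deriv j (\<lambda>y. \<eta> y $ i) x)) + partial_deriv j (\<lambda>y. \<phi> y $ j) x * (\<eta> x $ i * \<eta> x $ i)"
    for i j x
  proof -
    have "(\<lambda>y. \<eta> y $ i * \<eta> y $ i) differentiable at x"
      using C_k_1_mult[OF test_C1 test_C1, OF \<eta>[of i] \<eta>[of i]] by simp
    then show ?thesis
      unfolding F_def by (simp add: partial_deriv_mult test_differentiable \<phi> \<eta>)
  qed
  have AE: "AE x in lebesgue_on \<Omega>. (vgrad \<Omega> \<eta> x *v \<phi> x) \<bullet> \<eta> x + 1/2 * ((vdiv \<Omega> \<phi> x *\<^sub>R \<eta> x) \<bullet> \<eta> x)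
      = 1/2 * (\<Sum>i\<in>UNIV. \<Sum>j\<in>UNIV. partial_deriv j (F i j) x)"
  proof -
    have "AE x in lebesgue_on \<Omega>. \<forall>i. weak_grad \<Omega> (\<lambda>y. \<eta> y $ i) x = (\<chi> j. partial_deriv j (\<lambda>y. \<eta> y $ i) x)"
      "AE x in lebesgue_on \<Omega>. \<forall>i. weak_grad \<Omega> (\<lambda>y. \<phi> y $ i) x = (\<chi> j. partial_deriv j (\<lambda>y. \<phi> y $ i) x)"
      by (auto simp: AE_all_countable intro: weak_grad_test \<phi> \<eta>)
    then show ?thesis
    proof eventually_elim
      case (elim x)
      have 1: "(vgrad \<Omega> \<eta> x *v \<phi> x) \<bullet> \<eta> x
          = (\<Sum>i\<in>UNIV. \<Sum>j\<in>UNIV. partial_deriv j (\<lambda>y. \<eta> y $ i) x * \<phi> x $ j * \<eta> x $ i)"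
        using elim by (simp add: inner_vec_def matrix_vector_mult_def vgrad_nth sum_distrib_right)
      have \<eta>\<eta>: "\<eta> x \<bullet> \<eta> x = (\<Sum>i\<in>UNIV. \<eta> x $ i * \<eta> x $ i)" by (simp add: inner_vec_def)
      have div: "vdiv \<Omega> \<phi> x = (\<Sum>j\<in>UNIV. partial_deriv j (\<lambda>y. \<phi> y $ j) x)"
        using elim by (simp add: vdiv_eq vgrad_nth)
      have "(vdiv \<Omega> \<phi> x *\<^sub>R \<eta> x) \<bullet> \<eta> x = (\<eta> x \<bullet> \<eta> x) * vdiv \<Omega> \<phi> x" by simp
      then have 2: "(vdiv \<Omega> \<phi> x *\<^sub>R \<eta> x) \<bullet> \<eta> x
          = (\<Sum>i\<in>UNIV. \<Sum>j\<in>UNIV. \<eta> x $ i * \<eta> x $ i * partial_deriv j (\<lambda>y. \<phi> y $ j) x)"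
        by (simp only: \<eta>\<eta> div sum_product)
      show ?case unfolding 1 2 F_deriv sum_distrib_left sum.distrib[symmetric]
        by (intro sum.cong refl) (simp add: algebra_simps)
    qed
  qed
  have int_sum: "integrable (lebesgue_on \<Omega>) (\<lambda>x. \<Sum>i\<in>UNIV. \<Sum>j\<in>UNIV. partial_deriv j (F i j) x)"
    by (intro Bochner_Integration.integrable_sum F_int)
  have "c_form \<Omega> \<phi> \<eta> \<eta> = (\<integral>x. 1/2 * (\<Sum>i\<in>UNIV. \<Sum>j\<in>UNIV. partial_deriv j (F i j) x) \<partial>lebesgue_on \<Omega>)"
    unfolding c_form_eq[OF X(1,2,2)]
    by (rule integral_cong_AE[OF _ _ AE])
       (intro borel_measurable_integrable c_form_integrable X integrable_mult_right int_sum)+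
  also have "\<dots> = 1/2 * (\<integral>x. (\<Sum>i\<in>UNIV. \<Sum>j\<in>UNIV. partial_deriv j (F i j) x) \<partial>lebesgue_on \<Omega>)"
    by simp
  also have "(\<integral>x. (\<Sum>i\<in>UNIV. \<Sum>j\<in>UNIV. partial_deriv j (F i j) x) \<partial>lebesgue_on \<Omega>)
      = (\<Sum>i\<in>UNIV. \<integral>x. (\<Sum>j\<in>UNIV. partial_deriv j (F i j) x) \<partial>lebesgue_on \<Omega>)"
    by (intro Bochner_Integration.integral_sum Bochner_Integration.integrable_sum F_int)
  also have "\<dots> = (\<Sum>i\<in>UNIV. \<Sum>j\<in>UNIV. \<integral>x. partial_deriv j (F i j) x \<partial>lebesgue_on \<Omega>)"
    by (intro sum.cong refl Bochner_Integration.integral_sum F_int)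
  finally show ?thesis by (simp add: F_zero)
qed

lemma c_abs_bound:
  assumes bound: "\<And>v1 v2 v3. v1 \<in> X_space \<Omega> \<Longrightarrow> v2 \<in> X_space \<Omega> \<Longrightarrow> v3 \<in> X_space \<Omega> \<Longrightarrow>
      c_form \<Omega> v1 v2 v3 \<le> M * grad_norm v1 * grad_norm v2 * grad_norm v3"
    and X: "u \<in> X_space \<Omega>" "v \<in> X_space \<Omega>" "w \<in> X_space \<Omega>"
  shows "\<bar>c_form \<Omega> u v w\<bar> \<le> M * grad_norm u * grad_norm v * grad_norm w"
proof -
  have "c_form \<Omega> u v (\<lambda>x. 0 - w x) = c_form \<Omega> u v (\<lambda>x. 0) - c_form \<Omega> u v w"
    by (intro c_diff_3 X X_zero)
  also have "c_form \<Omega> u v (\<lambda>x. 0) = 0" by (simp add: c_form_def L2_inner_def)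
  finally have "- c_form \<Omega> u v w = c_form \<Omega> u v (\<lambda>x. (-1) *\<^sub>R w x)" by simp
  also have "\<dots> \<le> M * grad_norm u * grad_norm v * grad_norm (\<lambda>x. (-1) *\<^sub>R w x)"
    by (intro bound X X_scale)
  also have "grad_norm (\<lambda>x. (-1) *\<^sub>R w x) = grad_norm w" using grad_norm_scale[OF X(3), of "-1"] by simp
  finally show ?thesis using bound[OF X] by linarith
qed

text \<open>
  Trilinearity and boundedness make the form continuous in the gradient norm, in which test functions
  are dense.
\<close>

theorem c_skew:
  assumes M: "M \<ge> 0" and bound: "\<And>v1 v2 v3. v1 \<in> X_space \<Omega> \<Longrightarrow> v2 \<in> X_space \<Omega> \<Longrightarrow> v3 \<in> X_space \<Omega> \<Longrightarrow>
      c_form \<Omega> v1 v2 v3 \<le> M * grad_norm v1 * grad_norm v2 * grad_norm v3"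
    and u: "u \<in> X_space \<Omega>" and v: "v \<in> X_space \<Omega>"
  shows "c_form \<Omega> u v v = 0"
proof -
  define a b where "a = grad_norm u" and "b = grad_norm v"
  have ab: "a \<ge> 0" "b \<ge> 0" by (simp_all add: a_def b_def)
  \<comment> \<open>the three arguments are replaced one after the other, each at the cost of one of these terms times \<open>\<epsilon>\<close>\<close>
  define K where "K = M * b * b + M * (a + 1) * b + M * (a + 1) * (b + 1)"
  have K: "K \<ge> 0" using M ab by (simp add: K_def)
  have small: "\<bar>c_form \<Omega> u v v\<bar> \<le> K * \<epsilon>" if \<epsilon>: "0 < \<epsilon>" "\<epsilon> \<le> 1" for \<epsilon>
  proof -
    obtain \<phi> where \<phi>: "\<And>i. (\<lambda>x. \<phi> x $ i) \<in> test_functions \<Omega>" "grad_norm (\<lambda>x. u x - \<phi> x) < \<epsilon>"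
      using X_approx[OF u \<epsilon>(1)] by blast
    obtain \<eta> where \<eta>: "\<And>i. (\<lambda>x. \<eta> x $ i) \<in> test_functions \<Omega>" "grad_norm (\<lambda>x. v x - \<eta> x) < \<epsilon>"
      using X_approx[OF v \<epsilon>(1)] by blast
    note X = test_X[OF \<phi>(1)] test_X[OF \<eta>(1)]
    note d = X_diff[OF u X(1)] X_diff[OF v X(2)]
    have norm_le: "grad_norm z \<le> grad_norm y + 1" if "y \<in> X_space \<Omega>" "z \<in> X_space \<Omega>" "grad_norm (\<lambda>x. y x - z x) < \<epsilon>" for y z
    proof -
      have "grad_norm (\<lambda>x. y x + (-1) *\<^sub>R (y x - z x)) \<le> grad_norm y + grad_norm (\<lambda>x. (-1) *\<^sub>R (y x - z x))"
        by (intro grad_norm_triangle X_scale X_diff that)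
      also have "grad_norm (\<lambda>x. (-1) *\<^sub>R (y x - z x)) = grad_norm (\<lambda>x. y x - z x)"
        using grad_norm_scale[OF X_diff[OF that(1,2)], of "-1"] by simp
      finally show ?thesis using that(3) \<epsilon>(2) by simp
    qed
    have n\<phi>: "grad_norm \<phi> \<le> a + 1" and n\<eta>: "grad_norm \<eta> \<le> b + 1"
      using norm_le[OF u X(1) \<phi>(2)] norm_le[OF v X(2) \<eta>(2)] by (simp_all add: a_def b_def)
    have "c_form \<Omega> u v v = c_form \<Omega> (\<lambda>x. u x - \<phi> x) v v + c_form \<Omega> \<phi> (\<lambda>x. v x - \<eta> x) v
        + c_form \<Omega> \<phi> \<eta> (\<lambda>x. v x - \<eta> x) + c_form \<Omega> \<phi> \<eta> \<eta>"
      using u v X by (simp add: c_diff_1 c_diff_2 c_diff_3)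
    also have "c_form \<Omega> \<phi> \<eta> \<eta> = 0" by (rule c_skew_test[OF \<phi>(1) \<eta>(1)])
    finally have "\<bar>c_form \<Omega> u v v\<bar> \<le> \<bar>c_form \<Omega> (\<lambda>x. u x - \<phi> x) v v\<bar> + \<bar>c_form \<Omega> \<phi> (\<lambda>x. v x - \<eta> x) v\<bar>
        + \<bar>c_form \<Omega> \<phi> \<eta> (\<lambda>x. v x - \<eta> x)\<bar>" by linarith
    also have "\<dots> \<le> M * grad_norm (\<lambda>x. u x - \<phi> x) * b * b + M * grad_norm \<phi> * grad_norm (\<lambda>x. v x - \<eta> x) * b
        + M * grad_norm \<phi> * grad_norm \<eta> * grad_norm (\<lambda>x. v x - \<eta> x)"
      unfolding b_def by (intro add_mono c_abs_bound[OF bound] u v X d)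
    also have "\<dots> \<le> M * \<epsilon> * b * b + M * (a + 1) * \<epsilon> * b + M * (a + 1) * (b + 1) * \<epsilon>"
      using \<phi>(2) \<eta>(2) n\<phi> n\<eta> M ab \<epsilon> by (intro add_mono mult_mono) auto
    finally show ?thesis by (simp add: K_def algebra_simps)
  qed
  have "\<bar>c_form \<Omega> u v v\<bar> \<le> 0 + e" if "e > 0" for e
  proof -
    define \<epsilon> where "\<epsilon> = min 1 (e / (K + 1))"
    have "K * \<epsilon> \<le> K * (e / (K + 1))" using K by (intro mult_left_mono) (auto simp: \<epsilon>_def)
    also have "\<dots> \<le> e" using K that by (simp add: field_simps)
    finally show ?thesis using small[of \<epsilon>] K that by (simp add: \<epsilon>_def)
  qed
  then have "\<bar>c_form \<Omega> u v v\<bar> \<le> 0" by (rule field_le_epsilon)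
  then show ?thesis by simp
qed

end

section \<open>Energy estimates for the splitting iteration\<close>

context bounded_open_set
begin

lemma Q_L2: "q \<in> Q_space \<Omega> \<Longrightarrow> q \<in> L2 \<Omega>"
  by (simp add: Q_space_def)

lemma Q_zero: "(\<lambda>x. 0) \<in> Q_space \<Omega>"
  by (simp add: Q_space_def L2_zero)

lemma Q_diff: "q \<in> Q_space \<Omega> \<Longrightarrow> r \<in> Q_space \<Omega> \<Longrightarrow> (\<lambda>x. q x - r x) \<in> Q_space \<Omega>"
  by (simp add: Q_space_def L2_diff L2_integrable[OF bounded open_set])

lemma b_diff_left:
  "q \<in> Q_space \<Omega> \<Longrightarrow> r \<in> Q_space \<Omega> \<Longrightarrow> v \<in> X_space \<Omega> \<Longrightarrow>
    b_form \<Omega> (\<lambda>x. q x - r x) v = b_form \<Omega> q v - b_form \<Omega> r v"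
  by (simp add: b_form_def L2_inner_diff_left Q_L2 vdiv_L2)

lemma b_add_right:
  "q \<in> Q_space \<Omega> \<Longrightarrow> u \<in> X_space \<Omega> \<Longrightarrow> v \<in> X_space \<Omega> \<Longrightarrow>
    b_form \<Omega> q (\<lambda>x. u x + v x) = b_form \<Omega> q u + b_form \<Omega> q v"
  using inner_vdiv_add[of u v q] by (simp add: b_form_def Q_L2 L2_inner_commute[of \<Omega> q])

lemma b_scale_right:
  "q \<in> Q_space \<Omega> \<Longrightarrow> v \<in> X_space \<Omega> \<Longrightarrow> b_form \<Omega> q (\<lambda>x. c *\<^sub>R v x) = c * b_form \<Omega> q v"
  using inner_vdiv_scale[of v q c] by (simp add: b_form_def Q_L2 L2_inner_commute[of \<Omega> q])

lemma b_diff_right: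
  "q \<in> Q_space \<Omega> \<Longrightarrow> u \<in> X_space \<Omega> \<Longrightarrow> v \<in> X_space \<Omega> \<Longrightarrow>
    b_form \<Omega> q (\<lambda>x. u x - v x) = b_form \<Omega> q u - b_form \<Omega> q v"
  using b_add_right[OF _ _ X_scale[of v "-1"]] b_scale_right[of q v "-1"] by simp

lemma pressure_grad_X_dual:
  assumes q: "q \<in> Q_space \<Omega>"
  shows "pressure_grad \<Omega> q \<in> X_dual \<Omega>"
proof -
  have "\<bar>b_form \<Omega> q v\<bar> \<le> (L2_norm \<Omega> q * real CARD('n)) * grad_norm v" if v: "v \<in> X_space \<Omega>" for v
  proof -
    have "\<bar>b_form \<Omega> q v\<bar> \<le> L2_norm \<Omega> q * L2_norm \<Omega> (vdiv \<Omega> v)"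
      using L2_Cauchy_Schwarz[OF Q_L2[OF q] vdiv_L2[OF v]] by (simp add: b_form_def)
    also have "\<dots> \<le> L2_norm \<Omega> q * (real CARD('n) * grad_norm v)"
      by (intro mult_left_mono vdiv_le_grad_norm v) simp
    finally show ?thesis by (simp add: mult.assoc)
  qed
  then show ?thesis
    unfolding X_dual_def pressure_grad_def using q by (auto simp: b_add_right b_scale_right)
qed

end

locale splitting_iteration = bounded_open_set_2_3 \<Omega> for \<Omega> :: "(real ^ 'n) set" +
  fixes \<nu> \<gamma> M :: real
    and f :: "'n functional"
    and ut us :: "nat \<Rightarrow> real ^ 'n \<Rightarrow> real ^ 'n"
    and ps :: "nat \<Rightarrow> real ^ 'n \<Rightarrow> real"
    and u :: "real ^ 'n \<Rightarrow> real ^ 'n"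
    and p :: "real ^ 'n \<Rightarrow> real"
  assumes \<nu>: "\<nu> > 0" and \<gamma>: "\<gamma> > 0" and f: "f \<in> X_dual \<Omega>" and M: "M > 0"
    and M_bound: "\<And>v1 v2 v3. v1 \<in> X_space \<Omega> \<Longrightarrow> v2 \<in> X_space \<Omega> \<Longrightarrow> v3 \<in> X_space \<Omega> \<Longrightarrow>
          c_form \<Omega> v1 v2 v3 \<le> M * grad_norm v1 * grad_norm v2 * grad_norm v3"
    and alg: "sivs_solution \<nu> \<gamma> \<Omega> f ut us ps"
    and ns: "navier_stokes_solution \<nu> \<gamma> \<Omega> f u p"
begin

abbreviation a :: "(real ^ 'n \<Rightarrow> real ^ 'n) \<Rightarrow> (real ^ 'n \<Rightarrow> real ^ 'n) \<Rightarrow> real" where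
  "a \<equiv> a_form \<nu> \<gamma> \<Omega>"

abbreviation div_norm :: "(real ^ 'n \<Rightarrow> real ^ 'n) \<Rightarrow> real" where
  "div_norm v \<equiv> L2_norm \<Omega> (vdiv \<Omega> v)"

definition e :: "nat \<Rightarrow> real ^ 'n \<Rightarrow> real ^ 'n" where "e k = (\<lambda>x. u x - us k x)"
definition et :: "nat \<Rightarrow> real ^ 'n \<Rightarrow> real ^ 'n" where "et k = (\<lambda>x. u x - ut k x)"
definition \<delta> :: "nat \<Rightarrow> real ^ 'n \<Rightarrow> real" where "\<delta> k = (\<lambda>x. p x - ps k x)"

text \<open>
  This is the Riesz representative \<open>G \<delta>\<^sub>k\<close> of the gradient of the pressure error.
\<close>

definition potential :: "nat \<Rightarrow> real ^ 'n \<Rightarrow> real ^ 'n" where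
  "potential k = X_inverse \<Omega> (L_op \<nu> \<gamma> \<Omega>) (pressure_grad \<Omega> (\<delta> k))"

lemma u_X: "u \<in> X_space \<Omega>" and p_Q: "p \<in> Q_space \<Omega>"
  using ns by (auto simp: navier_stokes_solution_def)

lemma splitting_steps:
  shows ut_X: "ut (Suc k) \<in> X_space \<Omega>" and us_Suc_X: "us (Suc k) \<in> X_space \<Omega>"
    and ps_Suc_Q: "ps (Suc k) \<in> Q_space \<Omega>"
    and step_1: "v \<in> X_space \<Omega> \<Longrightarrow>
      a (ut (Suc k)) v + c_form \<Omega> (us k) (ut (Suc k)) v + b_form \<Omega> (ps k) v = f v"
    and step_2: "v \<in> X_space \<Omega> \<Longrightarrow>
      a (\<lambda>x. us (Suc k) x - ut (Suc k) x) v + b_form \<Omega> (\<lambda>x. ps (Suc k) x - ps k x) v = 0"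
    and us_divergence_free: "q \<in> Q_space \<Omega> \<Longrightarrow> b_form \<Omega> q (us (Suc k)) = 0"
proof -
  have "1 \<le> Suc k" by simp
  note steps = alg[unfolded sivs_solution_def, THEN conjunct2, THEN conjunct2, THEN spec[of _ "Suc k"],
    THEN mp, OF this, unfolded diff_Suc_1]
  from steps show "ut (Suc k) \<in> X_space \<Omega>" by blast
  from steps show "us (Suc k) \<in> X_space \<Omega>" by (simp add: V_space_def)
  from steps show "ps (Suc k) \<in> Q_space \<Omega>" by blast
  from steps show "v \<in> X_space \<Omega> \<Longrightarrow>
      a (ut (Suc k)) v + c_form \<Omega> (us k) (ut (Suc k)) v + b_form \<Omega> (ps k) v = f v" by blast
  from steps show "v \<in> X_space \<Omega> \<Longrightarrow>
      a (\<lambda>x. us (Suc k) x - ut (Suc k) x) v + b_form \<Omega> (\<lambda>x. ps (Suc k) x - ps k x) v = 0" by blast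
  from steps show "q \<in> Q_space \<Omega> \<Longrightarrow> b_form \<Omega> q (us (Suc k)) = 0" by blast
qed

lemma us_X: "us k \<in> X_space \<Omega>" and ps_Q: "ps k \<in> Q_space \<Omega>"
proof -
  have "us k \<in> X_space \<Omega> \<and> ps k \<in> Q_space \<Omega>"
  proof (cases k)
    case 0
    then show ?thesis using alg X_zero Q_zero by (simp add: sivs_solution_def)
  next
    case (Suc j)
    then show ?thesis by (simp add: us_Suc_X ps_Suc_Q)
  qed
  then show "us k \<in> X_space \<Omega>" "ps k \<in> Q_space \<Omega>" by auto
qed


lemma e_X: "e k \<in> X_space \<Omega>" and et_X: "et (Suc k) \<in> X_space \<Omega>" and \<delta>_Q: "\<delta> k \<in> Q_space \<Omega>"
  unfolding e_def et_def \<delta>_def by (intro X_diff Q_diff u_X us_X ut_X p_Q ps_Q)+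

lemma potential_X: "potential k \<in> X_space \<Omega>" and potential: "v \<in> X_space \<Omega> \<Longrightarrow> a (potential k) v = b_form \<Omega> (\<delta> k) v"
  using L_op_inverse[OF \<nu> _ pressure_grad_X_dual[OF \<delta>_Q[of k]], of \<gamma>] \<gamma>
  by (auto simp: potential_def pressure_grad_def)

lemma L_inv_norm_sq: "(L_inv_norm \<nu> \<gamma> \<Omega> (pressure_grad \<Omega> (\<delta> k)))\<^sup>2 = a (potential k) (potential k)"
proof -
  have "pressure_grad \<Omega> (\<delta> k) (potential k) = a (potential k) (potential k)" by (simp add: potential potential_X pressure_grad_def)
  moreover have "a (potential k) (potential k) \<ge> 0" using \<nu> \<gamma> by (simp add: a_self)
  ultimately show ?thesis by (simp add: L_inv_norm_def potential_def[symmetric])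
qed

lemma error_equation:
  assumes v: "v \<in> X_space \<Omega>"
  shows "a (et (Suc k)) v + c_form \<Omega> (e k) u v + c_form \<Omega> (us k) (et (Suc k)) v + a (potential k) v = 0"
proof -
  have 1: "a (ut (Suc k)) v + c_form \<Omega> (us k) (ut (Suc k)) v + b_form \<Omega> (ps k) v = f v"
    by (rule step_1[OF v])
  have 2: "a u v + c_form \<Omega> u u v + b_form \<Omega> p v = f v"
    using ns v by (simp add: navier_stokes_solution_def)
  have "a (et (Suc k)) v = a u v - a (ut (Suc k)) v"
    unfolding et_def by (intro a_diff_left u_X ut_X v)
  moreover have "c_form \<Omega> (e k) u v = c_form \<Omega> u u v - c_form \<Omega> (us k) u v"
    unfolding e_def by (intro c_diff_1 u_X us_X v)
  moreover have "c_form \<Omega> (us k) (et (Suc k)) v = c_form \<Omega> (us k) u v - c_form \<Omega> (us k) (ut (Suc k)) v"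
    unfolding et_def by (intro c_diff_2 u_X us_X ut_X v)
  moreover have "a (potential k) v = b_form \<Omega> p v - b_form \<Omega> (ps k) v"
    unfolding potential[OF v] \<delta>_def by (intro b_diff_left p_Q ps_Q v)
  ultimately show ?thesis using 1 2 by linarith
qed

text \<open>
  Step 2 for the errors: the correction of the velocity is a difference of pressure potentials.
\<close>

lemma projection_step:
  assumes v: "v \<in> X_space \<Omega>"
  shows "a (et (Suc k)) v = a (e (Suc k)) v + a (potential (Suc k)) v - a (potential k) v"
proof -
  have "a (\<lambda>x. us (Suc k) x - ut (Suc k) x) v + b_form \<Omega> (\<lambda>x. ps (Suc k) x - ps k x) v = 0"
    by (rule step_2[OF v])
  moreover have "a (\<lambda>x. us (Suc k) x - ut (Suc k) x) v = a (us (Suc k)) v - a (ut (Suc k)) v"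
    by (intro a_diff_left us_X ut_X v)
  moreover have "b_form \<Omega> (\<lambda>x. ps (Suc k) x - ps k x) v = b_form \<Omega> (ps (Suc k)) v - b_form \<Omega> (ps k) v"
    by (intro b_diff_left ps_Q v)
  moreover have "a (et (Suc k)) v = a u v - a (ut (Suc k)) v" "a (e (Suc k)) v = a u v - a (us (Suc k)) v"
    unfolding et_def e_def by (intro a_diff_left u_X ut_X us_X v)+
  moreover have "a (potential j) v = b_form \<Omega> p v - b_form \<Omega> (ps j) v" for j
    unfolding potential[OF v] \<delta>_def by (intro b_diff_left p_Q ps_Q v)
  ultimately show ?thesis by simp
qed

text \<open>
  The exact velocity and the corrected one are both divergence free, and \<open>a(G q, v)\<close> sees only the divergence of \<open>v\<close>.
\<close>

lemma e_orthogonal: "a (potential j) (e (Suc k)) = 0"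
proof -
  have "a (potential j) (e (Suc k)) = b_form \<Omega> (\<delta> j) u - b_form \<Omega> (\<delta> j) (us (Suc k))"
    unfolding potential[OF e_X] unfolding e_def by (intro b_diff_right \<delta>_Q u_X us_X)
  moreover have "b_form \<Omega> (\<delta> j) u = 0" using ns \<delta>_Q by (simp add: navier_stokes_solution_def)
  moreover have "b_form \<Omega> (\<delta> j) (us (Suc k)) = 0" by (rule us_divergence_free[OF \<delta>_Q])
  ultimately show ?thesis by simp
qed

lemma velocity_bound: "\<nu> * grad_norm u \<le> dual_norm \<Omega> f"
proof -
  have "a u u + c_form \<Omega> u u u + b_form \<Omega> p u = f u" "b_form \<Omega> p u = 0"
    using ns by (auto simp: navier_stokes_solution_def)
  moreover have "c_form \<Omega> u u u = 0" using c_skew[OF _ M_bound u_X u_X] M by simp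
  moreover have "0 \<le> \<gamma> * (div_norm u)\<^sup>2" using \<gamma> by simp
  ultimately have "\<nu> * (grad_norm u)\<^sup>2 \<le> f u" unfolding a_self by linarith
  also have "f u \<le> dual_norm \<Omega> f * grad_norm u" using dual_norm_bound(1)[OF f u_X] by simp
  finally have "(\<nu> * grad_norm u) * grad_norm u \<le> dual_norm \<Omega> f * grad_norm u" by (simp add: power2_eq_square)
  then show ?thesis
    using dual_norm_bound(2)[OF f] L2_norm_nonneg[of \<Omega> "vgrad \<Omega> u"]
    by (cases "grad_norm u = 0") (auto simp: mult_le_cancel_right)
qed

text \<open>
  The three quantities whose weighted sum contracts: the error of the corrected velocity, the
  intermediate dissipation, and the error of the pressure.
\<close>

definition vel_energy :: "nat \<Rightarrow> real" where "vel_energy k = \<nu> * (grad_norm (e k))\<^sup>2"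
definition mid_energy :: "nat \<Rightarrow> real" where
  "mid_energy k = \<nu> / 4 * (grad_norm (et k))\<^sup>2 + \<gamma> / 2 * ((div_norm (et k))\<^sup>2 + (div_norm (e k))\<^sup>2)"
definition pres_energy :: "nat \<Rightarrow> real" where "pres_energy k = a (potential k) (potential k)"

lemma vel_energy_nonneg: "vel_energy k \<ge> 0" and mid_energy_nonneg: "mid_energy k \<ge> 0" and pres_energy_nonneg: "pres_energy k \<ge> 0"
  using \<nu> \<gamma> by (simp_all add: vel_energy_def mid_energy_def pres_energy_def a_self)

text \<open>
  Testing the error equation with \<open>et (Suc k)\<close>. Polarisation of the projection step expresses the
  pressure term through energies; the constants come from splitting
  \<open>\<nu> \<Lambda> \<parallel>\<nabla>e\<parallel> \<parallel>\<nabla>et\<parallel>\<close> into \<open>\<nu> \<Lambda>\<^sup>2 \<parallel>\<nabla>e\<parallel>\<^sup>2\<close> and \<open>\<nu>/4 \<parallel>\<nabla>et\<parallel>\<^sup>2\<close>, which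
  the left-hand side absorbs.
\<close>

lemma energy_estimate:
  "mid_energy (Suc k) + vel_energy (Suc k) / 2 + pres_energy (Suc k) / 2 \<le> pres_energy k / 2 + (M * dual_norm \<Omega> f / \<nu>\<^sup>2)\<^sup>2 * vel_energy k"
proof -
  define \<Lambda> where "\<Lambda> = M * dual_norm \<Omega> f / \<nu>\<^sup>2"
  define X Y where "X = et (Suc k)" and "Y = e (Suc k)"
  note XY = et_X[of k, folded X_def] e_X[of "Suc k", folded Y_def]
  note proj = projection_step[of _ k, folded X_def Y_def]
  have orth: "a (potential j) Y = 0" "a Y (potential j) = 0" for j
    using e_orthogonal[of j k] by (simp_all add: Y_def a_commute)
  have comm: "a X Y = a Y X" "a X (potential j) = a (potential j) X" "a (potential (Suc k)) (potential k) = a (potential k) (potential (Suc k))" for j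
    by (rule a_commute)+
  have XX: "a X X = a Y Y + pres_energy (Suc k) - 2 * a (potential k) (potential (Suc k)) + pres_energy k"
    using proj[OF XY(1)] proj[OF XY(2)] proj[OF potential_X[of "Suc k"]] proj[OF potential_X[of k]]
      comm(1) comm(2)[of k] comm(2)[of "Suc k"] comm(3) orth[of k] orth[of "Suc k"]
    unfolding pres_energy_def by linarith
  have potential_X: "a (potential k) X = a (potential k) (potential (Suc k)) - pres_energy k"
    using proj[OF potential_X[of k]] comm(2)[of k] comm(3) orth(2)[of k] unfolding pres_energy_def by linarith
  have "c_form \<Omega> (us k) X X = 0" using c_skew[OF _ M_bound us_X XY(1)] M by simp
  then have "a X X + c_form \<Omega> (e k) u X + a (potential k) X = 0"
    using error_equation[OF XY(1), of k] by (simp add: X_def)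
  then have id: "a X X / 2 + a Y Y / 2 + pres_energy (Suc k) / 2 = pres_energy k / 2 - c_form \<Omega> (e k) u X"
    using XX potential_X by (simp add: field_simps)
  have "M * grad_norm u \<le> \<nu> * \<Lambda>"
    using mult_left_mono[OF velocity_bound, of "M / \<nu>"] M \<nu> by (simp add: \<Lambda>_def field_simps power2_eq_square)
  then have "M * grad_norm u * (grad_norm (e k) * grad_norm X) \<le> \<nu> * \<Lambda> * (grad_norm (e k) * grad_norm X)"
    by (rule mult_right_mono) simp
  moreover have "- c_form \<Omega> (e k) u X \<le> M * grad_norm u * (grad_norm (e k) * grad_norm X)"
    using c_abs_bound[OF M_bound e_X u_X XY(1), of k] by (simp add: mult_ac)
  moreover have "\<nu> * \<Lambda> * (grad_norm (e k) * grad_norm X) \<le> \<Lambda>\<^sup>2 * vel_energy k + \<nu> / 4 * (grad_norm X)\<^sup>2"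
  proof -
    have "0 \<le> \<nu> * (\<Lambda> * grad_norm (e k) - grad_norm X / 2)\<^sup>2" using \<nu> by simp
    then show ?thesis by (simp add: vel_energy_def power2_diff power_mult_distrib power_divide algebra_simps)
  qed
  ultimately have "- c_form \<Omega> (e k) u X \<le> \<Lambda>\<^sup>2 * vel_energy k + \<nu> / 4 * (grad_norm X)\<^sup>2" by linarith
  with id have "\<nu> / 4 * (grad_norm X)\<^sup>2 + \<gamma> / 2 * (div_norm X)\<^sup>2 + \<nu> / 2 * (grad_norm Y)\<^sup>2 + \<gamma> / 2 * (div_norm Y)\<^sup>2
      + pres_energy (Suc k) / 2 \<le> pres_energy k / 2 + \<Lambda>\<^sup>2 * vel_energy k"
    by (simp add: a_self add_divide_distrib)
  then show ?thesis by (simp add: vel_energy_def mid_energy_def X_def Y_def \<Lambda>_def algebra_simps)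
qed

text \<open>
  For \<open>\<Lambda>\<^sup>2 \<le> 1/2\<close> the energy estimate makes the sum of velocity and pressure energy nonincreasing.
\<close>

lemma velocities_bounded:
  assumes small: "(M * dual_norm \<Omega> f / \<nu>\<^sup>2)\<^sup>2 \<le> 1 / 2"
  obtains R where "R \<ge> 0" "\<And>k. grad_norm (us k) \<le> R"
proof -
  have dec: "vel_energy k + pres_energy k \<le> vel_energy 0 + pres_energy 0" for k
  proof (induction k)
    case (Suc k)
    have "(M * dual_norm \<Omega> f / \<nu>\<^sup>2)\<^sup>2 * vel_energy k \<le> 1 / 2 * vel_energy k"
      by (rule mult_right_mono[OF small vel_energy_nonneg])
    then show ?case using energy_estimate[of k] mid_energy_nonneg[of "Suc k"] Suc by linarith
  qed simp
  define r where "r = sqrt ((vel_energy 0 + pres_energy 0) / \<nu>)"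
  have "grad_norm (us k) \<le> grad_norm u + r" for k
  proof -
    have "(grad_norm (e k))\<^sup>2 \<le> (vel_energy 0 + pres_energy 0) / \<nu>"
      using dec[of k] pres_energy_nonneg[of k] \<nu> by (simp add: vel_energy_def field_simps)
    then have "grad_norm (e k) \<le> r" unfolding r_def by (rule real_le_rsqrt)
    moreover have "grad_norm (us k) \<le> grad_norm u + grad_norm (\<lambda>x. (-1) *\<^sub>R e k x)"
      using grad_norm_triangle[OF u_X X_scale[OF e_X, of "-1" k]] by (simp add: e_def)
    moreover have "grad_norm (\<lambda>x. (-1) *\<^sub>R e k x) = grad_norm (e k)"
      using grad_norm_scale[OF e_X, of "-1" k] by simp
    ultimately show ?thesis by simp
  qed
  moreover have "0 \<le> grad_norm u + r" using vel_energy_nonneg[of 0] pres_energy_nonneg[of 0] \<nu> by (simp add: r_def)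
  ultimately show ?thesis using that by blast
qed

text \<open>
  Testing the error equation with the pressure potential itself: its energy is bounded by the energies of
  the velocity errors times its gradient norm, which coercivity controls by the square root of the same energy.
\<close>

lemma pressure_estimate:
  assumes small: "(M * dual_norm \<Omega> f / \<nu>\<^sup>2)\<^sup>2 \<le> 1 / 2"
  obtains K where "K > 0" "\<And>k. pres_energy k \<le> K * (mid_energy (Suc k) + vel_energy k)"
proof -
  obtain R where R: "R \<ge> 0" "\<And>k. grad_norm (us k) \<le> R" using velocities_bounded[OF small] by blast
  define C where "C = \<nu> + \<gamma> * (real CARD('n))\<^sup>2 + M * R"
  define C' where "C' = M * grad_norm u"
  have C: "C \<ge> 0" "C' \<ge> 0" using \<nu> \<gamma> M R by (simp_all add: C_def C'_def)
  \<comment> \<open>from \<open>(s + t)\<^sup>2 \<le> 2 s\<^sup>2 + 2 t\<^sup>2\<close> and \<open>\<nu> \<parallel>\<nabla>et\<parallel>\<^sup>2 \<le> 4 mid_energy\<close>; the summand \<open>1\<close> makes \<open>K\<close> positive\<close>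
  define K where "K = (8 * C\<^sup>2 + 2 * C'\<^sup>2) / \<nu>\<^sup>2 + 1"
  have "pres_energy k \<le> K * (mid_energy (Suc k) + vel_energy k)" for k
  proof -
    define x g \<epsilon> where "x = grad_norm (et (Suc k))" and "g = grad_norm (potential k)" and "\<epsilon> = grad_norm (e k)"
    have nn: "x \<ge> 0" "g \<ge> 0" "\<epsilon> \<ge> 0" by (simp_all add: x_def g_def \<epsilon>_def)
    have "pres_energy k = - a (et (Suc k)) (potential k) - c_form \<Omega> (e k) u (potential k) - c_form \<Omega> (us k) (et (Suc k)) (potential k)"
      using error_equation[OF potential_X, of k k] by (simp add: pres_energy_def)
    also have "\<dots> \<le> \<bar>a (et (Suc k)) (potential k)\<bar> + \<bar>c_form \<Omega> (e k) u (potential k)\<bar> + \<bar>c_form \<Omega> (us k) (et (Suc k)) (potential k)\<bar>"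
      by linarith
    also have "\<dots> \<le> (\<nu> + \<gamma> * (real CARD('n))\<^sup>2) * x * g + M * \<epsilon> * grad_norm u * g + M * grad_norm (us k) * x * g"
      unfolding x_def g_def \<epsilon>_def using \<nu> \<gamma>
      by (intro add_mono a_bound c_abs_bound[OF M_bound] et_X e_X us_X u_X potential_X) auto
    also have "M * grad_norm (us k) * x * g \<le> M * R * x * g"
      using M R nn by (intro mult_right_mono mult_left_mono) auto
    finally have Dg: "pres_energy k \<le> (C * x + C' * \<epsilon>) * g" by (simp add: C_def C'_def algebra_simps)
    have "\<nu> * g\<^sup>2 \<le> pres_energy k" using \<gamma> by (simp add: pres_energy_def g_def a_self)
    with Dg have gg: "\<nu> * g * g \<le> (C * x + C' * \<epsilon>) * g" by (simp add: power2_eq_square)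
    have "\<nu> * g \<le> C * x + C' * \<epsilon>"
      using gg nn C by (cases "g = 0") (auto simp: mult_le_cancel_right)
    then have "(C * x + C' * \<epsilon>) * (\<nu> * g) \<le> (C * x + C' * \<epsilon>) * (C * x + C' * \<epsilon>)"
      using nn C by (intro mult_left_mono) auto
    moreover have "\<nu> * pres_energy k \<le> (C * x + C' * \<epsilon>) * (\<nu> * g)"
      using mult_left_mono[OF Dg, of \<nu>] \<nu> by (simp add: mult_ac)
    ultimately have "\<nu> * pres_energy k \<le> (C * x + C' * \<epsilon>)\<^sup>2" unfolding power2_eq_square by linarith
    also have "\<dots> \<le> 2 * (C * x)\<^sup>2 + 2 * (C' * \<epsilon>)\<^sup>2"
      using zero_le_power2[of "C * x - C' * \<epsilon>"] unfolding power2_diff power2_sum by linarith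
    finally have "\<nu> * pres_energy k \<le> 2 * C\<^sup>2 * x\<^sup>2 + 2 * C'\<^sup>2 * \<epsilon>\<^sup>2" by (simp add: power_mult_distrib)
    then have "\<nu> * (\<nu> * pres_energy k) \<le> \<nu> * (2 * C\<^sup>2 * x\<^sup>2 + 2 * C'\<^sup>2 * \<epsilon>\<^sup>2)"
      using \<nu> by (intro mult_left_mono) auto
    also have "\<dots> = 2 * C\<^sup>2 * (\<nu> * x\<^sup>2) + 2 * C'\<^sup>2 * vel_energy k" by (simp add: vel_energy_def \<epsilon>_def algebra_simps)
    also have "\<dots> \<le> 2 * C\<^sup>2 * (4 * mid_energy (Suc k)) + 2 * C'\<^sup>2 * vel_energy k"
    proof -
      have "\<nu> * x\<^sup>2 \<le> 4 * mid_energy (Suc k)" using \<gamma> by (simp add: mid_energy_def x_def field_simps)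
      then have "2 * C\<^sup>2 * (\<nu> * x\<^sup>2) \<le> 2 * C\<^sup>2 * (4 * mid_energy (Suc k))" by (intro mult_left_mono) auto
      then show ?thesis by simp
    qed
    also have "\<dots> \<le> (8 * C\<^sup>2 + 2 * C'\<^sup>2) * (mid_energy (Suc k) + vel_energy k)"
      using vel_energy_nonneg[of k] mid_energy_nonneg[of "Suc k"] by (simp add: algebra_simps)
    finally have "pres_energy k \<le> (8 * C\<^sup>2 + 2 * C'\<^sup>2) / \<nu>\<^sup>2 * (mid_energy (Suc k) + vel_energy k)"
      using \<nu> by (simp add: field_simps power2_eq_square)
    then show ?thesis using vel_energy_nonneg[of k] mid_energy_nonneg[of "Suc k"] by (simp add: K_def distrib_right)
  qed
  moreover have "K > 0" by (simp add: K_def add_nonneg_pos)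
  ultimately show ?thesis using that by blast
qed

end

text \<open>
  The energy estimate damps \<open>A\<close> but not \<open>D\<close>. Trading a fraction \<open>\<theta>\<close> of the dissipation \<open>B (Suc k)\<close> for
  \<open>\<theta>/K\<close> times \<open>D k\<close>, by the pressure estimate, damps \<open>D\<close> and costs only \<open>\<theta> * A k\<close>.
\<close>

lemma contraction_of_coupled_estimates:
  fixes A B D :: "nat \<Rightarrow> real"
  assumes nonneg: "\<And>k. A k \<ge> 0" "\<And>k. B k \<ge> 0" "\<And>k. D k \<ge> 0"
    and q: "0 \<le> q" "q < 1 / 2" and K: "K > 0"
    and energy: "\<And>k. B (Suc k) + A (Suc k) / 2 + D (Suc k) / 2 \<le> D k / 2 + q * A k"
    and pressure: "\<And>k. D k \<le> K * (B (Suc k) + A k)"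
  obtains \<theta> \<tau> where "0 < \<theta>" "\<theta> < 1" "0 < \<tau>" "\<tau> < 1"
    "\<And>k. A (Suc k) / 2 + (1 - \<theta>) * B (Suc k) + D (Suc k) / 2 \<le> \<tau> * (A k / 2 + (1 - \<theta>) * B k + D k / 2)"
proof -
  \<comment> \<open>small enough for \<open>q + \<theta> < 1/2\<close> and for \<open>1 - 2 \<theta> / K\<close> to stay positive\<close>
  define \<theta> where "\<theta> = min ((1 / 2 - q) / 2) (K / 4)"
  define \<tau> where "\<tau> = max (1 - 2 * \<theta> / K) (2 * (q + \<theta>))"
  have \<theta>: "0 < \<theta>" "\<theta> < 1" "q + \<theta> < 1 / 2" using q K by (auto simp: \<theta>_def min_def field_simps)
  have \<tau>: "0 < \<tau>" "\<tau> < 1" using q K \<theta> by (auto simp: \<tau>_def less_max_iff_disj)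
  have "A (Suc k) / 2 + (1 - \<theta>) * B (Suc k) + D (Suc k) / 2 \<le> \<tau> * (A k / 2 + (1 - \<theta>) * B k + D k / 2)" for k
  proof -
    have "\<theta> / K * D k \<le> \<theta> / K * (K * (B (Suc k) + A k))"
      using \<theta> K by (intro mult_left_mono pressure) auto
    then have "\<theta> / K * D k \<le> \<theta> * B (Suc k) + \<theta> * A k" using K by (simp add: field_simps)
    then have "A (Suc k) / 2 + (1 - \<theta>) * B (Suc k) + D (Suc k) / 2
        \<le> 2 * (q + \<theta>) * (A k / 2) + (1 - 2 * \<theta> / K) * (D k / 2)"
      using energy[of k] by (simp add: algebra_simps)
    also have "\<dots> \<le> \<tau> * (A k / 2) + \<tau> * (D k / 2)"
      using nonneg by (intro add_mono mult_right_mono) (auto simp: \<tau>_def)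
    also have "\<dots> \<le> \<tau> * (A k / 2) + \<tau> * (D k / 2) + \<tau> * ((1 - \<theta>) * B k)"
      using nonneg \<tau> \<theta> by simp
    finally show ?thesis by (simp add: algebra_simps)
  qed
  then show ?thesis using that \<theta> \<tau> by blast
qed

theorem theorem6:
  fixes \<Omega> :: "(real ^ 'n) set"
    and \<nu> \<gamma> M :: real
    and f :: "'n functional"
    and ut us :: "nat \<Rightarrow> real ^ 'n \<Rightarrow> real ^ 'n"
    and ps :: "nat \<Rightarrow> real ^ 'n \<Rightarrow> real"
    and u :: "real ^ 'n \<Rightarrow> real ^ 'n"
    and p :: "real ^ 'n \<Rightarrow> real"
  assumes dim: "CARD('n) = 2 \<or> CARD('n) = 3"
    and dom: "bounded \<Omega>" "connected \<Omega>" "open \<Omega>" "lipschitz_boundary \<Omega>"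
    and par: "\<nu> > 0" "\<gamma> > 0"
    and f: "f \<in> X_dual \<Omega>"
    and M_pos: "M > 0"
    and M_bound: "\<And>v1 v2 v3. v1 \<in> X_space \<Omega> \<Longrightarrow> v2 \<in> X_space \<Omega> \<Longrightarrow> v3 \<in> X_space \<Omega> \<Longrightarrow>
          c_form \<Omega> v1 v2 v3
            \<le> M * L2_norm \<Omega> (vgrad \<Omega> v1) * L2_norm \<Omega> (vgrad \<Omega> v2) * L2_norm \<Omega> (vgrad \<Omega> v3)"
    and alg: "sivs_solution \<nu> \<gamma> \<Omega> f ut us ps"
    and small: "M * dual_norm \<Omega> f / \<nu>\<^sup>2 < 1 / sqrt 2"
    and ns: "navier_stokes_solution \<nu> \<gamma> \<Omega> f u p"
  shows "\<exists>\<omega>1 > 0. \<exists>\<omega>2 > 0. \<exists>\<omega>3 > 0. \<exists>\<tau> > 0. \<tau> < 1 \<and>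
    (let e = (\<lambda>k x. u x - us k x);
         et = (\<lambda>k x. u x - ut k x);
         \<delta> = (\<lambda>k x. p x - ps k x);
         \<psi> = (\<lambda>k. \<omega>1 * (L2_norm \<Omega> (vgrad \<Omega> (e k)))\<^sup>2
                 + \<omega>2 * (\<nu> / 4 * (L2_norm \<Omega> (vgrad \<Omega> (et k)))\<^sup>2
                         + \<gamma> / 2 * ((L2_norm \<Omega> (vdiv \<Omega> (et k)))\<^sup>2 + (L2_norm \<Omega> (vdiv \<Omega> (e k)))\<^sup>2))
                 + \<omega>3 * (L_inv_norm \<nu> \<gamma> \<Omega> (pressure_grad \<Omega> (\<delta> k)))\<^sup>2)
     in \<forall>k \<ge> 1. \<psi> (k + 1) \<le> \<tau> * \<psi> k)"
proof -
  interpret splitting_iteration \<Omega> \<nu> \<gamma> M f ut us ps u p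
    by unfold_locales (fact dom dim par f M_pos M_bound alg ns)+
  define q where "q = (M * dual_norm \<Omega> f / \<nu>\<^sup>2)\<^sup>2"
  have "q < (1 / sqrt 2)\<^sup>2"
    unfolding q_def using small dual_norm_bound(2)[OF f] M_pos
    by (intro power_strict_mono) auto
  then have q: "0 \<le> q" "q < 1 / 2" by (simp_all add: q_def power_divide)
  obtain K where K: "K > 0" "\<And>k. pres_energy k \<le> K * (mid_energy (Suc k) + vel_energy k)"
    using pressure_estimate q(2) unfolding q_def by (metis less_imp_le)
  obtain \<theta> \<tau> where \<theta>: "0 < \<theta>" "\<theta> < 1" and \<tau>: "0 < \<tau>" "\<tau> < 1"
    and contr: "\<And>k. vel_energy (Suc k) / 2 + (1 - \<theta>) * mid_energy (Suc k) + pres_energy (Suc k) / 2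
      \<le> \<tau> * (vel_energy k / 2 + (1 - \<theta>) * mid_energy k + pres_energy k / 2)"
    using contraction_of_coupled_estimates[of vel_energy mid_energy pres_energy q K, OF vel_energy_nonneg mid_energy_nonneg pres_energy_nonneg q K(1) energy_estimate[folded q_def] K(2)]
    by blast
  have \<psi>: "\<nu> / 2 * (L2_norm \<Omega> (vgrad \<Omega> (\<lambda>x. u x - us k x)))\<^sup>2
        + (1 - \<theta>) * (\<nu> / 4 * (L2_norm \<Omega> (vgrad \<Omega> (\<lambda>x. u x - ut k x)))\<^sup>2
            + \<gamma> / 2 * ((L2_norm \<Omega> (vdiv \<Omega> (\<lambda>x. u x - ut k x)))\<^sup>2 + (L2_norm \<Omega> (vdiv \<Omega> (\<lambda>x. u x - us k x)))\<^sup>2))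
        + 1 / 2 * (L_inv_norm \<nu> \<gamma> \<Omega> (pressure_grad \<Omega> (\<lambda>x. p x - ps k x)))\<^sup>2
      = vel_energy k / 2 + (1 - \<theta>) * mid_energy k + pres_energy k / 2" for k
    unfolding vel_energy_def mid_energy_def pres_energy_def L_inv_norm_sq[symmetric] e_def et_def \<delta>_def by simp
  show ?thesis
    unfolding Let_def
  proof (rule exI[of _ "\<nu> / 2"], intro conjI, use par in simp,
      rule exI[of _ "1 - \<theta>"], intro conjI, use \<theta> in simp,
      rule exI[of _ "1 / 2"], intro conjI, simp,
      rule exI[of _ \<tau>], intro conjI \<tau> allI impI)
    fix k :: nat
    show "\<nu> / 2 * (L2_norm \<Omega> (vgrad \<Omega> (\<lambda>x. u x - us (k + 1) x)))\<^sup>2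
        + (1 - \<theta>) * (\<nu> / 4 * (L2_norm \<Omega> (vgrad \<Omega> (\<lambda>x. u x - ut (k + 1) x)))\<^sup>2
            + \<gamma> / 2 * ((L2_norm \<Omega> (vdiv \<Omega> (\<lambda>x. u x - ut (k + 1) x)))\<^sup>2 + (L2_norm \<Omega> (vdiv \<Omega> (\<lambda>x. u x - us (k + 1) x)))\<^sup>2))
        + 1 / 2 * (L_inv_norm \<nu> \<gamma> \<Omega> (pressure_grad \<Omega> (\<lambda>x. p x - ps (k + 1) x)))\<^sup>2
      \<le> \<tau> * (\<nu> / 2 * (L2_norm \<Omega> (vgrad \<Omega> (\<lambda>x. u x - us k x)))\<^sup>2
        + (1 - \<theta>) * (\<nu> / 4 * (L2_norm \<Omega> (vgrad \<Omega> (\<lambda>x. u x - ut k x)))\<^sup>2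
            + \<gamma> / 2 * ((L2_norm \<Omega> (vdiv \<Omega> (\<lambda>x. u x - ut k x)))\<^sup>2 + (L2_norm \<Omega> (vdiv \<Omega> (\<lambda>x. u x - us k x)))\<^sup>2))
        + 1 / 2 * (L_inv_norm \<nu> \<gamma> \<Omega> (pressure_grad \<Omega> (\<lambda>x. p x - ps k x)))\<^sup>2)"
      unfolding \<psi> using contr[of k] by simp
  qed
qed

end
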